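(* Let $b>0$ be fixed. There exist constants $\delta_0,\delta_1>0$ such that the following statements hold for all $\epsilon=(\epsilon_1,\epsilon_2)\in \mathbb{B}_{\delta_0}(0;\mathbb{R}^2)$: (i) the steady state equation $$\Bigl(H-\tfrac{\epsilon_1\cos\theta}{3}H^3\Bigr)+bH^3\bigl(H'+H'''\bigr)+\epsilon_2\sin(\theta)H^3H'=1,\qquad \theta\in S^1,$$ (where $'=\partial_\theta$ and $H^j$ denotes the $j$-th power) admits a unique solution $H(\cdot)=H(\cdot;\epsilon)$ satisfying $\|H(\cdot;\epsilon)-\mathbb{1}\|_{\mathcal{H}^4(S^1)}<\delta_1$; (ii) the $\mathcal{H}^4(S^1)$-valued map $\epsilon\mapsto H(\cdot;\epsilon)$ is real analytic in $\mathbb{B}_{\delta_0}(0;\mathbb{R}^2)$; (iii) $\min_{\theta\in S^1}|H(\theta;\epsilon)|>0$; (iv) the first terms of the Maclaurin series of the $\mathcal{H}^4(S^1)$-valued map $\epsilon\mapsto H(\cdot;\epsilon)$ are given by $H(\theta;\epsilon)=\mathbb{1}+\frac{\epsilon_1}{3}\cos(\theta)+O(|\epsilon|^2)$ as $\epsilon\to0$.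
   Context: $S^1=\mathbb{R}\ (\mathrm{mod}\ 2\pi)$, so functions on $S^1$ are $2\pi$-periodic functions of $\theta$. $\mathcal{H}^k(S^1)=W^{k,2}(S^1)$ is the real Hilbertian Sobolev space, with norm $\|v\|_{\mathcal{H}^k}=\bigl(\sum_{n\in\mathbb{Z}}|v_n|^2(n^{2k}+1)\bigr)^{1/2}$ for $v=\sum_n v_ne^{\mathrm{i}n\theta}$. $\mathbb{1}$ is the constant function equal to $1$. $\mathbb{B}_r(0;\mathbb{R}^2)$ is the open ball of radius $r$ in $\mathbb{R}^2$ centered at $0$. *)

theory Defs
  imports "HOL-Analysis.Analysis" "HOL-Library.Landau_Symbols"
begin

definition fourier_coeff :: "(real \<Rightarrow> real) \<Rightarrow> int \<Rightarrow> complex" where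
  "fourier_coeff v n =
     integral {0..2*pi} (\<lambda>\<theta>. complex_of_real (v \<theta>) * cis (- (real_of_int n * \<theta>))) / complex_of_real (2*pi)"

text \<open>
  The real Sobolev space of order \<open>k \<ge> 1\<close> on the circle. Functions on the circle are
  \<open>2\<pi>\<close>-periodic functions on the line, and each Sobolev class is represented by its unique
  continuous member, which exists because \<open>k \<ge> 1\<close> (for \<open>k = 0\<close> the set below is not all of
  \<open>L\<^sup>2\<close>). Equality of classes is thus equality of functions.
\<close>

definition sobolev :: "nat \<Rightarrow> (real \<Rightarrow> real) set" where
  "sobolev k = {v. continuous_on UNIV v \<and> (\<forall>\<theta>. v (\<theta> + 2*pi) = v \<theta>) \<and>
     (\<lambda>n::int. (cmod (fourier_coeff v n))\<^sup>2 * (real_of_int n ^ (2*k) + 1)) summable_on UNIV}"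

text \<open>Only meaningful on \<open>sobolev k\<close>: \<open>infsum\<close> is \<open>0\<close> for a family that is not summable.\<close>

definition sobolev_norm :: "nat \<Rightarrow> (real \<Rightarrow> real) \<Rightarrow> real" where
  "sobolev_norm k v =
     sqrt (\<Sum>\<^sub>\<infinity>n::int. (cmod (fourier_coeff v n))\<^sup>2 * (real_of_int n ^ (2*k) + 1))"

text \<open>
  The values of \<open>H\<close> on the ball of radius \<open>r\<close> about \<open>c\<close> lie in the Sobolev space and are the sums
  of the double power series with Sobolev coefficients \<open>a j l\<close>, the series being absolutely
  convergent, and converging to \<open>H \<epsilon>\<close>, in the Sobolev norm.
\<close>

definition has_sobolev_power_series ::
  "nat \<Rightarrow> (real^2 \<Rightarrow> real \<Rightarrow> real) \<Rightarrow> real^2 \<Rightarrow> real \<Rightarrow> (nat \<Rightarrow> nat \<Rightarrow> real \<Rightarrow> real) \<Rightarrow> bool" where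
  "has_sobolev_power_series k H c r a \<longleftrightarrow>
     (\<forall>j l. a j l \<in> sobolev k) \<and>
     (\<forall>\<epsilon>\<in>ball c r. H \<epsilon> \<in> sobolev k \<and>
        (\<lambda>(j, l). sobolev_norm k (a j l) * \<bar>\<epsilon>$1 - c$1\<bar> ^ j * \<bar>\<epsilon>$2 - c$2\<bar> ^ l) summable_on UNIV \<and>
        ((\<lambda>F. sobolev_norm k
             (\<lambda>\<theta>. H \<epsilon> \<theta> - (\<Sum>(j, l)\<in>F. (\<epsilon>$1 - c$1) ^ j * (\<epsilon>$2 - c$2) ^ l * a j l \<theta>)))
           \<longlongrightarrow> 0) (finite_subsets_at_top UNIV))"

text \<open>Real analyticity, on an open set \<open>S\<close> of parameters, of a map with Sobolev values.\<close>

definition sobolev_real_analytic_on ::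
  "nat \<Rightarrow> (real^2 \<Rightarrow> real \<Rightarrow> real) \<Rightarrow> (real^2) set \<Rightarrow> bool" where
  "sobolev_real_analytic_on k H S \<longleftrightarrow>
     (\<forall>c\<in>S. \<exists>r>0. ball c r \<subseteq> S \<and> (\<exists>a. has_sobolev_power_series k H c r a))"

text \<open>
  Used only for \<open>h \<in> sobolev 4\<close>; such \<open>h\<close> is three times continuously differentiable, so the
  derivatives are classical and the equation is required at every point.
\<close>

definition steady_state :: "real \<Rightarrow> real^2 \<Rightarrow> (real \<Rightarrow> real) \<Rightarrow> bool" where
  "steady_state b \<epsilon> h \<longleftrightarrow>
     (\<forall>\<theta>. (h \<theta> - \<epsilon>$1 * cos \<theta> / 3 * h \<theta> ^ 3)
        + b * h \<theta> ^ 3 * (deriv h \<theta> + (deriv ^^ 3) h \<theta>)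
        + \<epsilon>$2 * sin \<theta> * h \<theta> ^ 3 * deriv h \<theta> = 1)"

definition solution_near_one :: "real \<Rightarrow> real \<Rightarrow> real^2 \<Rightarrow> (real \<Rightarrow> real) \<Rightarrow> bool" where
  "solution_near_one b \<delta> \<epsilon> h \<longleftrightarrow>
     h \<in> sobolev 4 \<and> steady_state b \<epsilon> h \<and> sobolev_norm 4 (\<lambda>\<theta>. h \<theta> - 1) < \<delta>"

end

theory Submission
  imports Defs
begin

text \<open>
  Write \<open>H = 1 + u\<close> and \<open>L u = u + b (u' + u''')\<close>. The equation reads \<open>L u = N(\<epsilon>, u)\<close> with \<open>N\<close> polynomial and
  small near \<open>0\<close>, and \<open>L\<close> gains three derivatives, since its symbol \<open>1 + \<i> b (n - n\<^sup>3)\<close> is bounded below by a multiple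
  of \<open>1 + \<bar>n\<bar>\<^sup>3\<close>. Hence \<open>g = L u\<close> solves a fixed point equation that is a contraction in any Banach algebra
  on which \<open>L\<^sup>-\<^sup>1\<close>, \<open>\<partial> L\<^sup>-\<^sup>1\<close> and \<open>\<partial>\<^sup>3 L\<^sup>-\<^sup>1\<close> act boundedly, such as a weighted \<open>\<ell>\<^sup>1\<close> algebra of Fourier
  coefficients. These algebras sandwich the Sobolev space: for \<open>H\<close> in \<open>sobolev 4\<close> the coefficients of \<open>g\<close> are
  summable, which gives uniqueness in the unweighted algebra, whereas \<open>g\<close> in the algebra with weight \<open>1 + \<bar>n\<bar>\<close>
  yields \<open>H\<close> in \<open>sobolev 4\<close>. For existence the contraction is run in an algebra of absolutely
  convergent power series in the increments of \<open>\<epsilon>\<close> around an arbitrary centre, so its fixed point is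
  the power series expansion of the solution. Finally, a zero of \<open>H\<close> would turn the equation into \<open>0 = 1\<close>.
\<close>

section \<open>Weighted Wiener algebras\<close>

text \<open>The choice of algebra replaces an implicit function theorem: the parameter increments
  become extra indices beside the frequency, so one fixed point carries all Taylor coefficients
  together with their norms, and inserting parameter values is an algebra homomorphism. Absolutely
  summable coefficients are used for \<open>g\<close> because products, completeness and sums over
  degrees then rest on the triangle inequality alone. The price is that neither algebra is the exact
  image of the Sobolev space, hence two weights and two radii: the uniqueness radius is fixed first,
  through the embedding into the larger algebra, and \<epsilon> is then made so small that the
  constructed solution falls inside it. Expansions at different centres come from separate fixed
  points; uniqueness identifies them. Real values and vanishing at the centre are closed conditions
  preserved by the iteration, so the fixed point inherits them. The linear term in \<epsilon> is
  free of b since n - n^3 vanishes at the frequencies 1 and -1 of the forcing, and free of the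
  second parameter since that one multiplies H', itself of first order.\<close>

lemma has_sum_fibre:
  fixes F :: "'p \<Rightarrow> 'c::banach"
  assumes "F summable_on UNIV"
  shows "((\<lambda>k. \<Sum>\<^sub>\<infinity>p\<in>{p. \<pi> p = k}. F p) has_sum infsum F UNIV) UNIV"
proof (rule has_sum_Sigma[OF isUCont_plus, where B = "\<lambda>k. {p. \<pi> p = k}" and f = "\<lambda>x. F (snd x)"])
  let ?S = "Sigma UNIV (\<lambda>k. {p. \<pi> p = k})"
  have bij: "bij_betw snd ?S UNIV"
    by (rule bij_betwI[where g = "\<lambda>p. (\<pi> p, p)"]) auto
  show "((\<lambda>x. F (snd x)) has_sum infsum F UNIV) ?S"
    using assms by (subst has_sum_reindex_bij_betw[OF bij]) simp
  show "((\<lambda>p. F (snd (k, p))) has_sum (\<Sum>\<^sub>\<infinity>p\<in>{p. \<pi> p = k}. F p)) {p. \<pi> p = k}" for k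
    using summable_on_subset_banach[OF assms, of "{p. \<pi> p = k}"] by simp
qed

text \<open>The triangle inequality inside each fibre, where the weight is constant. With
  \<open>\<pi>\<close> the addition of indices this is the norm bound for products; with
  \<open>\<pi>\<close> the frequency it collects a series of modes into a Fourier series.\<close>

lemma abs_summable_fibre:
  fixes F :: "'p \<Rightarrow> complex"
  assumes "(\<lambda>p. norm (F p) * w (\<pi> p)) summable_on UNIV" "\<And>k. w k \<ge> 0"
  assumes "F summable_on UNIV"
  shows "(\<lambda>k. norm (\<Sum>\<^sub>\<infinity>p\<in>{p. \<pi> p = k}. F p) * w k) summable_on UNIV"
    and "(\<Sum>\<^sub>\<infinity>k. norm (\<Sum>\<^sub>\<infinity>p\<in>{p. \<pi> p = k}. F p) * w k) \<le> (\<Sum>\<^sub>\<infinity>p. norm (F p) * w (\<pi> p))"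
proof -
  let ?G = "\<lambda>p. norm (F p) * w (\<pi> p)"
  have S: "((\<lambda>k. \<Sum>\<^sub>\<infinity>p\<in>{p. \<pi> p = k}. ?G p) has_sum infsum ?G UNIV) UNIV"
    by (rule has_sum_fibre[OF assms(1)])
  have abs: "(\<lambda>p. norm (F p)) summable_on UNIV"
    using assms(3) by (simp add: summable_on_iff_abs_summable_on_complex)
  have le: "norm (\<Sum>\<^sub>\<infinity>p\<in>{p. \<pi> p = k}. F p) * w k \<le> (\<Sum>\<^sub>\<infinity>p\<in>{p. \<pi> p = k}. ?G p)" for k
  proof -
    have s: "(\<lambda>p. norm (F p)) summable_on {p. \<pi> p = k}"
      by (rule summable_on_subset_banach[OF abs]) auto
    have "norm (\<Sum>\<^sub>\<infinity>p\<in>{p. \<pi> p = k}. F p) * w k \<le> (\<Sum>\<^sub>\<infinity>p\<in>{p. \<pi> p = k}. norm (F p)) * w k"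
      using norm_infsum_bound[OF s] assms(2) by (simp add: mult_right_mono)
    also have "\<dots> = (\<Sum>\<^sub>\<infinity>p\<in>{p. \<pi> p = k}. norm (F p) * w k)"
      by (rule infsum_cmult_left'[symmetric])
    also have "\<dots> = (\<Sum>\<^sub>\<infinity>p\<in>{p. \<pi> p = k}. ?G p)"
      by (rule infsum_cong) auto
    finally show ?thesis .
  qed
  show 1: "(\<lambda>k. norm (\<Sum>\<^sub>\<infinity>p\<in>{p. \<pi> p = k}. F p) * w k) summable_on UNIV"
    by (rule summable_on_comparison_test[OF has_sum_imp_summable[OF S]])
      (use le assms(2) in auto)
  show "(\<Sum>\<^sub>\<infinity>k. norm (\<Sum>\<^sub>\<infinity>p\<in>{p. \<pi> p = k}. F p) * w k) \<le> infsum ?G UNIV"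
    using infsum_mono[OF 1 has_sum_imp_summable[OF S] le] infsumI[OF S] by simp
qed

section \<open>Convolution over a weighted commutative monoid\<close>

lemma has_sum_product_nonneg:
  fixes f :: "'a \<Rightarrow> real" and g :: "'b \<Rightarrow> real"
  assumes "f summable_on UNIV" "g summable_on UNIV" "\<And>i. f i \<ge> 0" "\<And>j. g j \<ge> 0"
  shows "((\<lambda>p. f (fst p) * g (snd p)) has_sum (infsum f UNIV * infsum g UNIV)) UNIV"
proof -
  have 1: "((\<lambda>j. f (fst (i, j)) * g (snd (i, j))) has_sum (f i * infsum g UNIV)) UNIV" for i
    using assms by (simp add: has_sum_cmult_right)
  have 2: "((\<lambda>i. f i * infsum g UNIV) has_sum (infsum f UNIV * infsum g UNIV)) UNIV"
    using assms by (simp add: has_sum_cmult_left)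
  have "((\<lambda>p. f (fst p) * g (snd p)) has_sum (infsum f UNIV * infsum g UNIV)) (UNIV \<times> UNIV)"
    using assms
    by (intro has_sum_SigmaI[OF 1 2] summable_on_SigmaI[OF 1 has_sum_imp_summable[OF 2]]) auto
  then show ?thesis by simp
qed

text \<open>The axioms turn weighted absolute summability into a normed algebra:
  \<open>wt_add\<close> makes the norm submultiplicative, \<open>wt_zero\<close> gives the unit norm
  one, and \<open>wt_ge_1\<close> makes the norm dominate the plain sum of absolute values, so that
  coefficients are continuous. The weight is a class parameter in order that \<open>wiener\<close>
  becomes a type to which the Banach space class applies.\<close>

class weighted_monoid = comm_monoid_add +
  fixes wt :: "'a \<Rightarrow> real"
  assumes wt_ge_1: "1 \<le> wt x"
    and wt_add: "wt (x + y) \<le> wt x * wt y"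
    and wt_zero: "wt 0 = 1"
begin

lemma wt_nonneg [simp]: "0 \<le> wt x" and wt_pos [simp]: "0 < wt x"
  using wt_ge_1[of x] by auto

end

typedef (overloaded) ('i::weighted_monoid) wiener =
    "{f :: 'i \<Rightarrow> complex. (\<lambda>i. norm (f i) * wt i) summable_on UNIV}"
  morphisms coeff Wiener
  by (rule exI[of _ "\<lambda>_. 0"]) simp

setup_lifting type_definition_wiener

lemma coeff_summable: "(\<lambda>i. norm (coeff f i) * wt i) summable_on UNIV"
  using coeff[of f] by simp

lemma summable_mult_wt:
  fixes f :: "'i::weighted_monoid \<Rightarrow> complex"
  assumes "(\<lambda>i. norm (f i) * wt i) summable_on UNIV" "\<And>i. norm (\<phi> i) \<le> C * wt i"
  shows "(\<lambda>i. f i * \<phi> i) summable_on UNIV"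
proof -
  have "(\<lambda>i. C * (norm (f i) * wt i)) summable_on UNIV"
    using assms(1) by (rule summable_on_cmult_right)
  then have "(\<lambda>i. norm (f i * \<phi> i)) summable_on UNIV"
    by (rule Infinite_Sum.abs_summable_on_comparison_test')
      (use assms(2) in \<open>auto simp: norm_mult mult.assoc mult.left_commute[of C] intro: mult_left_mono\<close>)
  then show ?thesis by (rule abs_summable_summable)
qed

text \<open>The sum runs over pairs with prescribed sum because the index is only a monoid: degrees
  cannot be subtracted as in \<open>f i * g (k - i)\<close>.\<close>

definition conv :: "('i::weighted_monoid \<Rightarrow> complex) \<Rightarrow> ('i \<Rightarrow> complex) \<Rightarrow> 'i \<Rightarrow> complex" where
  "conv f g k = (\<Sum>\<^sub>\<infinity>p\<in>{p. fst p + snd p = k}. f (fst p) * g (snd p))"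

context
  fixes f g :: "'i::weighted_monoid \<Rightarrow> complex"
  assumes f: "(\<lambda>i. norm (f i) * wt i) summable_on UNIV"
    and g: "(\<lambda>i. norm (g i) * wt i) summable_on UNIV"
begin

lemma conv_summable_wt:
  "(\<lambda>p. norm (f (fst p) * g (snd p)) * wt (fst p + snd p)) summable_on UNIV" (is ?A)
  "(\<Sum>\<^sub>\<infinity>p. norm (f (fst p) * g (snd p)) * wt (fst p + snd p)) 
     \<le> (\<Sum>\<^sub>\<infinity>i. norm (f i) * wt i) * (\<Sum>\<^sub>\<infinity>i. norm (g i) * wt i)" (is ?B)
proof -
  have P: "((\<lambda>p. (norm (f (fst p)) * wt (fst p)) * (norm (g (snd p)) * wt (snd p))) has_sum
      ((\<Sum>\<^sub>\<infinity>i. norm (f i) * wt i) * (\<Sum>\<^sub>\<infinity>i. norm (g i) * wt i))) UNIV"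
    by (rule has_sum_product_nonneg[OF f g]) auto
  have le: "norm (f (fst p) * g (snd p)) * wt (fst p + snd p) \<le>
    (norm (f (fst p)) * wt (fst p)) * (norm (g (snd p)) * wt (snd p))" for p
    using mult_left_mono[OF wt_add[of "fst p" "snd p"], of "norm (f (fst p) * g (snd p))"]
    by (simp add: norm_mult mult_ac)
  show ?A
    by (rule summable_on_comparison_test[OF has_sum_imp_summable[OF P] le]) simp
  then show ?B
    using infsum_mono[OF _ has_sum_imp_summable[OF P] le] infsumI[OF P] by simp
qed

lemma conv_summable_pairs:
  assumes "\<And>k. norm (\<phi> k) \<le> C * wt k"
  shows "(\<lambda>p. f (fst p) * g (snd p) * \<phi> (fst p + snd p)) summable_on UNIV"
proof -
  have "(\<lambda>p. C * (norm (f (fst p) * g (snd p)) * wt (fst p + snd p))) summable_on UNIV"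
    using conv_summable_wt(1) by (rule summable_on_cmult_right)
  then have "(\<lambda>p. norm (f (fst p) * g (snd p) * \<phi> (fst p + snd p))) summable_on UNIV"
    by (rule Infinite_Sum.abs_summable_on_comparison_test')
      (use assms in \<open>auto simp: norm_mult mult.assoc mult.left_commute[of C] intro!: mult_left_mono\<close>)
  then show ?thesis by (rule abs_summable_summable)
qed

lemma conv_pair_summable: "(\<lambda>p. f (fst p) * g (snd p)) summable_on UNIV"
  using conv_summable_pairs[of "\<lambda>_. 1" 1] by (simp add: wt_ge_1)

lemma conv_bounded:
  "(\<lambda>k. norm (conv f g k) * wt k) summable_on UNIV"
  "(\<Sum>\<^sub>\<infinity>k. norm (conv f g k) * wt k) \<le> (\<Sum>\<^sub>\<infinity>i. norm (f i) * wt i) * (\<Sum>\<^sub>\<infinity>i. norm (g i) * wt i)"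
  unfolding conv_def
  using abs_summable_fibre[where \<pi> = "\<lambda>p. fst p + snd p" and w = wt and F = "\<lambda>p. f (fst p) * g (snd p)"]
    conv_summable_wt conv_pair_summable by auto

text \<open>Integration of a convolution against a test function of at most the growth of the
  weight. Characters as test functions give multiplicativity of evaluation, point indicators give
  the values of the convolution, and a shifted sum over a third factor gives associativity.\<close>

lemma has_sum_conv_test:
  assumes "\<And>k. norm (\<phi> k) \<le> C * wt k"
  shows "((\<lambda>k. conv f g k * \<phi> k) has_sum (\<Sum>\<^sub>\<infinity>p. f (fst p) * g (snd p) * \<phi> (fst p + snd p))) UNIV"
proof -
  have "((\<lambda>k. \<Sum>\<^sub>\<infinity>p\<in>{p. fst p + snd p = k}. f (fst p) * g (snd p) * \<phi> (fst p + snd p)) has_sum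
      (\<Sum>\<^sub>\<infinity>p. f (fst p) * g (snd p) * \<phi> (fst p + snd p))) UNIV"
    by (rule has_sum_fibre[OF conv_summable_pairs[OF assms]])
  also have "(\<lambda>k. \<Sum>\<^sub>\<infinity>p\<in>{p. fst p + snd p = k}. f (fst p) * g (snd p) * \<phi> (fst p + snd p)) =
      (\<lambda>k. conv f g k * \<phi> k)"
  proof
    fix k
    have "(\<Sum>\<^sub>\<infinity>p\<in>{p. fst p + snd p = k}. f (fst p) * g (snd p) * \<phi> (fst p + snd p)) =
      (\<Sum>\<^sub>\<infinity>p\<in>{p. fst p + snd p = k}. f (fst p) * g (snd p) * \<phi> k)"
      by (rule infsum_cong) auto
    then show "(\<Sum>\<^sub>\<infinity>p\<in>{p. fst p + snd p = k}. f (fst p) * g (snd p) * \<phi> (fst p + snd p)) = conv f g k * \<phi> k"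
      by (simp add: conv_def infsum_cmult_left')
  qed
  finally show ?thesis .
qed

lemma infsum_conv_mult:
  assumes "\<And>i j. ch (i + j) = ch i * ch j" "\<And>i. norm (ch i) \<le> wt i"
  shows "(\<Sum>\<^sub>\<infinity>k. conv f g k * ch k) = (\<Sum>\<^sub>\<infinity>i. f i * ch i) * (\<Sum>\<^sub>\<infinity>i. g i * ch i)"
proof -
  let ?F = "\<lambda>p. (f (fst p) * ch (fst p)) * (g (snd p) * ch (snd p))"
  have le: "norm (ch k) \<le> 1 * wt k" for k using assms(2) by simp
  have eq: "f (fst p) * g (snd p) * ch (fst p + snd p) = ?F p" for p
    by (simp add: assms(1) mult_ac)
  have s: "?F summable_on UNIV \<times> UNIV"
    using conv_summable_pairs[of ch 1] assms(2) by (simp add: eq)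
  have "(\<Sum>\<^sub>\<infinity>k. conv f g k * ch k) = (\<Sum>\<^sub>\<infinity>p\<in>UNIV \<times> UNIV. ?F p)"
    using infsumI[OF has_sum_conv_test[OF le]] by (simp add: eq)
  also have "\<dots> = (\<Sum>\<^sub>\<infinity>i. \<Sum>\<^sub>\<infinity>j. ?F (i, j))"
    by (rule infsum_Sigma_banach[OF s, symmetric])
  also have "\<dots> = (\<Sum>\<^sub>\<infinity>i. f i * ch i) * (\<Sum>\<^sub>\<infinity>i. g i * ch i)"
    by (simp add: infsum_cmult_right' infsum_cmult_left')
  finally show ?thesis .
qed

lemma conv_commute: "conv f g k = conv g f k"
  unfolding conv_def
  by (rule infsum_reindex_bij_witness[where i = prod.swap and j = prod.swap]) (auto simp: add.commute mult.commute)

end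

lemma norm_of_bool_le_wt: "norm (of_bool P :: complex) \<le> 1 * wt i"
  using wt_ge_1[of i] by auto

text \<open>The indicator replaces the sum over a fibre, whose domain moves with \<open>k\<close>,
  by one over all pairs, to which Fubini applies.\<close>

lemma conv_of_bool:
  fixes f g :: "'i::weighted_monoid \<Rightarrow> complex"
  assumes "(\<lambda>i. norm (f i) * wt i) summable_on UNIV" "(\<lambda>i. norm (g i) * wt i) summable_on UNIV"
  shows "conv f g k = (\<Sum>\<^sub>\<infinity>p. f (fst p) * g (snd p) * of_bool (fst p + snd p = k))"
proof -
  have "((\<lambda>i. conv f g i * of_bool (i = k)) has_sum (\<Sum>\<^sub>\<infinity>p. f (fst p) * g (snd p) * of_bool (fst p + snd p = k))) UNIV"
    by (rule has_sum_conv_test[OF assms, where C = 1]) (rule norm_of_bool_le_wt)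
  moreover have "((\<lambda>i. conv f g i * of_bool (i = k)) has_sum conv f g k) UNIV"
    by (rule has_sum_finite_neutralI[of "{k}"]) auto
  ultimately show ?thesis by (rule has_sum_unique[symmetric])
qed

lemma conv_left_iterated:
  fixes f g :: "'i::weighted_monoid \<Rightarrow> complex"
  assumes f: "(\<lambda>i. norm (f i) * wt i) summable_on UNIV" and g: "(\<lambda>i. norm (g i) * wt i) summable_on UNIV"
  shows "conv f g k = (\<Sum>\<^sub>\<infinity>i. f i * (\<Sum>\<^sub>\<infinity>j. g j * of_bool (i + j = k)))"
proof -
  let ?F = "\<lambda>p. f (fst p) * g (snd p) * of_bool (fst p + snd p = k)"
  have "?F summable_on UNIV \<times> UNIV"
    using conv_summable_pairs[OF f g, of "\<lambda>i. of_bool (i = k)" 1] norm_of_bool_le_wt by auto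
  from infsum_Sigma_banach[OF this] show ?thesis
    by (simp add: conv_of_bool[OF f g] mult.assoc infsum_cmult_right')
qed

text \<open>Both sides are the sum over triples with total \<open>k\<close>. The inner sum over the
  third index is itself an admissible test function, bounded by the norm of \<open>h\<close> times
  the weight, so pairing it with \<open>conv f g\<close> unfolds the left side by double sums
  only.\<close>

lemma conv_assoc:
  fixes f g h :: "'i::weighted_monoid \<Rightarrow> complex"
  assumes f: "(\<lambda>i. norm (f i) * wt i) summable_on UNIV" and g: "(\<lambda>i. norm (g i) * wt i) summable_on UNIV"
    and h: "(\<lambda>i. norm (h i) * wt i) summable_on UNIV"
  shows "conv (conv f g) h k = conv f (conv g h) k"
proof -
  let ?F = "\<lambda>q. f (fst (fst q)) * g (snd (fst q)) * h (snd q) * of_bool (fst (fst q) + snd (fst q) + snd q = k)"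
  let ?\<phi> = "\<lambda>i. \<Sum>\<^sub>\<infinity>j. h j * of_bool (i + j = k)"
  have \<phi>: "norm (?\<phi> i) \<le> (\<Sum>\<^sub>\<infinity>j. norm (h j) * wt j) * wt i" for i
  proof -
    have s: "(\<lambda>j. norm (h j * of_bool (i + j = k))) summable_on UNIV"
      by (rule Infinite_Sum.abs_summable_on_comparison_test'[OF h])
        (use wt_ge_1 in \<open>auto simp: norm_mult mult_le_cancel_left1 not_le\<close>)
    have "norm (?\<phi> i) \<le> (\<Sum>\<^sub>\<infinity>j. norm (h j * of_bool (i + j = k)))"
      by (rule norm_infsum_bound[OF s])
    also have "\<dots> \<le> (\<Sum>\<^sub>\<infinity>j. norm (h j) * wt j)"
      by (rule infsum_mono[OF s h]) (use wt_ge_1 in \<open>auto simp: norm_mult mult_le_cancel_left1 not_le\<close>)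
    also have "\<dots> \<le> (\<Sum>\<^sub>\<infinity>j. norm (h j) * wt j) * wt i"
      using wt_ge_1[of i] infsum_nonneg[of UNIV "\<lambda>j. norm (h j) * wt j"]
      by (simp add: mult_le_cancel_left1)
    finally show ?thesis .
  qed
  have "conv (conv f g) h k = (\<Sum>\<^sub>\<infinity>i. conv f g i * ?\<phi> i)"
    by (rule conv_left_iterated[OF conv_bounded(1)[OF f g] h])
  also have "\<dots> = (\<Sum>\<^sub>\<infinity>p. f (fst p) * g (snd p) * ?\<phi> (fst p + snd p))"
    by (rule infsumI[OF has_sum_conv_test[OF f g \<phi>]])
  also have "\<dots> = (\<Sum>\<^sub>\<infinity>i. \<Sum>\<^sub>\<infinity>j. f i * g j * ?\<phi> (i + j))"
    using infsum_Sigma_banach[of "\<lambda>p. f (fst p) * g (snd p) * ?\<phi> (fst p + snd p)" UNIV "\<lambda>_. UNIV"]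
      conv_summable_pairs[OF f g \<phi>] by simp
  also have "\<dots> = (\<Sum>\<^sub>\<infinity>i. f i * (\<Sum>\<^sub>\<infinity>l. conv g h l * of_bool (i + l = k)))"
  proof (rule infsum_cong)
    fix i
    have le: "norm (of_bool (i + l = k) :: complex) \<le> 1 * wt l" for l by (rule norm_of_bool_le_wt)
    have "(\<Sum>\<^sub>\<infinity>l. conv g h l * of_bool (i + l = k)) = 
       (\<Sum>\<^sub>\<infinity>p. g (fst p) * h (snd p) * of_bool (i + (fst p + snd p) = k))"
      by (rule infsumI[OF has_sum_conv_test[OF g h le]])
    also have "\<dots> = (\<Sum>\<^sub>\<infinity>j. \<Sum>\<^sub>\<infinity>l. g j * h l * of_bool (i + (j + l) = k))"
      using infsum_Sigma_banach[of "\<lambda>p. g (fst p) * h (snd p) * of_bool (i + (fst p + snd p) = k)" UNIV "\<lambda>_. UNIV"]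
        conv_summable_pairs[OF g h le] by simp
    also have "\<dots> = (\<Sum>\<^sub>\<infinity>j. g j * ?\<phi> (i + j))"
      by (simp add: mult.assoc infsum_cmult_right' add.assoc)
    finally show "(\<Sum>\<^sub>\<infinity>j. f i * g j * ?\<phi> (i + j)) = f i * (\<Sum>\<^sub>\<infinity>l. conv g h l * of_bool (i + l = k))"
      by (simp add: mult.assoc infsum_cmult_right')
  qed
  also have "\<dots> = conv f (conv g h) k"
    by (rule conv_left_iterated[OF f conv_bounded(1)[OF g h], symmetric])
  finally show ?thesis .
qed

lemma conv_add_left:
  fixes f g h :: "'i::weighted_monoid \<Rightarrow> complex"
  assumes "(\<lambda>i. norm (f i) * wt i) summable_on UNIV" "(\<lambda>i. norm (g i) * wt i) summable_on UNIV"
    and "(\<lambda>i. norm (h i) * wt i) summable_on UNIV"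
  shows "conv (\<lambda>i. f i + g i) h k = conv f h k + conv g h k"
  unfolding conv_def distrib_right
  by (intro infsum_add summable_on_subset_banach[OF conv_pair_summable] assms) auto

lemma conv_scaleR_left: "conv (\<lambda>i. c *\<^sub>R f i) g k = c *\<^sub>R conv f g k"
  unfolding conv_def by (simp add: infsum_scaleR_right)

lemma conv_one_left:
  fixes f :: "'i::weighted_monoid \<Rightarrow> complex"
  shows "conv (\<lambda>i. of_bool (i = 0)) f k = f k"
proof -
  have "conv (\<lambda>i. of_bool (i = 0)) f k =
     (\<Sum>\<^sub>\<infinity>p\<in>{(0 :: 'i, k)}. of_bool (fst p = 0) * f (snd p))"
    unfolding conv_def by (rule Infinite_Sum.infsum_cong_neutral) auto
  then show ?thesis by simp
qed


section \<open>The commutative Banach algebra of weighted absolutely summable families\<close>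

lemma norm_add_mult_wt: "norm (x + y :: complex) * wt i \<le> norm x * wt i + norm y * wt i"
  using mult_right_mono[OF norm_triangle_ineq[of x y], of "wt i"] by (simp add: distrib_right)

lemma summable_of_bool_wt: "(\<lambda>i. norm (of_bool (i = a) * z :: complex) * wt i) summable_on UNIV"
  by (rule finite_nonzero_values_imp_summable_on) (auto simp: of_bool_def intro: finite_subset[of _ "{a}"])

instantiation wiener :: (weighted_monoid) "{real_vector, times, one}"
begin

lift_definition zero_wiener :: "'a wiener" is "\<lambda>_. 0" by simp

lift_definition one_wiener :: "'a wiener" is "\<lambda>i. of_bool (i = 0)"
  using summable_of_bool_wt[of 0 1] by simp

lift_definition plus_wiener :: "'a wiener \<Rightarrow> 'a wiener \<Rightarrow> 'a wiener" is "\<lambda>f g i. f i + g i"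
proof -
  fix f g :: "'a \<Rightarrow> complex"
  assume "(\<lambda>i. norm (f i) * wt i) summable_on UNIV" "(\<lambda>i. norm (g i) * wt i) summable_on UNIV"
  then have "(\<lambda>i. norm (f i) * wt i + norm (g i) * wt i) summable_on UNIV"
    by (rule summable_on_add)
  then show "(\<lambda>i. norm (f i + g i) * wt i) summable_on UNIV"
    by (rule summable_on_comparison_test) (auto simp: norm_add_mult_wt)
qed

lift_definition uminus_wiener :: "'a wiener \<Rightarrow> 'a wiener" is "\<lambda>f i. - f i" by simp

lift_definition scaleR_wiener :: "real \<Rightarrow> 'a wiener \<Rightarrow> 'a wiener" is "\<lambda>c f i. c *\<^sub>R f i"
  by (simp add: mult.assoc summable_on_cmult_right)

lift_definition times_wiener :: "'a wiener \<Rightarrow> 'a wiener \<Rightarrow> 'a wiener" is conv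
  by (rule conv_bounded)

definition minus_wiener :: "'a wiener \<Rightarrow> 'a wiener \<Rightarrow> 'a wiener" where
  "minus_wiener f g = f + - g"

instance
proof
  fix f g h :: "'a wiener" and c d :: real
  show "f + g + h = f + (g + h)" "f + g = g + f" "0 + f = f" "- f + f = 0"
    "c *\<^sub>R (f + g) = c *\<^sub>R f + c *\<^sub>R g" "(c + d) *\<^sub>R f = c *\<^sub>R f + d *\<^sub>R f"
    "c *\<^sub>R d *\<^sub>R f = (c * d) *\<^sub>R f" "1 *\<^sub>R f = f"
    by (transfer, auto simp: algebra_simps fun_eq_iff)+
  show "f - g = f + - g" by (rule minus_wiener_def)
qed

end

instantiation wiener :: (weighted_monoid) real_normed_vector
begin

definition norm_wiener :: "'a wiener \<Rightarrow> real" where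
  "norm_wiener f = (\<Sum>\<^sub>\<infinity>i. norm (coeff f i) * wt i)"

definition dist_wiener :: "'a wiener \<Rightarrow> 'a wiener \<Rightarrow> real" where
  "dist_wiener f g = norm (f - g)"

definition sgn_wiener :: "'a wiener \<Rightarrow> 'a wiener" where
  "sgn_wiener f = f /\<^sub>R norm f"

definition uniformity_wiener :: "('a wiener \<times> 'a wiener) filter" where
  "uniformity_wiener = (INF e\<in>{0<..}. principal {(x, y). dist x y < e})"

definition open_wiener :: "'a wiener set \<Rightarrow> bool" where
  "open_wiener U = (\<forall>x\<in>U. eventually (\<lambda>(x', y). x' = x \<longrightarrow> y \<in> U) uniformity)"

instance
proof
  fix f g h :: "'a wiener" and c d :: real
  show "dist f g = norm (f - g)" by (rule dist_wiener_def)
  show "sgn f = f /\<^sub>R norm f" by (rule sgn_wiener_def)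
  show "(uniformity :: ('a wiener \<times> 'a wiener) filter) = (INF e\<in>{0<..}. principal {(x, y). dist x y < e})"
    by (rule uniformity_wiener_def)
  show "open U \<longleftrightarrow> (\<forall>x\<in>U. eventually (\<lambda>(x', y). x' = x \<longrightarrow> y \<in> U) uniformity)" for U :: "'a wiener set"
    by (rule open_wiener_def)
  show "norm f = 0 \<longleftrightarrow> f = 0"
  proof
    assume "norm f = 0"
    then have "norm (coeff f i) * wt i = 0" for i
      using nonneg_infsum_le_0D[OF _ coeff_summable[of f], of i] by (auto simp: norm_wiener_def)
    then have "coeff f i = 0" for i
      using wt_pos[of i] by (metis mult_eq_0_iff less_irrefl norm_eq_zero)
    then show "f = 0" by transfer auto
  next
    assume "f = 0"
    then show "norm f = 0" by (simp add: norm_wiener_def zero_wiener.rep_eq)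
  qed
  show "norm (f + g) \<le> norm f + norm g"
  proof -
    have "norm (f + g) \<le> (\<Sum>\<^sub>\<infinity>i. norm (coeff f i) * wt i + norm (coeff g i) * wt i)"
      unfolding norm_wiener_def
      by (rule infsum_mono[OF coeff_summable summable_on_add[OF coeff_summable coeff_summable]])
        (simp add: plus_wiener.rep_eq norm_add_mult_wt)
    then show ?thesis
      by (simp add: norm_wiener_def infsum_add[OF coeff_summable coeff_summable])
  qed
  show "norm (c *\<^sub>R f) = \<bar>c\<bar> * norm f"
    by (simp add: norm_wiener_def scaleR_wiener.rep_eq mult.assoc infsum_cmult_right')
qed

end

lemma coeff_minus: "coeff (f - g) i = coeff f i - coeff g i"
  unfolding minus_wiener_def plus_wiener.rep_eq uminus_wiener.rep_eq by simp

lemmas coeff_simps = zero_wiener.rep_eq one_wiener.rep_eq plus_wiener.rep_eq uminus_wiener.rep_eq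
  scaleR_wiener.rep_eq times_wiener.rep_eq coeff_minus

lemma norm_coeff_le: "norm (coeff f i) \<le> norm f"
proof -
  have "norm (coeff f i) * 1 \<le> norm (coeff f i) * wt i"
    by (intro mult_left_mono wt_ge_1) auto
  also have "\<dots> = (\<Sum>j\<in>{i}. norm (coeff f j) * wt j)" by simp
  also have "\<dots> \<le> norm f"
    unfolding norm_wiener_def by (rule finite_sum_le_infsum[OF coeff_summable]) auto
  finally show ?thesis by simp
qed

lemma bounded_linear_coeff: "bounded_linear (\<lambda>f. coeff f i)"
  by (rule bounded_linear_intro[where K = 1]) (auto simp: coeff_simps norm_coeff_le)

lemma wiener_eqI: "(\<And>i. coeff f i = coeff g i) \<Longrightarrow> f = g"
  by (rule coeff_inject[THEN iffD1]) (rule ext)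

instance wiener :: (weighted_monoid) "{real_normed_algebra_1, comm_ring_1}"
proof
  fix f g h :: "'a wiener" and c :: real
  note summable = coeff_summable
  have commute: "f * g = g * f" for f g :: "'a wiener"
    by (rule wiener_eqI) (unfold times_wiener.rep_eq, rule conv_commute[OF summable summable])
  have add_left: "(f + g) * h = f * h + g * h" for f g h :: "'a wiener"
    by (rule wiener_eqI)
      (unfold times_wiener.rep_eq plus_wiener.rep_eq, rule conv_add_left[OF summable summable summable])
  have scale_left: "(c *\<^sub>R f) * g = c *\<^sub>R (f * g)" for f g :: "'a wiener"
    by (rule wiener_eqI)
      (unfold times_wiener.rep_eq scaleR_wiener.rep_eq, rule conv_scaleR_left)
  have one_left: "1 * f = f" for f :: "'a wiener"
    by (rule wiener_eqI) (unfold times_wiener.rep_eq one_wiener.rep_eq, rule conv_one_left)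
  show "f * g = g * f" by (rule commute)
  show "(f + g) * h = f * h + g * h" by (rule add_left)
  show "(c *\<^sub>R f) * g = c *\<^sub>R (f * g)" by (rule scale_left)
  show "1 * f = f" by (rule one_left)
  show "f * g * h = f * (g * h)"
    by (rule wiener_eqI) (unfold times_wiener.rep_eq, rule conv_assoc[OF summable summable summable])
  show "f * (g + h) = f * g + f * h"
    unfolding commute[of f] by (rule add_left)
  show "f * (c *\<^sub>R g) = c *\<^sub>R (f * g)"
    unfolding commute[of f] by (rule scale_left)
  show "f * 1 = f"
    unfolding commute[of f] by (rule one_left)
  have "coeff (0 :: 'a wiener) 0 \<noteq> coeff 1 0"
    unfolding zero_wiener.rep_eq one_wiener.rep_eq by simp
  then show "(0 :: 'a wiener) \<noteq> 1" by (rule contrapos_nn) (rule arg_cong)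
  show "norm (f * g) \<le> norm f * norm g"
    unfolding norm_wiener_def times_wiener.rep_eq
    by (rule conv_bounded(2)[OF coeff_summable coeff_summable])
  have "(\<Sum>\<^sub>\<infinity>i. norm (coeff (1 :: 'a wiener) i) * wt i) = (\<Sum>\<^sub>\<infinity>i\<in>{0}. norm (coeff (1 :: 'a wiener) i) * wt i)"
    by (rule Infinite_Sum.infsum_cong_neutral) (auto simp: coeff_simps)
  then show "norm (1 :: 'a wiener) = 1"
    by (simp add: norm_wiener_def coeff_simps wt_zero)
qed

lemma norm_wiener_le:
  fixes f :: "'i::weighted_monoid wiener"
  assumes "\<And>F. finite F \<Longrightarrow> (\<Sum>i\<in>F. norm (coeff f i) * wt i) \<le> B"
  shows "norm f \<le> B"
  unfolding norm_wiener_def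
  by (rule infsum_le_finite_sums[OF coeff_summable]) (use assms in auto)

lemma sum_coeff_le_norm:
  fixes f :: "'i::weighted_monoid wiener"
  assumes "finite F"
  shows "(\<Sum>i\<in>F. norm (coeff f i) * wt i) \<le> norm f"
  unfolding norm_wiener_def by (rule finite_sum_le_infsum[OF coeff_summable]) (use assms in auto)

instance wiener :: (weighted_monoid) banach
proof
  fix X :: "nat \<Rightarrow> 'a wiener"
  assume X: "Cauchy X"
  have "Cauchy (\<lambda>n. coeff (X n) i)" for i
    by (rule bounded_linear.Cauchy[OF bounded_linear_coeff X])
  then have conv: "convergent (\<lambda>n. coeff (X n) i)" for i
    by (simp add: Cauchy_convergent_iff)
  define f where "f i = lim (\<lambda>n. coeff (X n) i)" for i
  have f: "(\<lambda>n. coeff (X n) i) \<longlonglongrightarrow> f i" for i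
    unfolding f_def using conv by (simp add: convergent_LIMSEQ_iff)
  \<comment> \<open>Only finite partial sums are passed to the coefficientwise limit; a bound
    uniform in \<open>F\<close> then returns the full norm, with no exchange of a limit and an
    infinite sum.\<close>
  have fin: "\<exists>N. \<forall>n\<ge>N. \<forall>F. finite F \<longrightarrow> (\<Sum>i\<in>F. norm (coeff (X n) i - f i) * wt i) \<le> e" if "e > 0" for e
  proof -
    obtain N where N: "\<And>m n. m \<ge> N \<Longrightarrow> n \<ge> N \<Longrightarrow> norm (X m - X n) < e"
      using CauchyD[OF X \<open>e > 0\<close>] by metis
    have "(\<Sum>i\<in>F. norm (coeff (X n) i - f i) * wt i) \<le> e" if n: "n \<ge> N" and F: "finite F" for n F
    proof (rule LIMSEQ_le_const2)
      show "(\<lambda>m. \<Sum>i\<in>F. norm (coeff (X n) i - coeff (X m) i) * wt i)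
          \<longlonglongrightarrow> (\<Sum>i\<in>F. norm (coeff (X n) i - f i) * wt i)"
        by (intro tendsto_intros f)
      have "(\<Sum>i\<in>F. norm (coeff (X n) i - coeff (X m) i) * wt i) \<le> e" if "m \<ge> N" for m
        using sum_coeff_le_norm[OF F, of "X n - X m"] N[OF n that] by (simp add: coeff_simps)
      then show "\<exists>N. \<forall>m\<ge>N. (\<Sum>i\<in>F. norm (coeff (X n) i - coeff (X m) i) * wt i) \<le> e" by blast
    qed
    then show ?thesis by blast
  qed
  obtain N where N: "\<And>F. finite F \<Longrightarrow> (\<Sum>i\<in>F. norm (coeff (X N) i - f i) * wt i) \<le> 1"
    using fin[of 1] by auto
  have "(\<lambda>i. norm (coeff (X N) i - f i) * wt i) summable_on UNIV"
    by (rule nonneg_bdd_above_summable_on) (use N in \<open>auto intro!: bdd_aboveI2[where M = 1]\<close>)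
  from summable_on_add[OF this coeff_summable[of "X N"]]
  moreover have "norm (f i) * wt i \<le> norm (coeff (X N) i - f i) * wt i + norm (coeff (X N) i) * wt i" for i
    using norm_add_mult_wt[of "f i - coeff (X N) i" "coeff (X N) i" i] by (simp add: norm_minus_commute)
  ultimately have "(\<lambda>i. norm (f i) * wt i) summable_on UNIV"
    by (rule summable_on_comparison_test) simp
  then have cf: "coeff (Wiener f) = f" by (simp add: Wiener_inverse)
  have "X \<longlonglongrightarrow> Wiener f"
  proof (rule LIMSEQ_I)
    fix e :: real assume "e > 0"
    then obtain M where M: "\<And>n F. n \<ge> M \<Longrightarrow> finite F \<Longrightarrow> (\<Sum>i\<in>F. norm (coeff (X n) i - f i) * wt i) \<le> e / 2"
      using fin[of "e / 2"] by auto
    have "norm (X n - Wiener f) \<le> e / 2" if "n \<ge> M" for n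
      by (rule norm_wiener_le) (use M[OF that] in \<open>simp add: coeff_simps cf\<close>)
    then show "\<exists>no. \<forall>n\<ge>no. norm (X n - Wiener f) < e"
      using \<open>e > 0\<close> by (intro exI[of _ M]) force
  qed
  then show "convergent X" by (auto simp: convergent_def)
qed

section \<open>Fourier multipliers and point evaluations\<close>

definition multiplier :: "('i \<Rightarrow> complex) \<Rightarrow> 'i::weighted_monoid wiener \<Rightarrow> 'i wiener" where
  "multiplier m f = Wiener (\<lambda>i. m i * coeff f i)"

lemma
  assumes "\<And>i. norm (m i) \<le> B"
  shows coeff_multiplier: "coeff (multiplier m f) i = m i * coeff f i"
    and norm_multiplier_le: "norm (multiplier m f) \<le> B * norm f"
proof -
  have s: "(\<lambda>i. B * (norm (coeff f i) * wt i)) summable_on UNIV"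
    by (rule summable_on_cmult_right[OF coeff_summable])
  have le: "norm (m i * coeff f i) * wt i \<le> B * (norm (coeff f i) * wt i)" for i
    using mult_right_mono[OF assms[of i], of "norm (coeff f i) * wt i"] by (simp add: norm_mult mult_ac)
  have s': "(\<lambda>i. norm (m i * coeff f i) * wt i) summable_on UNIV"
    by (rule summable_on_comparison_test[OF s le]) simp
  then have c: "coeff (multiplier m f) = (\<lambda>i. m i * coeff f i)"
    unfolding multiplier_def by (simp add: Wiener_inverse)
  show "coeff (multiplier m f) i = m i * coeff f i" by (simp add: c)
  show "norm (multiplier m f) \<le> B * norm f"
    using infsum_mono[OF s' s le] by (simp add: norm_wiener_def c infsum_cmult_right')
qed

lemma bounded_linear_multiplier:
  assumes "\<And>i. norm (m i) \<le> B"
  shows "bounded_linear (multiplier m)"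
  by (rule bounded_linear_intro[where K = B])
    (use norm_multiplier_le[of m, OF assms] in
      \<open>auto intro!: wiener_eqI simp: coeff_multiplier[of m, OF assms] coeff_simps algebra_simps\<close>)

lift_definition single :: "'i::weighted_monoid \<Rightarrow> complex \<Rightarrow> 'i wiener" is "\<lambda>a z i. of_bool (i = a) * z"
  by (rule summable_of_bool_wt)

lemma norm_single: "norm (single a z) = norm z * wt a"
proof -
  have "(\<Sum>\<^sub>\<infinity>i. norm (coeff (single a z) i) * wt i) = (\<Sum>\<^sub>\<infinity>i\<in>{a}. norm (coeff (single a z) i) * wt i)"
    by (rule Infinite_Sum.infsum_cong_neutral) (auto simp: single.rep_eq)
  then show ?thesis by (simp add: norm_wiener_def single.rep_eq)
qed

definition ev :: "('i::weighted_monoid \<Rightarrow> complex) \<Rightarrow> 'i wiener \<Rightarrow> complex" where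
  "ev ch f = (\<Sum>\<^sub>\<infinity>i. coeff f i * ch i)"

text \<open>The multiplicative functionals by which an element is read as a function; the relevant
  characters are e^(i n \<theta>) s^j t^l. The bound \<open>ch_le\<close> makes the evaluating
  series converge absolutely and admits \<open>ch\<close> as a test function for products.\<close>

locale wiener_character =
  fixes ch :: "'i::weighted_monoid \<Rightarrow> complex"
  assumes ch_add: "ch (i + j) = ch i * ch j"
    and ch_zero: "ch 0 = 1"
    and ch_le: "norm (ch i) \<le> wt i"
begin

lemma ev_summable: "(\<lambda>i. coeff f i * ch i) summable_on UNIV"
  by (rule summable_mult_wt[OF coeff_summable, where C = 1]) (simp add: ch_le)

lemma ev_has_sum: "((\<lambda>i. coeff f i * ch i) has_sum ev ch f) UNIV"
  unfolding ev_def using ev_summable by simp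

lemma ev_add: "ev ch (f + g) = ev ch f + ev ch g"
  unfolding ev_def plus_wiener.rep_eq distrib_right by (intro infsum_add ev_summable)

lemma ev_scaleR: "ev ch (c *\<^sub>R f) = c *\<^sub>R ev ch f"
  unfolding ev_def scaleR_wiener.rep_eq by (simp add: infsum_scaleR_right)

lemma ev_diff: "ev ch (f - g) = ev ch f - ev ch g"
  using ev_add[of "f - g" g] by simp

lemma ev_mult: "ev ch (f * g) = ev ch f * ev ch g"
  unfolding ev_def times_wiener.rep_eq
  by (rule infsum_conv_mult[OF coeff_summable coeff_summable ch_add ch_le])

lemma ev_single: "ev ch (single a z) = z * ch a"
proof -
  have "ev ch (single a z) = (\<Sum>\<^sub>\<infinity>i\<in>{a}. coeff (single a z) i * ch i)"
    unfolding ev_def by (rule Infinite_Sum.infsum_cong_neutral) (auto simp: single.rep_eq)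
  then show ?thesis by (simp add: single.rep_eq)
qed

lemma ev_one: "ev ch 1 = 1"
proof -
  have "1 = single (0::'i) 1" by (rule wiener_eqI) (simp add: single.rep_eq one_wiener.rep_eq)
  then show ?thesis using ev_single[of 0 1] ch_zero by simp
qed

lemma ev_power: "ev ch (f ^ n) = ev ch f ^ n"
  by (induction n) (simp_all add: ev_one ev_mult)

lemmas ev_simps = ev_add ev_scaleR ev_diff ev_mult ev_one ev_power

end

section \<open>The fixed point map and its contraction estimate\<close>

lemma
  fixes p q :: "'a::{real_normed_algebra_1, comm_ring_1}"
  assumes p: "norm p \<le> 1"
  shows norm_cube_le: "norm ((1 + p) ^ 3) \<le> 8"
    and norm_cube_minus_one_le: "norm ((1 + p) ^ 3 - 1) \<le> 7 * norm p"
    and norm_cube_diff_le: "norm q \<le> 1 \<Longrightarrow> norm ((1 + p) ^ 3 - (1 + q) ^ 3) \<le> 12 * norm (p - q)"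
proof -
  have le2: "norm (1 + p) \<le> 2" if "norm p \<le> 1" for p :: 'a
    using norm_triangle_ineq[of 1 p] that by simp
  have prod: "norm (x * y) \<le> a * c" if "norm x \<le> a" "norm y \<le> c" for x y :: 'a and a c
    using that by (meson mult_mono norm_ge_zero norm_mult_ineq order_trans)
  show "norm ((1 + p) ^ 3) \<le> 8"
    using norm_power_ineq[of "1 + p" 3] power_mono[OF le2[OF p], of 3] by simp
  have sq: "norm (p ^ 2) \<le> 1"
    using norm_power_ineq[of p 2] power_mono[OF p, of 2] by simp
  have "norm (3 * p) \<le> 3"
    using prod[of 3 3 p 1] p by simp
  then have "norm (3 + 3 * p + p ^ 2) \<le> 7"
    using norm_triangle_ineq[of "3 + 3 * p" "p ^ 2"] norm_triangle_ineq[of 3 "3 * p"] sq by simp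
  then have "norm (p * (3 + 3 * p + p ^ 2)) \<le> norm p * 7" by (intro prod) auto
  then show "norm ((1 + p) ^ 3 - 1) \<le> 7 * norm p"
    by (simp add: algebra_simps power3_eq_cube power2_eq_square)
  assume q: "norm q \<le> 1"
  let ?s = "(1 + p) * (1 + p) + (1 + p) * (1 + q) + (1 + q) * (1 + q)"
  have "norm ?s \<le> 2 * 2 + 2 * 2 + 2 * 2"
    by (intro order_trans[OF norm_triangle_ineq] add_mono prod le2 p q)
  then have "norm ((p - q) * ?s) \<le> norm (p - q) * 12" by (intro prod) auto
  then show "norm ((1 + p) ^ 3 - (1 + q) ^ 3) \<le> 12 * norm (p - q)"
    by (simp add: algebra_simps power3_eq_cube)
qed

text \<open>With \<open>K0 g\<close>, \<open>K1 g\<close>, \<open>K2 g\<close> in the roles of u, u'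
  and u' + u''', this is the equation for H = 1 + u solved for u + b (u' + u'''): splitting that
  linear part off b H^3 (u' + u''') leaves the factor H^3 - 1. Keeping the operators abstract lets
  one estimate serve both algebras.\<close>

definition steady_map ::
  "real \<Rightarrow> ('a \<Rightarrow> 'a) \<Rightarrow> ('a \<Rightarrow> 'a) \<Rightarrow> ('a \<Rightarrow> 'a) \<Rightarrow> 'a \<Rightarrow> 'a \<Rightarrow> 'a::real_algebra_1 \<Rightarrow> 'a" where
  "steady_map b K0 K1 K2 e1 e2 g =
     e1 * (1 + K0 g) ^ 3 - b *\<^sub>R (((1 + K0 g) ^ 3 - 1) * K2 g) - e2 * ((1 + K0 g) ^ 3 * K1 g)"

text \<open>Chosen to make B R and b B^2 R at most 1/200, where R is this radius. The three terms of
  the map then have Lipschitz constants 12/200, 19/200 and 20/200, with sum about 1/4; nothing is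
  optimised.\<close>

definition contraction_radius :: "real \<Rightarrow> real \<Rightarrow> real" where
  "contraction_radius b B = 1 / (200 * (1 + b) * (1 + B) ^ 2)"

lemma steady_map_contraction:
  fixes K0 K1 K2 :: "'a::{real_normed_algebra_1, comm_ring_1} \<Rightarrow> 'a"
  assumes b: "b \<ge> 0" and B: "B \<ge> 0"
    and lin: "bounded_linear K0" "bounded_linear K1" "bounded_linear K2"
    and K: "\<And>g. norm (K0 g) \<le> B * norm g" "\<And>g. norm (K1 g) \<le> B * norm g" "\<And>g. norm (K2 g) \<le> B * norm g"
    and le: "norm e1 \<le> contraction_radius b B" "norm e2 \<le> contraction_radius b B"
      "norm g \<le> contraction_radius b B" "norm h \<le> contraction_radius b B"
  shows "norm (steady_map b K0 K1 K2 e1 e2 g - steady_map b K0 K1 K2 e1 e2 h) \<le> norm (g - h) / 2"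
proof -
  let ?R = "contraction_radius b B" and ?d = "norm (g - h)"
  let ?C = "(1 + K0 g) ^ 3" and ?D = "(1 + K0 h) ^ 3"
  have R0: "?R > 0" using b B by (simp add: contraction_radius_def)
  have eqR: "200 * ((1 + b) * ((1 + B) * ((1 + B) * ?R))) = 1"
    using b B by (simp add: contraction_radius_def power2_eq_square)
  have "(1 + b) * ((1 + B) * ((1 + B) * ?R)) \<ge> 1 * (B * (1 * ?R))"
    using b B R0 by (intro mult_mono) auto
  then have BR: "B * ?R \<le> 1 / 200" using eqR by simp
  have "(1 + b) * ((1 + B) * ((1 + B) * ?R)) \<ge> b * (B * (B * ?R))"
    using b B R0 by (intro mult_mono) auto
  then have bBBR: "b * (B * (B * ?R)) \<le> 1 / 200" using eqR by simp
  have Kle: "norm (K x) \<le> B * ?R" if "norm x \<le> ?R" "\<And>x. norm (K x) \<le> B * norm x" for K :: "'a \<Rightarrow> 'a" and x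
    using that B by (meson mult_left_mono order_trans)
  note prod = order_trans[OF norm_mult_ineq mult_mono]
  have diff: "norm (K g - K h) \<le> B * ?d" if "bounded_linear K" "\<And>x. norm (K x) \<le> B * norm x" for K :: "'a \<Rightarrow> 'a"
    using that by (metis bounded_linear.linear linear_diff)
  have p: "norm (K0 g) \<le> 1" "norm (K0 h) \<le> 1"
    using Kle[OF le(3) K(1)] Kle[OF le(4) K(1)] BR by auto
  have CD: "norm (?C - ?D) \<le> 12 * (B * ?d)"
    using norm_cube_diff_le[OF p] diff[OF lin(1) K(1)] by simp
  have D: "norm (?D - 1) \<le> 7 * (B * ?R)"
    using norm_cube_minus_one_le[OF p(2)] Kle[OF le(4) K(1)] by simp
  have "norm (e1 * (?C - ?D)) \<le> ?R * (12 * (B * ?d))"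
    using CD le(1) R0 by (intro prod) auto
  moreover have "?R * (12 * (B * ?d)) = 12 * (B * ?R) * ?d" by simp
  ultimately have t1: "norm (e1 * (?C - ?D)) \<le> 12 / 200 * ?d"
    using mult_right_mono[OF BR, of ?d] by simp
  \<comment> \<open>Each summand gains a factor \<open>B * ?R\<close>: in the first from
    \<open>K2 g\<close>, in the second from \<open>?D - 1\<close>, which is of first order. This is
    what lets the radius offset a large b.\<close>
  have "norm ((?C - ?D) * K2 g + (?D - 1) * (K2 g - K2 h)) \<le> 12 * (B * ?d) * (B * ?R) + 7 * (B * ?R) * (B * ?d)"
    by (rule order_trans[OF norm_triangle_ineq], intro add_mono prod CD D Kle le K diff lin)
      (use B R0 in auto)
  then have "norm (b *\<^sub>R ((?C - ?D) * K2 g + (?D - 1) * (K2 g - K2 h)))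
      \<le> b * (12 * (B * ?d) * (B * ?R) + 7 * (B * ?R) * (B * ?d))"
    using b by (simp add: mult_left_mono)
  also have "\<dots> = 19 * (b * (B * (B * ?R))) * ?d" by (simp add: algebra_simps)
  also have "\<dots> \<le> 19 / 200 * ?d" using mult_right_mono[OF bBBR, of "19 * ?d"] by (simp add: mult_ac)
  finally have t2: "norm (b *\<^sub>R ((?C - ?D) * K2 g + (?D - 1) * (K2 g - K2 h))) \<le> 19 / 200 * ?d" .
  have "norm ((?C - ?D) * K1 g + ?D * (K1 g - K1 h)) \<le> 12 * (B * ?d) * 1 + 8 * (B * ?d)"
    by (rule order_trans[OF norm_triangle_ineq], intro add_mono prod CD norm_cube_le p diff lin K)
      (use B R0 Kle[OF le(3) K(2)] BR in auto)
  then have "norm (e2 * ((?C - ?D) * K1 g + ?D * (K1 g - K1 h))) \<le> ?R * (20 * (B * ?d))"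
    using le(2) R0 by (intro prod) auto
  moreover have "?R * (20 * (B * ?d)) = 20 * (B * ?R) * ?d" by simp
  ultimately have t3: "norm (e2 * ((?C - ?D) * K1 g + ?D * (K1 g - K1 h))) \<le> 20 / 200 * ?d"
    using mult_right_mono[OF BR, of ?d] by simp
  have "steady_map b K0 K1 K2 e1 e2 g - steady_map b K0 K1 K2 e1 e2 h =
      e1 * (?C - ?D) - b *\<^sub>R ((?C - ?D) * K2 g + (?D - 1) * (K2 g - K2 h))
      - e2 * ((?C - ?D) * K1 g + ?D * (K1 g - K1 h))"
    unfolding steady_map_def by (simp only: algebra_simps)
  also have "norm \<dots> \<le> 12 / 200 * ?d + 19 / 200 * ?d + 20 / 200 * ?d"
    by (intro order_trans[OF norm_triangle_ineq4] add_mono t1 t2 t3)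
  also have "\<dots> \<le> ?d / 2" by simp
  finally show ?thesis .
qed

lemma contraction_radius_pos: "b \<ge> 0 \<Longrightarrow> B \<ge> 0 \<Longrightarrow> contraction_radius b B > 0"
  by (simp add: contraction_radius_def)

lemma steady_map_fixpoint_unique:
  fixes K0 K1 K2 :: "'a::{real_normed_algebra_1, comm_ring_1} \<Rightarrow> 'a"
  assumes "b \<ge> 0" "B \<ge> 0" "bounded_linear K0" "bounded_linear K1" "bounded_linear K2"
    and "\<And>g. norm (K0 g) \<le> B * norm g" "\<And>g. norm (K1 g) \<le> B * norm g" "\<And>g. norm (K2 g) \<le> B * norm g"
    and "norm e1 \<le> contraction_radius b B" "norm e2 \<le> contraction_radius b B"
      "norm g \<le> contraction_radius b B" "norm h \<le> contraction_radius b B"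
    and "steady_map b K0 K1 K2 e1 e2 g = g" "steady_map b K0 K1 K2 e1 e2 h = h"
  shows "g = h"
proof -
  have "norm (g - h) \<le> norm (g - h) / 2"
    using steady_map_contraction[OF assms(1-12)] assms(13,14) by simp
  then show ?thesis by simp
qed

text \<open>The map sends 0 to \<open>e1\<close>, so the Lipschitz constant 1/2 and the bound
  \<open>\<rho> / 2\<close> for \<open>e1\<close> keep the ball of radius \<open>\<rho>\<close>
  invariant. The closed invariant set \<open>S\<close> hands properties of the iterates on to the
  fixed point; it will encode reality and vanishing at the centre.\<close>

lemma steady_map_fixpoint_exists:
  fixes K0 K1 K2 :: "'a::{real_normed_algebra_1, comm_ring_1, banach} \<Rightarrow> 'a"
  assumes b: "b \<ge> 0" and B: "B \<ge> 0"
    and lin: "bounded_linear K0" "bounded_linear K1" "bounded_linear K2"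
    and K: "\<And>g. norm (K0 g) \<le> B * norm g" "\<And>g. norm (K1 g) \<le> B * norm g" "\<And>g. norm (K2 g) \<le> B * norm g"
    and \<rho>: "\<rho> \<le> contraction_radius b B" "norm e1 \<le> \<rho> / 2" "norm e2 \<le> \<rho>"
    and S: "closed S" "0 \<in> S" "\<And>g. g \<in> S \<Longrightarrow> steady_map b K0 K1 K2 e1 e2 g \<in> S"
  shows "\<exists>g\<in>S. norm g \<le> \<rho> \<and> steady_map b K0 K1 K2 e1 e2 g = g"
proof -
  let ?N = "steady_map b K0 K1 K2 e1 e2"
  have \<rho>0: "\<rho> \<ge> 0" using \<rho>(3) norm_ge_zero order_trans by blast
  have K_zero: "K0 0 = 0" "K1 0 = 0" "K2 0 = 0"
    using lin by (simp_all add: bounded_linear.linear linear_0)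
  have lip: "norm (?N g - ?N h) \<le> norm (g - h) / 2" if "norm g \<le> \<rho>" "norm h \<le> \<rho>" for g h
    by (rule steady_map_contraction[OF b B lin K]) (use \<rho> that \<rho>0 in auto)
  have self: "norm (?N g) \<le> \<rho>" if "norm g \<le> \<rho>" for g
  proof -
    have "norm (?N g) \<le> norm (?N 0) + norm (?N g - ?N 0)" by (rule norm_triangle_sub)
    also have "\<dots> \<le> \<rho> / 2 + \<rho> / 2"
      using lip[of g 0] that \<rho> \<rho>0 by (intro add_mono) (auto simp: steady_map_def K_zero)
    finally show ?thesis by simp
  qed
  have "\<exists>!g\<in>S \<inter> cball 0 \<rho>. ?N g = g"
  proof (rule Banach_fix[where c = "1 / 2"])
    show "complete (S \<inter> cball 0 \<rho>)" using S(1) by (simp add: complete_eq_closed closed_Int)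
    show "S \<inter> cball 0 \<rho> \<noteq> {}" using S(2) \<rho>0 by auto
    show "?N ` (S \<inter> cball 0 \<rho>) \<subseteq> S \<inter> cball 0 \<rho>" using S(3) self by auto
    show "dist (?N x) (?N y) \<le> 1 / 2 * dist x y" if "x \<in> S \<inter> cball 0 \<rho>" "y \<in> S \<inter> cball 0 \<rho>" for x y
      using lip[of x y] that by (simp add: dist_norm)
  qed auto
  then show ?thesis by auto
qed

section \<open>Fourier series and the Sobolev space\<close>

text \<open>The index is kept apart from its frequency so that Fourier series and series over modes,
  where many indices share a frequency, are treated alike.\<close>

definition trig_sum :: "('i \<Rightarrow> int) \<Rightarrow> ('i \<Rightarrow> complex) \<Rightarrow> (real \<Rightarrow> real) \<Rightarrow> bool" where
  "trig_sum \<nu> c v \<longleftrightarrow>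
     (\<forall>\<theta>. ((\<lambda>i. c i * cis (of_int (\<nu> i) * \<theta>)) has_sum complex_of_real (v \<theta>)) UNIV)"

lemma trig_sumD: "trig_sum \<nu> c v \<Longrightarrow> ((\<lambda>i. c i * cis (of_int (\<nu> i) * \<theta>)) has_sum complex_of_real (v \<theta>)) UNIV"
  by (simp add: trig_sum_def)

text \<open>At \<theta> = 0 the terms are the coefficients themselves, and unconditional summability
  of complex numbers is absolute summability.\<close>

lemma trig_sum_summable:
  assumes "trig_sum \<nu> c v"
  shows "(\<lambda>i. norm (c i)) summable_on UNIV"
  using has_sum_imp_summable[OF trig_sumD[OF assms, of 0]]
  by (simp add: summable_on_iff_abs_summable_on_complex)

lemma has_sum_trig:
  assumes "(\<lambda>i. norm (c i)) summable_on UNIV"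
  shows "((\<lambda>i. c i * cis (of_int (\<nu> i) * \<theta>)) has_sum (\<Sum>\<^sub>\<infinity>i. c i * cis (of_int (\<nu> i) * \<theta>))) UNIV"
proof -
  have "(\<lambda>i. norm (c i * cis (of_int (\<nu> i) * \<theta>))) summable_on UNIV"
    using assms by (simp add: norm_mult)
  then show ?thesis using abs_summable_summable by fastforce
qed

lemma uniform_limit_trig:
  fixes c :: "'i \<Rightarrow> complex" and \<nu> :: "'i \<Rightarrow> int"
  assumes "(\<lambda>i. norm (c i)) summable_on UNIV"
  shows "uniform_limit S (\<lambda>F \<theta>. \<Sum>i\<in>F. c i * cis (of_int (\<nu> i) * \<theta>))
     (\<lambda>\<theta>. \<Sum>\<^sub>\<infinity>i. c i * cis (of_int (\<nu> i) * \<theta>)) (finite_subsets_at_top UNIV)"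
  by (rule Weierstrass_m_test_general[OF _ assms]) (simp add: norm_mult)

lemma continuous_on_trig:
  fixes c :: "'i \<Rightarrow> complex" and \<nu> :: "'i \<Rightarrow> int"
  assumes "(\<lambda>i. norm (c i)) summable_on UNIV"
  shows "continuous_on S (\<lambda>\<theta>. \<Sum>\<^sub>\<infinity>i. c i * cis (of_int (\<nu> i) * \<theta>))"
  by (rule uniform_limit_theorem[OF _ uniform_limit_trig[OF assms]])
    (auto intro!: continuous_intros always_eventually)

lemma has_vector_derivative_cis_mult:
  "((\<lambda>t. cis (k * t)) has_vector_derivative \<i> * of_real k * cis (k * t)) (at t within S)"
  unfolding cis_conv_exp
  by (auto intro!: derivative_eq_intros has_vector_derivative_real_field simp: algebra_simps)

lemma has_vector_derivative_trig_monomial: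
  "((\<lambda>t. c * cis (of_int n * t)) has_vector_derivative \<i> * of_int n * c * cis (of_int n * t)) (at t within S)"
  using has_vector_derivative_mult_right[OF has_vector_derivative_cis_mult[of "of_int n"], of c]
  by (simp add: mult_ac)

text \<open>Termwise differentiation through the fundamental theorem of calculus: the differentiated
  series converges uniformly, so its sum is continuous and integrates to the increment of the
  original series.\<close>

lemma has_vector_derivative_trig:
  fixes c :: "'i \<Rightarrow> complex" and \<nu> :: "'i \<Rightarrow> int"
  assumes c: "(\<lambda>i. norm (c i)) summable_on UNIV"
    and d: "(\<lambda>i. norm (\<i> * of_int (\<nu> i) * c i)) summable_on UNIV"
  shows "((\<lambda>\<theta>. \<Sum>\<^sub>\<infinity>i. c i * cis (of_int (\<nu> i) * \<theta>)) has_vector_derivative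
     (\<Sum>\<^sub>\<infinity>i. \<i> * of_int (\<nu> i) * c i * cis (of_int (\<nu> i) * \<theta>))) (at \<theta>)"
proof -
  let ?f = "\<lambda>\<theta>. \<Sum>\<^sub>\<infinity>i. c i * cis (of_int (\<nu> i) * \<theta>)"
  let ?g = "\<lambda>\<theta>. \<Sum>\<^sub>\<infinity>i. \<i> * of_int (\<nu> i) * c i * cis (of_int (\<nu> i) * \<theta>)"
  \<comment> \<open>Starting one unit to the left puts \<theta> in the interior of the interval, so
    the derivative within it is two-sided.\<close>
  let ?a = "\<theta> - 1"
  have eq: "?f ?a + integral {?a..t} ?g = ?f t" if "t \<in> {?a..\<theta> + 1}" for t
  proof -
    let ?s = "\<lambda>F \<theta>. \<Sum>i\<in>F. c i * cis (of_int (\<nu> i) * \<theta>)"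
    let ?s' = "\<lambda>F \<theta>. \<Sum>i\<in>F. \<i> * of_int (\<nu> i) * c i * cis (of_int (\<nu> i) * \<theta>)"
    have "uniform_limit {?a..t} ?s' ?g (finite_subsets_at_top UNIV)"
      by (rule uniform_limit_trig[OF d])
    then obtain I J where I: "\<And>F. (?s' F has_integral I F) {?a..t}"
        and J: "(?g has_integral J) {?a..t}" and IJ: "(I \<longlongrightarrow> J) (finite_subsets_at_top UNIV)"
      by (rule uniform_limit_integral) (auto intro!: continuous_intros)
    have "(?s' F has_integral ?s F t - ?s F ?a) {?a..t}" for F
      using that
      by (intro fundamental_theorem_of_calculus)
        (auto intro!: has_vector_derivative_sum has_vector_derivative_trig_monomial)
    with I have I_eq: "I F = ?s F t - ?s F ?a" for F
      by (rule has_integral_unique)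
    have lim: "((\<lambda>F. ?s F t) \<longlongrightarrow> ?f t) (finite_subsets_at_top UNIV)" for t
      using has_sum_trig[OF c] unfolding has_sum_def .
    have "(I \<longlongrightarrow> ?f t - ?f ?a) (finite_subsets_at_top UNIV)"
      unfolding I_eq by (intro tendsto_diff lim)
    with IJ have "J = ?f t - ?f ?a"
      by (rule tendsto_unique[OF finite_subsets_at_top_neq_bot])
    then show ?thesis using J by (simp add: integral_unique)
  qed
  have "((\<lambda>t. ?f ?a + integral {?a..t} ?g) has_vector_derivative 0 + ?g \<theta>) (at \<theta> within {?a..\<theta> + 1})"
    by (intro has_vector_derivative_add has_vector_derivative_const integral_has_vector_derivative
      continuous_on_trig d) auto
  then have "(?f has_vector_derivative 0 + ?g \<theta>) (at \<theta> within {?a..\<theta> + 1})"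
    by (rule has_vector_derivative_transform[rotated 2]) (use eq in auto)
  then show ?thesis by (simp add: at_within_Icc_at)
qed

lemma trig_sum_eq: "trig_sum \<nu> c v \<Longrightarrow> complex_of_real (v \<theta>) = (\<Sum>\<^sub>\<infinity>i. c i * cis (of_int (\<nu> i) * \<theta>))"
  using infsumI[OF trig_sumD] by metis

lemma trig_sum_deriv:
  assumes t: "trig_sum \<nu> c v" and s: "(\<lambda>i. norm (c i) * \<bar>of_int (\<nu> i)\<bar>) summable_on UNIV"
  shows "trig_sum \<nu> (\<lambda>i. \<i> * of_int (\<nu> i) * c i) (deriv v)"
proof -
  have s': "(\<lambda>i. norm (\<i> * of_int (\<nu> i) * c i)) summable_on UNIV"
    using s by (simp add: norm_mult mult.commute)
  have "complex_of_real (deriv v \<theta>) = (\<Sum>\<^sub>\<infinity>i. \<i> * of_int (\<nu> i) * c i * cis (of_int (\<nu> i) * \<theta>))" for \<theta>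
  proof -
    let ?D = "\<Sum>\<^sub>\<infinity>i. \<i> * of_int (\<nu> i) * c i * cis (of_int (\<nu> i) * \<theta>)"
    have D: "((\<lambda>\<theta>. complex_of_real (v \<theta>)) has_vector_derivative ?D) (at \<theta>)"
      using has_vector_derivative_trig[OF trig_sum_summable[OF t] s'] by (simp add: trig_sum_eq[OF t])
    from bounded_linear.has_vector_derivative[OF bounded_linear_Re D]
    have r: "(v has_real_derivative Re ?D) (at \<theta>)"
      by (simp add: has_real_derivative_iff_has_vector_derivative)
    then have "((\<lambda>\<theta>. complex_of_real (v \<theta>)) has_vector_derivative complex_of_real (Re ?D)) (at \<theta>)"
      by (simp add: has_vector_derivative_of_real has_real_derivative_iff_has_vector_derivative)
    \<comment> \<open>Both are derivatives of the same function, one of them real, so the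
      differentiated series sums to a real number.\<close>
    with D have "?D = complex_of_real (Re ?D)" by (rule vector_derivative_unique_at)
    then show ?thesis using DERIV_imp_deriv[OF r] by simp
  qed
  then show ?thesis using has_sum_trig[OF s'] by (simp add: trig_sum_def)
qed

lemma trig_sum_continuous:
  assumes "trig_sum \<nu> c v"
  shows "continuous_on S v"
proof -
  have "continuous_on S (\<lambda>\<theta>. complex_of_real (v \<theta>))"
    unfolding trig_sum_eq[OF assms] by (rule continuous_on_trig[OF trig_sum_summable[OF assms]])
  from continuous_on_Re[OF this] show ?thesis by simp
qed

lemma cis_int_periodic: "cis (of_int n * (\<theta> + 2 * pi)) = cis (of_int n * \<theta>)"
  using cis_multiple_2pi[of "of_int n"] by (simp add: distrib_left mult_ac flip: cis_mult)

lemma trig_sum_periodic: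
  assumes "trig_sum \<nu> c v"
  shows "v (\<theta> + 2 * pi) = v \<theta>"
proof -
  have "complex_of_real (v (\<theta> + 2 * pi)) = complex_of_real (v \<theta>)"
    unfolding trig_sum_eq[OF assms] by (simp only: cis_int_periodic)
  then show ?thesis by simp
qed

lemma has_integral_cis_int:
  "((\<lambda>t. cis (of_int k * t)) has_integral (if k = 0 then 2 * pi else 0)) {0..2 * pi}"
proof (cases "k = 0")
  case True
  then show ?thesis
    using has_integral_const_real[of "1::complex" 0 "2 * pi"] by (simp add: scaleR_conv_of_real)
next
  case False
  have "((\<lambda>t. cis (of_int k * t)) has_integral
     cis (of_int k * (2 * pi)) / (\<i> * of_int k) - cis (of_int k * 0) / (\<i> * of_int k)) {0..2 * pi}"
    using False
    using has_vector_derivative_divide[OF has_vector_derivative_cis_mult[of "of_int k"], of "\<i> * of_int k"]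
    by (intro fundamental_theorem_of_calculus) auto
  then show ?thesis using False cis_int_periodic[of k 0] by simp
qed

lemma integral_trig_cis:
  fixes a :: "int \<Rightarrow> complex"
  assumes a: "(\<lambda>n. norm (a n)) summable_on UNIV"
  shows "((\<lambda>\<theta>. (\<Sum>\<^sub>\<infinity>n. a n * cis (of_int n * \<theta>)) * cis (- (of_int m * \<theta>))) has_integral 2 * pi * a m) {0..2 * pi}"
proof -
  let ?g = "\<lambda>\<theta>. (\<Sum>\<^sub>\<infinity>n. a n * cis (of_int n * \<theta>)) * cis (- (of_int m * \<theta>))"
  let ?s = "\<lambda>F \<theta>. \<Sum>n\<in>F. a n * cis (of_int n * \<theta>) * cis (- (of_int m * \<theta>))"
  have "uniform_limit {0..2 * pi} ?s
     (\<lambda>\<theta>. \<Sum>\<^sub>\<infinity>n. a n * cis (of_int n * \<theta>) * cis (- (of_int m * \<theta>))) (finite_subsets_at_top UNIV)"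
    by (rule Weierstrass_m_test_general[OF _ a]) (simp add: norm_mult)
  then have "uniform_limit {0..2 * pi} ?s ?g (finite_subsets_at_top UNIV)"
    by (simp add: infsum_cmult_left')
  then obtain I J where I: "\<And>F. (?s F has_integral I F) {0..2 * pi}"
      and J: "(?g has_integral J) {0..2 * pi}" and IJ: "(I \<longlongrightarrow> J) (finite_subsets_at_top UNIV)"
    by (rule uniform_limit_integral) (auto intro!: continuous_intros)
  have "(?s F has_integral (if m \<in> F then 2 * pi * a m else 0)) {0..2 * pi}" if "finite F" for F
  proof -
    have "((\<lambda>\<theta>. \<Sum>n\<in>F. a n * cis (of_int (n - m) * \<theta>)) has_integral
        (\<Sum>n\<in>F. a n * (if n - m = 0 then 2 * pi else 0))) {0..2 * pi}"
      by (intro has_integral_sum has_integral_mult_right has_integral_cis_int that)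
    moreover have "(\<Sum>n\<in>F. a n * (if n - m = 0 then 2 * pi else 0)) = (if m \<in> F then 2 * pi * a m else 0)"
      using that by (simp add: if_distrib sum.delta cong: if_cong)
    ultimately show ?thesis by (simp add: cis_mult left_diff_distrib mult.assoc)
  qed
  then have "I F = 2 * pi * a m" if "finite F" "m \<in> F" for F
    using has_integral_unique[OF I] that by fastforce
  then have "eventually (\<lambda>F. I F = 2 * pi * a m) (finite_subsets_at_top UNIV)"
    unfolding eventually_finite_subsets_at_top by (intro exI[of _ "{m}"]) auto
  then have "(I \<longlongrightarrow> 2 * pi * a m) (finite_subsets_at_top UNIV)" by (rule tendsto_eventually)
  with IJ have "J = 2 * pi * a m" by (rule tendsto_unique[OF finite_subsets_at_top_neq_bot])
  with J show ?thesis by simp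
qed

lemma trig_sum_fourier_coeff:
  assumes "trig_sum (\<lambda>n. n) a v"
  shows "fourier_coeff v n = a n"
  using integral_unique[OF integral_trig_cis[OF trig_sum_summable[OF assms], of n]]
  by (simp add: fourier_coeff_def trig_sum_eq[OF assms, symmetric])

lemma trig_sum_fibre:
  assumes "trig_sum \<nu> c v"
  shows "trig_sum (\<lambda>n. n) (\<lambda>n. \<Sum>\<^sub>\<infinity>i\<in>{i. \<nu> i = n}. c i) v"
  unfolding trig_sum_def
proof
  fix \<theta>
  have "((\<lambda>n. \<Sum>\<^sub>\<infinity>i\<in>{i. \<nu> i = n}. c i * cis (of_int (\<nu> i) * \<theta>)) has_sum complex_of_real (v \<theta>)) UNIV"
    using has_sum_fibre[OF has_sum_imp_summable[OF trig_sumD[OF assms]]] infsumI[OF trig_sumD[OF assms]] by simp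
  moreover have "(\<Sum>\<^sub>\<infinity>i\<in>{i. \<nu> i = n}. c i * cis (of_int (\<nu> i) * \<theta>)) =
      (\<Sum>\<^sub>\<infinity>i\<in>{i. \<nu> i = n}. c i) * cis (of_int n * \<theta>)" for n
    by (subst infsum_cmult_left'[symmetric]) (rule infsum_cong, simp)
  ultimately show "((\<lambda>n. (\<Sum>\<^sub>\<infinity>i\<in>{i. \<nu> i = n}. c i) * cis (of_int n * \<theta>)) has_sum complex_of_real (v \<theta>)) UNIV"
    by simp
qed

lemma sum_squares_le_square_sum:
  fixes x :: "'i \<Rightarrow> real"
  assumes "finite F" "\<And>i. i \<in> F \<Longrightarrow> x i \<ge> 0"
  shows "(\<Sum>i\<in>F. (x i)\<^sup>2) \<le> (\<Sum>i\<in>F. x i)\<^sup>2"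
proof -
  have "(\<Sum>i\<in>F. (x i)\<^sup>2) \<le> (\<Sum>i\<in>F. x i * (\<Sum>j\<in>F. x j))"
    using assms by (intro sum_mono) (auto simp: power2_eq_square intro!: mult_left_mono member_le_sum)
  then show ?thesis by (simp add: power2_eq_square sum_distrib_right)
qed

text \<open>Once equal frequencies are collected, the absolute coefficients times n^4 + 1 are
  summable. The Hilbertian norm follows from (n^4)^2 + 1 \<le> (n^4 + 1)^2 and from a sum of squares
  being at most the square of the sum.\<close>

lemma trig_sum_sobolev:
  assumes t: "trig_sum \<nu> c v" and s: "(\<lambda>i. norm (c i) * (of_int (\<nu> i) ^ 4 + 1)) summable_on UNIV"
  shows "v \<in> sobolev 4" "sobolev_norm 4 v \<le> (\<Sum>\<^sub>\<infinity>i. norm (c i) * (of_int (\<nu> i) ^ 4 + 1))"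
proof -
  let ?a = "\<lambda>n. \<Sum>\<^sub>\<infinity>i\<in>{i. \<nu> i = n}. c i"
  let ?x = "\<lambda>n. norm (?a n) * (of_int n ^ 4 + 1)"
  let ?T = "\<Sum>\<^sub>\<infinity>i. norm (c i) * (of_int (\<nu> i) ^ 4 + 1)"
  have ta: "trig_sum (\<lambda>n. n) ?a v" by (rule trig_sum_fibre[OF t])
  have csum: "c summable_on UNIV"
    using trig_sum_summable[OF t] by (rule abs_summable_summable)
  have x: "?x summable_on UNIV" "infsum ?x UNIV \<le> ?T"
    using abs_summable_fibre[where \<pi> = \<nu> and F = c and w = "\<lambda>n. of_int n ^ 4 + 1", OF s _ csum] by auto
  have x0: "?x n \<ge> 0" for n by simp
  let ?y = "\<lambda>n. (cmod (fourier_coeff v n))\<^sup>2 * (real_of_int n ^ (2 * 4) + 1)"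
  have y: "?y n \<le> (?x n)\<^sup>2" for n
  proof -
    have "((of_int n :: real) ^ 4)\<^sup>2 + 1 \<le> (of_int n ^ 4 + 1)\<^sup>2"
      by (subst power2_sum) simp
    then have le: "(of_int n :: real) ^ (2 * 4) + 1 \<le> (of_int n ^ 4 + 1)\<^sup>2"
      by (simp flip: power_mult)
    show ?thesis
      unfolding trig_sum_fourier_coeff[OF ta] power_mult_distrib by (rule mult_left_mono[OF le]) simp
  qed
  have T0: "?T \<ge> 0" by (intro infsum_nonneg) auto
  have fin: "sum ?y F \<le> ?T\<^sup>2" if "finite F" for F
  proof -
    have "sum ?y F \<le> (\<Sum>n\<in>F. (?x n)\<^sup>2)" by (intro sum_mono y)
    also have "\<dots> \<le> (\<Sum>n\<in>F. ?x n)\<^sup>2"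
      using that x0 by (rule sum_squares_le_square_sum)
    also have "\<dots> \<le> ?T\<^sup>2"
      using finite_sum_le_infsum[OF x(1) that] x(2) x0
      by (intro power_mono sum_nonneg) (auto intro: order_trans)
    finally show ?thesis .
  qed
  have ysum: "?y summable_on UNIV"
    by (rule nonneg_bdd_above_summable_on) (use fin in \<open>auto intro!: bdd_aboveI2[where M = "?T\<^sup>2"]\<close>)
  then show "v \<in> sobolev 4"
    using trig_sum_continuous[OF t] trig_sum_periodic[OF t] by (simp add: sobolev_def)
  have le: "infsum ?y UNIV \<le> ?T\<^sup>2"
    by (rule infsum_le_finite_sums[OF ysum fin])
  show "sobolev_norm 4 v \<le> ?T"
    unfolding sobolev_norm_def by (rule real_le_lsqrt[OF T0 le])
qed

section \<open>Completeness of the trigonometric system\<close>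

lemma continuous_on_circle_of_periodic:
  fixes f :: "real \<Rightarrow> real"
  assumes f: "continuous_on {0..2 * pi} f" and per: "f (2 * pi) = f 0"
  shows "continuous_on (sphere 0 1) (\<lambda>z. f (Arg2pi z))"
    and "\<theta> \<in> {0..2 * pi} \<Longrightarrow> f (Arg2pi (cis \<theta>)) = f \<theta>"
proof -
  show eq: "f (Arg2pi (cis \<theta>)) = f \<theta>" if "\<theta> \<in> {0..2 * pi}" for \<theta>
  proof (cases "\<theta> = 2 * pi")
    case True
    have "Arg2pi (cis 0) = 0" by (rule Arg2pi_unique[where r = 1]) auto
    then show ?thesis using True per by simp
  next
    case False
    then have "Arg2pi (cis \<theta>) = \<theta>"
      using that by (intro Arg2pi_unique[where r = 1]) (auto simp: cis_conv_exp)
    then show ?thesis by simp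
  qed
  have img: "cis ` {0..2 * pi} = sphere 0 1"
  proof
    show "sphere 0 1 \<subseteq> cis ` {0..2 * pi}"
    proof
      fix z :: complex assume "z \<in> sphere 0 1"
      then have "z = cis (Arg2pi z)" using Arg2pi_eq[of z] by (simp add: cis_conv_exp)
      then show "z \<in> cis ` {0..2 * pi}"
        using Arg2pi_ge_0[of z] Arg2pi_lt_2pi[of z] by (intro image_eqI[of _ _ "Arg2pi z"]) auto
    qed
  qed auto
  \<comment> \<open>\<open>Arg2pi\<close> jumps at 1, so continuity comes from the quotient
    topology: \<open>cis\<close> maps the compact interval onto the circle, and composing with it
    gives back the continuous \<open>f\<close>.\<close>
  show "continuous_on (sphere 0 1) (\<lambda>z. f (Arg2pi z))"
    proof (subst continuous_on_open_gen[where T = "(\<lambda>z. f (Arg2pi z)) ` sphere 0 1"], blast, intro allI impI)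
    fix U assume U: "openin (top_of_set ((\<lambda>z. f (Arg2pi z)) ` sphere 0 1)) U"
    let ?V = "sphere 0 1 \<inter> (\<lambda>z. f (Arg2pi z)) -` U"
    have "(\<lambda>z. f (Arg2pi z)) ` sphere 0 1 = f ` {0..2 * pi}"
      unfolding img[symmetric] image_image by (rule image_cong) (auto simp: eq)
    with U have "openin (top_of_set {0..2 * pi}) ({0..2 * pi} \<inter> f -` U)"
      using f continuous_on_open_gen[of f "{0..2 * pi}" "f ` {0..2 * pi}"] by auto
    also have "{0..2 * pi} \<inter> f -` U = {0..2 * pi} \<inter> cis -` ?V"
      using eq by auto
    finally show "openin (top_of_set (sphere 0 1)) ?V"
      using Abstract_Topology_2.continuous_imp_quotient_map[of "{0..2 * pi}" cis "sphere 0 1" ?V] img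
        continuous_on_cis[OF continuous_on_id] by auto
  qed
qed

text \<open>\<open>G\<close> is left general so that a product can be handled by absorbing one
  factor into it: by the first induction hypothesis the new \<open>G\<close> again has vanishing
  moments. A linear function of \<open>cis t\<close> is a combination of \<open>cis t\<close> and
  \<open>cis (- t)\<close>, which shifts \<open>n\<close> by one.\<close>

lemma integral_real_polynomial_cis:
  fixes p :: "complex \<Rightarrow> real" and G :: "real \<Rightarrow> complex"
  assumes "real_polynomial_function p" and "continuous_on {0..2 * pi} G"
    and "\<And>n::int. ((\<lambda>t. G t * cis (of_int n * t)) has_integral 0) {0..2 * pi}"
  shows "((\<lambda>t. G t * of_real (p (cis t)) * cis (of_int n * t)) has_integral 0) {0..2 * pi}"
  using assms
proof (induction arbitrary: G n rule: real_polynomial_function.induct)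
  case (linear f)
  let ?a = "(of_real (f 1) - \<i> * of_real (f \<i>)) / 2 :: complex"
  let ?b = "(of_real (f 1) + \<i> * of_real (f \<i>)) / 2 :: complex"
  have f: "f (cis t) = cos t * f 1 + sin t * f \<i>" for t
  proof -
    have "cis t = cos t *\<^sub>R 1 + sin t *\<^sub>R \<i>" by (simp add: complex_eq_iff)
    then show ?thesis
      using bounded_linear.linear[OF linear(1)] by (simp add: linear_add linear_scale)
  qed
  have "of_real (f (cis t)) * cis (of_int n * t) = ?a * cis (of_int (n + 1) * t) + ?b * cis (of_int (n - 1) * t)" for t
  proof -
    have "of_real (f (cis t)) = ?a * cis t + ?b * cis (- t)"
      by (simp add: f complex_eq_iff field_simps)
    then show ?thesis
      by (simp add: distrib_right left_diff_distrib mult.assoc cis_mult add.commute)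
  qed
  then have eq: "G t * of_real (f (cis t)) * cis (of_int n * t) =
      ?a * (G t * cis (of_int (n + 1) * t)) + ?b * (G t * cis (of_int (n - 1) * t))" for t
    by (simp add: mult.assoc) (simp add: algebra_simps)
  have "((\<lambda>t. ?a * (G t * cis (of_int (n + 1) * t)) + ?b * (G t * cis (of_int (n - 1) * t)))
     has_integral ?a * 0 + ?b * 0) {0..2 * pi}"
    by (intro has_integral_add has_integral_mult_right linear(3))
  then show ?case by (simp only: eq mult_zero_right add_0)
next
  case (const c)
  then show ?case using has_integral_mult_right[OF const(2)[of n], of "of_real c"] by (simp add: mult_ac)
next
  case (add f g)
  show ?case
    using has_integral_add[OF add.IH(1)[OF add.prems, of n] add.IH(2)[OF add.prems, of n]]
    by (simp add: algebra_simps)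
next
  case (mult f g)
  have "continuous_on UNIV f"
    using mult.hyps(1) by (simp add: real_polynomial_function_eq continuous_on_polymonial_function)
  then have "continuous_on {0..2 * pi} (\<lambda>t. f (cis t))"
    by (rule continuous_on_compose2[OF _ continuous_on_cis[OF continuous_on_id]]) simp
  then have "continuous_on {0..2 * pi} (\<lambda>t. complex_of_real (f (cis t)))"
    by (rule continuous_on_of_real)
  then have c: "continuous_on {0..2 * pi} (\<lambda>t. G t * of_real (f (cis t)))"
    using mult.prems(1) by (intro continuous_on_mult)
  show ?case
    using mult.IH(2)[OF c mult.IH(1)[OF mult.prems], of n] by (simp add: mult.assoc)
qed

text \<open>Stone-Weierstrass on the unit circle gives a polynomial p within e of f. Orthogonality
  turns the integral of f^2 into that of f (f - p), at most 2 pi M e for a bound M of |f|.\<close>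

lemma integral_against_polynomials_zero_imp_zero:
  fixes f :: "real \<Rightarrow> real"
  assumes f: "continuous_on {0..2 * pi} f" and per: "f (2 * pi) = f 0"
    and orth: "\<And>p :: complex \<Rightarrow> real. real_polynomial_function p \<Longrightarrow>
      ((\<lambda>t. f t * p (cis t)) has_integral 0) {0..2 * pi}"
    and t: "t \<in> {0..2 * pi}"
  shows "f t = 0"
proof -
  note circ = continuous_on_circle_of_periodic[OF f per]
  have "bounded (f ` {0..2 * pi})"
    by (intro compact_imp_bounded compact_continuous_image f compact_Icc)
  then obtain M where M: "\<And>t. t \<in> {0..2 * pi} \<Longrightarrow> \<bar>f t\<bar> \<le> M"
    unfolding bounded_iff by fastforce
  have M0: "M \<ge> 0" using M[of 0] by (simp add: order_trans[OF abs_ge_zero])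
  have f2: "(\<lambda>t. f t * f t) integrable_on {0..2 * pi}"
    using f by (intro integrable_continuous_interval continuous_on_mult)
  have small: "integral {0..2 * pi} (\<lambda>t. f t * f t) \<le> e * (2 * pi * M)" if e: "e > 0" for e
  proof -
    obtain p where p: "real_polynomial_function p" "\<And>z. z \<in> sphere 0 1 \<Longrightarrow> \<bar>f (Arg2pi z) - p z\<bar> < e"
      using Stone_Weierstrass_real_polynomial_function[OF compact_sphere circ(1) e] by metis
    have I: "((\<lambda>t. f t * f t - f t * p (cis t)) has_integral integral {0..2 * pi} (\<lambda>t. f t * f t) - 0) {0..2 * pi}"
      by (intro has_integral_diff orth p integrable_integral f2)
    have C: "((\<lambda>_. M * e) has_integral (2 * pi - 0) *\<^sub>R (M * e)) {0..2 * pi}"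
      by (intro has_integral_const_real[THEN has_integral_eq_rhs]) simp
    have le: "f t * f t - f t * p (cis t) \<le> M * e" if "t \<in> {0..2 * pi}" for t
    proof -
      have "f t * f t - f t * p (cis t) = f t * (f (Arg2pi (cis t)) - p (cis t))"
        unfolding circ(2)[OF that] by (rule right_diff_distrib[symmetric])
      also have "\<dots> \<le> \<bar>f t\<bar> * \<bar>f (Arg2pi (cis t)) - p (cis t)\<bar>"
        unfolding abs_mult[symmetric] by (rule abs_ge_self)
      also have "\<dots> \<le> M * e"
        using less_imp_le[OF p(2), of "cis t"] by (intro mult_mono M[OF that] M0) auto
      finally show ?thesis .
    qed
    have "integral {0..2 * pi} (\<lambda>t. f t * f t) - 0 \<le> (2 * pi - 0) *\<^sub>R (M * e)"
      by (rule has_integral_le[OF I C le])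
    then show ?thesis by (simp add: mult_ac)
  qed
  have "integral {0..2 * pi} (\<lambda>t. f t * f t) \<le> 0"
  proof (rule field_le_epsilon)
    fix e :: real assume e: "e > 0"
    define c where "c = 2 * pi * M"
    have c0: "c \<ge> 0" unfolding c_def by (intro mult_nonneg_nonneg M0) auto
    then have c: "c + 1 > 0" "c \<ge> 0" by linarith+
    \<comment> \<open>The accuracy is \<open>e / (c + 1)\<close> rather than \<open>e / c\<close>
      because \<open>c\<close> may be zero.\<close>
    have "integral {0..2 * pi} (\<lambda>t. f t * f t) \<le> e / (c + 1) * c"
      unfolding c_def by (rule small) (intro divide_pos_pos e c(1)[unfolded c_def])
    also have "\<dots> = e * c / (c + 1)" by (rule times_divide_eq_left)
    also have "\<dots> \<le> e"
      using c e by (simp add: pos_divide_le_eq distrib_left)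
    finally show "integral {0..2 * pi} (\<lambda>t. f t * f t) \<le> 0 + e" by simp
  qed
  moreover have "0 \<le> integral {0..2 * pi} (\<lambda>t. f t * f t)"
    by (rule integral_nonneg[OF f2]) simp
  ultimately have "integral {0..2 * pi} (\<lambda>t. f t * f t) = 0" by linarith
  then have "f t * f t = 0"
    using integral_eq_0_iff[OF continuous_on_mult[OF f f]] t pi_gt_zero by simp
  then show ?thesis by simp
qed

lemma periodic_representative:
  fixes f :: "real \<Rightarrow> 'a"
  assumes per: "\<And>\<theta>. f (\<theta> + 2 * pi) = f \<theta>"
  obtains t where "t \<in> {0..2 * pi}" "f t = f \<theta>"
proof
  interpret periodic_fun_simple f "2 * pi" by unfold_locales (rule per)
  let ?k = "\<lfloor>\<theta> / (2 * pi)\<rfloor>"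
  show "\<theta> - of_int ?k * (2 * pi) \<in> {0..2 * pi}"
    using floor_divide_lower[of "2 * pi" \<theta>] floor_divide_upper[of "2 * pi" \<theta>]
    by (auto simp: algebra_simps)
  show "f (\<theta> - of_int ?k * (2 * pi)) = f \<theta>" by (rule minus_of_int)
qed

text \<open>The approximating polynomials are real while the exponentials are not. Hence the
  vanishing moments are first extended from exponentials to polynomials, and only then split into
  real and imaginary parts.\<close>

lemma fourier_uniqueness:
  fixes G :: "real \<Rightarrow> complex"
  assumes G: "continuous_on UNIV G" and per: "\<And>\<theta>. G (\<theta> + 2 * pi) = G \<theta>"
    and zero: "\<And>n::int. ((\<lambda>t. G t * cis (of_int n * t)) has_integral 0) {0..2 * pi}"
  shows "G \<theta> = 0"
proof -
  have cont: "continuous_on {0..2 * pi} G" using G by (rule continuous_on_subset) simp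
  have orth: "((\<lambda>t. G t * of_real (p (cis t))) has_integral 0) {0..2 * pi}"
    if "real_polynomial_function p" for p
    using integral_real_polynomial_cis[OF that cont zero, of 0] by simp
  have "Re (G t) = 0" if t: "t \<in> {0..2 * pi}" for t
  proof (rule integral_against_polynomials_zero_imp_zero[OF _ _ _ t])
    show "((\<lambda>t. Re (G t) * p (cis t)) has_integral 0) {0..2 * pi}" if "real_polynomial_function p" for p
      using has_integral_linear[OF orth[OF that] bounded_linear_Re] by (simp add: o_def)
  qed (use cont per[of 0] in \<open>auto intro: continuous_on_Re\<close>)
  moreover have "Im (G t) = 0" if t: "t \<in> {0..2 * pi}" for t
  proof (rule integral_against_polynomials_zero_imp_zero[OF _ _ _ t])
    show "((\<lambda>t. Im (G t) * p (cis t)) has_integral 0) {0..2 * pi}" if "real_polynomial_function p" for p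
      using has_integral_linear[OF orth[OF that] bounded_linear_Im] by (simp add: o_def)
  qed (use cont per[of 0] in \<open>auto intro: continuous_on_Im\<close>)
  ultimately have "G t = 0" if "t \<in> {0..2 * pi}" for t
    using that by (simp add: complex_eq_iff)
  then show ?thesis using periodic_representative[of G \<theta>, OF per] by metis
qed

text \<open>The difference of \<open>v\<close> and the sum of its Fourier series is continuous,
  periodic and has all moments zero.\<close>

lemma fourier_series_converges:
  assumes v: "continuous_on UNIV v" "\<And>\<theta>. v (\<theta> + 2 * pi) = v \<theta>"
    and a: "(\<lambda>n. norm (fourier_coeff v n)) summable_on UNIV"
  shows "trig_sum (\<lambda>n. n) (fourier_coeff v) v"
proof -
  let ?s = "\<lambda>\<theta>. \<Sum>\<^sub>\<infinity>n. fourier_coeff v n * cis (of_int n * \<theta>)"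
  let ?G = "\<lambda>\<theta>. complex_of_real (v \<theta>) - ?s \<theta>"
  have "?G \<theta> = 0" for \<theta>
  proof (rule fourier_uniqueness)
    show "continuous_on UNIV ?G"
      by (intro continuous_intros v continuous_on_trig a)
    show "?G (\<theta> + 2 * pi) = ?G \<theta>" for \<theta>
      by (simp only: v cis_int_periodic)
    show "((\<lambda>t. ?G t * cis (of_int n * t)) has_integral 0) {0..2 * pi}" for n
    proof -
      let ?h = "\<lambda>\<theta>. complex_of_real (v \<theta>) * cis (of_int n * \<theta>)"
      have "?h integrable_on {0..2 * pi}"
        by (intro integrable_continuous_interval continuous_intros continuous_on_subset[OF v(1)]) auto
      then have "(?h has_integral (2 * pi * fourier_coeff v (- n))) {0..2 * pi}"
        by (simp add: fourier_coeff_def has_integral_integrable_integral)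
      from has_integral_diff[OF this integral_trig_cis[OF a, of "- n"]]
      show ?thesis by (simp add: left_diff_distrib)
    qed
  qed
  then show ?thesis using has_sum_trig[OF a] by (simp add: trig_sum_def)
qed

section \<open>Summability of Fourier coefficients in the Sobolev space\<close>

lemma summable_inverse_one_plus_square_int: "(\<lambda>n::int. 1 / (1 + (of_int n :: real)\<^sup>2)) summable_on UNIV"
proof -
  have nat: "(\<lambda>n::nat. 1 / (1 + (of_nat n :: real)\<^sup>2)) summable_on UNIV"
  proof -
    have "summable (\<lambda>n::nat. 1 / (1 + (of_nat n :: real)\<^sup>2))"
    proof (rule summable_comparison_test_ev)
      show "summable (\<lambda>n::nat. inverse ((of_nat n :: real)\<^sup>2))"
        using inverse_power_summable[of 2, where 'a = real] by simp
      show "\<forall>\<^sub>F n::nat in sequentially. norm (1 / (1 + (of_nat n :: real)\<^sup>2)) \<le> inverse ((of_nat n :: real)\<^sup>2)"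
        using eventually_gt_at_top[of 0]
        by eventually_elim (simp add: inverse_eq_divide frac_le)
    qed
    then show ?thesis by (intro summable_nonneg_imp_summable_on) auto
  qed
  have "(\<lambda>n::int. 1 / (1 + (of_int n :: real)\<^sup>2)) summable_on (range int)"
    using nat by (subst summable_on_reindex) (auto simp: o_def)
  moreover have "(\<lambda>n::int. 1 / (1 + (of_int n :: real)\<^sup>2)) summable_on (range (\<lambda>n. - int n))"
    using nat by (subst summable_on_reindex) (auto simp: o_def inj_def)
  ultimately have "(\<lambda>n::int. 1 / (1 + (of_int n :: real)\<^sup>2)) summable_on (range int \<union> range (\<lambda>n. - int n))"
    by (rule summable_on_union)
  also have "range int \<union> range (\<lambda>n. - int n) = UNIV"
    by (auto intro: int_cases2)
  finally show ?thesis .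
qed

text \<open>The Cauchy-Schwarz constant, with 6 / (1 + n^2) as a bound for (1 + |n|^3)^2 / (n^8 +
  1).\<close>

definition sobolev_embedding_const :: real where
  "sobolev_embedding_const = sqrt (\<Sum>\<^sub>\<infinity>n::int. 6 / (1 + (of_int n)\<^sup>2))"

text \<open>After multiplication by 1 + y^2 the left side is at most 2 (1 + y^2 + y^6 + y^8), and
  y^2 and y^6 are each at most 1 + y^8; this gives the factor 6.\<close>

lemma cube_weight_le:
  fixes x :: real
  shows "(1 + \<bar>x\<bar> ^ 3)\<^sup>2 \<le> 6 / (1 + x\<^sup>2) * (x ^ 8 + 1)"
proof -
  define y where "y = \<bar>x\<bar>"
  have y: "y \<ge> 0" by (simp add: y_def)
  have pow: "y ^ k \<le> 1 + y ^ 8" if "k \<le> 8" for k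
  proof (cases "y \<le> 1")
    case True
    then have "y ^ k \<le> 1" "0 \<le> y ^ 8" using y by (auto simp: power_le_one)
    then show ?thesis by linarith
  next
    case False
    then show ?thesis using power_increasing[OF that, of y] by linarith
  qed
  have "(1 + y ^ 3)\<^sup>2 \<le> 2 * (1 + y ^ 6)"
    using zero_le_power2[of "1 - y ^ 3"] by (simp add: power2_eq_square algebra_simps flip: power_add)
  then have "(1 + y ^ 3)\<^sup>2 * (1 + y\<^sup>2) \<le> 2 * (1 + y ^ 6) * (1 + y\<^sup>2)"
    by (rule mult_right_mono) simp
  also have "\<dots> = 2 * (1 + y ^ 2 + y ^ 6 + y ^ 8)"
    by (simp add: distrib_left distrib_right flip: power_add)
  also have "\<dots> \<le> 6 * (y ^ 8 + 1)"
    using pow[of 2] pow[of 6] by simp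
  finally have "(1 + y ^ 3)\<^sup>2 \<le> 6 * (y ^ 8 + 1) / (1 + y\<^sup>2)"
    by (simp add: pos_le_divide_eq add_pos_nonneg)
  then show ?thesis by (simp add: y_def)
qed

text \<open>The weight 1 + |n|^3 is the growth of the symbol of L, so for v = H - 1 the coefficients
  of L v become summable. Order 4 exceeds 3 by more than 1/2, which is the margin Cauchy-Schwarz
  asks for.\<close>

lemma sobolev_4_fourier:
  assumes v: "v \<in> sobolev 4"
  shows "(\<lambda>n. norm (fourier_coeff v n) * (1 + \<bar>of_int n\<bar> ^ 3)) summable_on UNIV"
    and "(\<Sum>\<^sub>\<infinity>n. norm (fourier_coeff v n) * (1 + \<bar>of_int n\<bar> ^ 3)) \<le> sobolev_embedding_const * sobolev_norm 4 v"
    and "trig_sum (\<lambda>n. n) (fourier_coeff v) v"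
proof -
  let ?x = "\<lambda>n. norm (fourier_coeff v n) * (1 + \<bar>of_int n :: real\<bar> ^ 3)"
  let ?y = "\<lambda>n. (cmod (fourier_coeff v n))\<^sup>2 * (real_of_int n ^ (2 * 4) + 1)"
  let ?w = "\<lambda>n::int. 6 / (1 + (of_int n :: real)\<^sup>2)"
  have y: "?y summable_on UNIV" using v by (simp add: sobolev_def)
  have w: "?w summable_on UNIV"
    using summable_on_cmult_right[OF summable_inverse_one_plus_square_int, of 6] by simp
  have fin: "(\<Sum>n\<in>F. ?x n) \<le> sobolev_embedding_const * sobolev_norm 4 v" if F: "finite F" for F
  proof -
    have x: "?x n \<le> sqrt (?w n) * sqrt (?y n)" for n
    proof -
      have "(?x n)\<^sup>2 \<le> (norm (fourier_coeff v n))\<^sup>2 * (?w n * (of_int n ^ 8 + 1))"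
        unfolding power_mult_distrib by (intro mult_left_mono cube_weight_le) auto
      then have "?x n \<le> sqrt (?w n * ?y n)"
        by (intro real_le_rsqrt) (simp add: mult_ac)
      then show ?thesis by (simp only: real_sqrt_mult)
    qed
    have "((\<Sum>n\<in>F. sqrt (?w n) * sqrt (?y n)))\<^sup>2 \<le> (\<Sum>n\<in>F. (sqrt (?w n))\<^sup>2) * (\<Sum>n\<in>F. (sqrt (?y n))\<^sup>2)"
      by (rule Cauchy_Schwarz_ineq_sum)
    also have "\<dots> = (\<Sum>n\<in>F. ?w n) * (\<Sum>n\<in>F. ?y n)" by simp
    also have "\<dots> \<le> infsum ?w UNIV * infsum ?y UNIV"
      using F by (intro mult_mono finite_sum_le_infsum y w infsum_nonneg sum_nonneg) auto
    finally have "(\<Sum>n\<in>F. sqrt (?w n) * sqrt (?y n)) \<le> sqrt (infsum ?w UNIV * infsum ?y UNIV)"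
      by (rule real_le_rsqrt)
    also have "\<dots> = sobolev_embedding_const * sobolev_norm 4 v"
      by (simp add: sobolev_embedding_const_def sobolev_norm_def real_sqrt_mult)
    finally show ?thesis using sum_mono[of F ?x, OF x] by linarith
  qed
  show s: "?x summable_on UNIV"
    by (rule nonneg_bdd_above_summable_on)
      (use fin in \<open>auto intro!: bdd_aboveI2[where M = "sobolev_embedding_const * sobolev_norm 4 v"]\<close>)
  show "infsum ?x UNIV \<le> sobolev_embedding_const * sobolev_norm 4 v"
    by (rule infsum_le_finite_sums[OF s fin])
  have "(\<lambda>n. norm (fourier_coeff v n)) summable_on UNIV"
    by (rule summable_on_comparison_test[OF s]) (auto simp: mult_le_cancel_left1 not_le)
  then show "trig_sum (\<lambda>n. n) (fourier_coeff v) v"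
    using v by (intro fourier_series_converges) (auto simp: sobolev_def)
qed

section \<open>The steady state equation as a fixed point problem\<close>

definition steady_symbol :: "real \<Rightarrow> int \<Rightarrow> complex" where
  "steady_symbol b n = Complex 1 (b * (of_int n - of_int n ^ 3))"

text \<open>At n = 1 and n = -1 the symbol is 1 and the weight 2, whence 1/2. For |n| \<ge> 2 the
  real part is 1 and the imaginary part at least (3 b / 4) |n|^3 in absolute value; the mean of
  these two lower bounds is 1/2 + (3 b / 8) |n|^3.\<close>

definition symbol_bound :: "real \<Rightarrow> real" where
  "symbol_bound b = min (1 / 2) (3 * b / 8)"

lemma symbol_bound_pos: "b > 0 \<Longrightarrow> symbol_bound b > 0"
  by (simp add: symbol_bound_def)

lemma steady_symbol_nonzero: "steady_symbol b n \<noteq> 0"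
  by (simp add: steady_symbol_def complex_eq_iff)

text \<open>n - n^3 vanishes at -1, 0 and 1, so L is the identity on constants, sine and cosine.
  This keeps b out of the linear term of the solution.\<close>

lemma steady_symbol_unit: "\<bar>n\<bar> \<le> 1 \<Longrightarrow> steady_symbol b n = 1"
proof -
  assume "\<bar>n\<bar> \<le> 1"
  then have "n = -1 \<or> n = 0 \<or> n = 1" by linarith
  then show ?thesis by (auto simp: steady_symbol_def complex_eq_iff)
qed

lemma steady_symbol_lower:
  assumes b: "b > 0"
  shows "symbol_bound b * (1 + \<bar>of_int n\<bar> ^ 3) \<le> norm (steady_symbol b n)"
proof (cases "\<bar>n\<bar> \<le> 1")
  case True
  then have "\<bar>of_int n :: real\<bar> ^ 3 \<le> 1" by (intro power_le_one) linarith+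
  then have "symbol_bound b * (1 + \<bar>of_int n\<bar> ^ 3) \<le> 1 / 2 * 2"
    by (intro mult_mono) (auto simp: symbol_bound_def)
  then show ?thesis using True by (simp add: steady_symbol_unit)
next
  case False
  define x where "x = \<bar>of_int n :: real\<bar>"
  have x: "x \<ge> 2" using False unfolding x_def by linarith
  have "2 * 2 * x \<le> x * x * x" using x by (intro mult_mono) auto
  then have x3: "x \<le> x ^ 3 / 4" by (simp add: power3_eq_cube)
  have "\<bar>of_int n - of_int n ^ 3 :: real\<bar> \<ge> \<bar>of_int n ^ 3\<bar> - \<bar>of_int n :: real\<bar>" by linarith
  then have d: "\<bar>of_int n - of_int n ^ 3 :: real\<bar> \<ge> 3 / 4 * x ^ 3"
    using x3 by (simp add: x_def power_abs)
  have "\<bar>Im (steady_symbol b n)\<bar> = b * \<bar>of_int n - of_int n ^ 3 :: real\<bar>"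
    using b by (simp add: steady_symbol_def abs_mult)
  also have "\<dots> \<ge> b * (3 / 4 * x ^ 3)"
    using d b by (intro mult_left_mono) auto
  finally have im: "b * (3 / 4 * x ^ 3) \<le> norm (steady_symbol b n)"
    using abs_Im_le_cmod order_trans by blast
  have re: "1 \<le> norm (steady_symbol b n)"
    using abs_Re_le_cmod[of "steady_symbol b n"] by (simp add: steady_symbol_def)
  have "symbol_bound b * 1 + symbol_bound b * x ^ 3 \<le> 1 / 2 * 1 + 3 * b / 8 * x ^ 3"
    using x by (intro add_mono mult_right_mono) (auto simp: symbol_bound_def)
  also have "\<dots> \<le> norm (steady_symbol b n)" using im re by linarith
  finally show ?thesis by (simp add: x_def distrib_left)
qed

lemma steady_symbol_upper:
  assumes b: "b > 0"
  shows "norm (steady_symbol b n) \<le> (1 + 2 * b) * (1 + \<bar>of_int n\<bar> ^ 3)"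
proof -
  define x where "x = \<bar>of_int n :: real\<bar>"
  have x0: "x \<ge> 0" by (simp add: x_def)
  have x3: "x \<le> 1 + x ^ 3"
  proof (cases "x \<le> 1")
    case True
    then show ?thesis using x0 zero_le_power[of x 3] by linarith
  next
    case False
    then show ?thesis using power_increasing[of 1 3 x] by simp
  qed
  have "\<bar>of_int n - of_int n ^ 3 :: real\<bar> \<le> x + x ^ 3"
    using abs_triangle_ineq4[of "of_int n :: real" "of_int n ^ 3"] by (simp add: x_def power_abs)
  then have le: "b * \<bar>of_int n - of_int n ^ 3 :: real\<bar> \<le> b * (2 * (1 + x ^ 3))"
    using x3 b by (intro mult_left_mono) auto
  have "norm (steady_symbol b n) \<le> 1 + b * \<bar>of_int n - of_int n ^ 3 :: real\<bar>"
    using cmod_le[of "steady_symbol b n"] b by (simp add: steady_symbol_def abs_mult)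
  also have "\<dots> \<le> 1 + b * (2 * (1 + x ^ 3))" using le by simp
  finally have "norm (steady_symbol b n) \<le> 1 + b * (2 * (1 + x ^ 3))" .
  also have "\<dots> \<le> (1 + 2 * b) * (1 + x ^ 3)"
    using zero_le_power[OF x0, of 3] by (simp add: algebra_simps)
  finally show ?thesis by (simp add: x_def)
qed

lemma norm_div_steady_symbol_le:
  assumes b: "b > 0" and z: "norm z \<le> C * (1 + \<bar>of_int n\<bar> ^ 3)" and C: "C \<ge> 0"
  shows "norm (z / steady_symbol b n) \<le> C / symbol_bound b"
proof -
  have "norm z * symbol_bound b \<le> C * (1 + \<bar>of_int n\<bar> ^ 3) * symbol_bound b"
    using z symbol_bound_pos[OF b] by (intro mult_right_mono) auto
  also have "\<dots> \<le> C * norm (steady_symbol b n)"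
    using mult_left_mono[OF steady_symbol_lower[OF b, of n] C] by (simp add: mult_ac)
  finally show ?thesis
    using symbol_bound_pos[OF b] steady_symbol_nonzero[of b n] by (simp add: norm_divide field_simps)
qed

lemma power_le_one_plus_cube:
  fixes x :: real
  assumes "x \<ge> 0" "k \<le> 3"
  shows "x ^ k \<le> 1 + x ^ 3"
proof (cases "x \<le> 1")
  case True
  then have "x ^ k \<le> 1" "0 \<le> x ^ 3" using assms by (auto simp: power_le_one)
  then show ?thesis by linarith
next
  case False
  then show ?thesis using power_increasing[OF assms(2), of x] by linarith
qed

text \<open>The k-th derivative composed with the inverse of L.\<close>

definition resolvent :: "nat \<Rightarrow> real \<Rightarrow> ('i \<Rightarrow> int) \<Rightarrow> 'i::weighted_monoid wiener \<Rightarrow> 'i wiener" where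
  "resolvent k b \<nu> = multiplier (\<lambda>i. (\<i> * of_int (\<nu> i)) ^ k / steady_symbol b (\<nu> i))"

lemma resolvent_symbol_le:
  assumes "b > 0" "k \<le> 3"
  shows "norm ((\<i> * of_int n) ^ k / steady_symbol b n) \<le> 1 / symbol_bound b"
  by (rule norm_div_steady_symbol_le)
    (use assms power_le_one_plus_cube[of "\<bar>of_int n\<bar>" k] in \<open>auto simp: norm_mult norm_power\<close>)

lemma
  assumes "b > 0" "k \<le> 3"
  shows coeff_resolvent: "coeff (resolvent k b \<nu> g) i = (\<i> * of_int (\<nu> i)) ^ k / steady_symbol b (\<nu> i) * coeff g i"
    and norm_resolvent_le: "norm (resolvent k b \<nu> g) \<le> 1 / symbol_bound b * norm g"
    and bounded_linear_resolvent: "bounded_linear (resolvent k b \<nu>)"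
  unfolding resolvent_def
  by (rule coeff_multiplier norm_multiplier_le bounded_linear_multiplier, rule resolvent_symbol_le[OF assms])+

definition flux_op :: "real \<Rightarrow> ('i \<Rightarrow> int) \<Rightarrow> 'i::weighted_monoid wiener \<Rightarrow> 'i wiener" where
  "flux_op b \<nu> g = resolvent 1 b \<nu> g + resolvent 3 b \<nu> g"

lemma bounded_linear_flux_op: "b > 0 \<Longrightarrow> bounded_linear (flux_op b \<nu>)"
  unfolding flux_op_def by (intro bounded_linear_add bounded_linear_resolvent) auto

text \<open>Twice the bound of a single resolvent, because \<open>flux_op\<close> is a sum of two;
  one constant then serves all three operators.\<close>

definition op_bound :: "real \<Rightarrow> real" where
  "op_bound b = 2 / symbol_bound b"

lemma norm_flux_op_le: "b > 0 \<Longrightarrow> norm (flux_op b \<nu> g) \<le> op_bound b * norm g"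
  using norm_triangle_ineq[of "resolvent 1 b \<nu> g" "resolvent 3 b \<nu> g"]
    norm_resolvent_le[of b 1 \<nu> g] norm_resolvent_le[of b 3 \<nu> g]
  by (simp add: flux_op_def op_bound_def)

lemma norm_resolvent_le_op_bound:
  assumes "b > 0" "k \<le> 3"
  shows "norm (resolvent k b \<nu> g) \<le> op_bound b * norm g"
proof -
  have "1 / symbol_bound b * norm g \<le> op_bound b * norm g"
    using symbol_bound_pos[OF assms(1)] by (intro mult_right_mono) (auto simp: op_bound_def divide_right_mono)
  with norm_resolvent_le[OF assms, of \<nu> g] show ?thesis by linarith
qed

lemma op_bound_nonneg: "b > 0 \<Longrightarrow> op_bound b \<ge> 0"
  using symbol_bound_pos[of b] by (simp add: op_bound_def)

text \<open>
  If \<open>g\<close> represents \<open>H - 1 + b (H' + H''')\<close>, then \<open>resolvent 0\<close>, \<open>resolvent 1\<close> and \<open>flux_op\<close> map it to \<open>H - 1\<close>,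
  \<open>H'\<close> and \<open>H' + H'''\<close>.
\<close>

abbreviation steady_op :: "real \<Rightarrow> ('i \<Rightarrow> int) \<Rightarrow> 'i::weighted_monoid wiener \<Rightarrow> 'i wiener \<Rightarrow> 'i wiener \<Rightarrow> 'i wiener" where
  "steady_op b \<nu> \<equiv> steady_map b (resolvent 0 b \<nu>) (resolvent 1 b \<nu>) (flux_op b \<nu>)"

abbreviation steady_radius :: "real \<Rightarrow> real" where
  "steady_radius b \<equiv> contraction_radius b (op_bound b)"

text \<open>The character is split into the frequency, which differentiation in \<theta> sees, and a
  factor \<open>w\<close> holding the values of the parameters. With \<open>w\<close> constantly 1
  on the integers this is ordinary Fourier series.\<close>

locale circle_weights =
  fixes \<nu> :: "'i::weighted_monoid \<Rightarrow> int" and w :: "'i \<Rightarrow> complex"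
  assumes \<nu>_add: "\<nu> (i + j) = \<nu> i + \<nu> j" and \<nu>_zero: "\<nu> 0 = 0"
    and w_add: "w (i + j) = w i * w j" and w_zero: "w 0 = 1" and w_le: "norm (w i) \<le> 1"
begin

definition ch :: "real \<Rightarrow> 'i \<Rightarrow> complex" where
  "ch \<theta> i = w i * cis (of_int (\<nu> i) * \<theta>)"

sublocale ch: wiener_character "ch \<theta>" for \<theta>
proof
  show "ch \<theta> (i + j) = ch \<theta> i * ch \<theta> j" for i j
    by (simp add: ch_def \<nu>_add w_add distrib_right flip: cis_mult)
  show "ch \<theta> 0 = 1" by (simp add: ch_def w_zero \<nu>_zero)
  show "norm (ch \<theta> i) \<le> wt i" for i
    using w_le[of i] wt_ge_1[of i] by (simp add: ch_def norm_mult)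
qed

definition rep :: "'i wiener \<Rightarrow> (real \<Rightarrow> real) \<Rightarrow> bool" where
  "rep f v \<longleftrightarrow> (\<forall>\<theta>. ev (ch \<theta>) f = complex_of_real (v \<theta>))"

lemma summable_coeff_w: "(\<lambda>i. norm (coeff f i * w i)) summable_on UNIV"
proof (rule summable_on_comparison_test[OF coeff_summable[of f]])
  show "norm (coeff f i * w i) \<le> norm (coeff f i) * wt i" for i
    using w_le[of i] wt_ge_1[of i] by (simp add: norm_mult mult_left_mono)
qed simp

lemma rep_iff_trig_sum: "rep f v \<longleftrightarrow> trig_sum \<nu> (\<lambda>i. coeff f i * w i) v"
proof -
  have "((\<lambda>i. coeff f i * w i * cis (of_int (\<nu> i) * \<theta>)) has_sum ev (ch \<theta>) f) UNIV" for \<theta>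
    using ch.ev_has_sum[where f = f] by (simp add: ch_def mult.assoc)
  then show ?thesis
    unfolding rep_def trig_sum_def by (metis has_sum_unique)
qed

text \<open>Membership of the differentiated coefficients in the algebra, as an element
  \<open>f'\<close>, supplies the summability that termwise differentiation asks for.\<close>

lemma rep_deriv:
  assumes "rep f v" and f': "\<And>i. coeff f' i = \<i> * of_int (\<nu> i) * coeff f i"
  shows "rep f' (deriv v)"
proof -
  have "(\<lambda>i. norm (coeff f i * w i) * \<bar>of_int (\<nu> i)\<bar>) summable_on UNIV"
    using summable_coeff_w[of f'] by (simp add: f' norm_mult mult_ac)
  from trig_sum_deriv[OF _ this] assms(1) show ?thesis
    unfolding rep_iff_trig_sum by (simp add: f' mult_ac)
qed

text \<open>Raising the first index of \<open>resolvent\<close> by one is a differentiation; the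
  summand 1 has frequency 0 and disappears.\<close>

lemma rep_resolvent_derivs:
  assumes b: "b > 0" and h: "rep (1 + resolvent 0 b \<nu> g) h"
  shows "rep (resolvent 1 b \<nu> g) (deriv h)"
    and "rep (flux_op b \<nu> g) (\<lambda>\<theta>. deriv h \<theta> + (deriv ^^ 3) h \<theta>)"
proof -
  show 1: "rep (resolvent 1 b \<nu> g) (deriv h)"
    by (rule rep_deriv[OF h]) (use \<nu>_zero in \<open>auto simp: coeff_simps coeff_resolvent[OF b]\<close>)
  have "rep (resolvent 2 b \<nu> g) (deriv (deriv h))"
    by (rule rep_deriv[OF 1]) (simp add: coeff_resolvent[OF b] power2_eq_square)
  then have "rep (resolvent 3 b \<nu> g) (deriv (deriv (deriv h)))"
    by (rule rep_deriv) (simp add: coeff_resolvent[OF b] power2_eq_square power3_eq_cube)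
  then show "rep (flux_op b \<nu> g) (\<lambda>\<theta>. deriv h \<theta> + (deriv ^^ 3) h \<theta>)"
    using 1 by (simp add: rep_def flux_op_def ch.ev_simps numeral_3_eq_3)
qed

lemma resolvent_recovers:
  assumes "b > 0"
  shows "g = resolvent 0 b \<nu> g + b *\<^sub>R flux_op b \<nu> g"
proof (rule wiener_eqI)
  fix i
  let ?n = "of_int (\<nu> i) :: complex"
  have s: "steady_symbol b (\<nu> i) = 1 + of_real b * (\<i> * ?n + (\<i> * ?n) ^ 3)"
    by (simp add: steady_symbol_def complex_eq_iff power3_eq_cube algebra_simps)
  have "coeff (resolvent 0 b \<nu> g + b *\<^sub>R flux_op b \<nu> g) i =
      (1 + of_real b * (\<i> * ?n + (\<i> * ?n) ^ 3)) / steady_symbol b (\<nu> i) * coeff g i"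
    unfolding flux_op_def plus_wiener.rep_eq scaleR_wiener.rep_eq scaleR_conv_of_real[where 'a = complex]
    by (simp add: coeff_resolvent[OF assms] add_divide_distrib distrib_right distrib_left mult.assoc)
  then show "coeff g i = coeff (resolvent 0 b \<nu> g + b *\<^sub>R flux_op b \<nu> g) i"
    by (simp add: s[symmetric] steady_symbol_nonzero)
qed

text \<open>Evaluation at each \<theta> is a homomorphism and takes the algebraic equation to the
  differential one. The equivalence speaks of evaluations, not of elements, because evaluating at
  one parameter value does not determine an element of the mode algebra; over the integers
  \<open>fourier_ev_inject\<close> restores equality.\<close>

lemma steady_state_iff:
  assumes b: "b > 0" and h: "rep (1 + resolvent 0 b \<nu> g) h"
    and e: "rep e1 (\<lambda>\<theta>. \<epsilon>$1 * cos \<theta> / 3)" "rep e2 (\<lambda>\<theta>. \<epsilon>$2 * sin \<theta>)"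
  shows "steady_state b \<epsilon> h \<longleftrightarrow> (\<forall>\<theta>. ev (ch \<theta>) (steady_op b \<nu> e1 e2 g) = ev (ch \<theta>) g)"
  unfolding steady_state_def
proof (intro all_cong1)
  fix \<theta>
  let ?h = "h \<theta>" and ?s = "deriv h \<theta>" and ?q = "deriv h \<theta> + (deriv ^^ 3) h \<theta>"
  let ?e1 = "\<epsilon>$1 * cos \<theta> / 3" and ?e2 = "\<epsilon>$2 * sin \<theta>"
  note r = rep_resolvent_derivs[OF b h] h e
  have h': "1 + ev (ch \<theta>) (resolvent 0 b \<nu> g) = of_real ?h"
    using h by (simp add: rep_def ch.ev_simps)
  have "ev (ch \<theta>) (steady_op b \<nu> e1 e2 g) =
     of_real (?e1 * ?h ^ 3 - b * ((?h ^ 3 - 1) * ?q) - ?e2 * (?h ^ 3 * ?s))"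
    unfolding steady_map_def ch.ev_simps h' scaleR_conv_of_real[where 'a = complex] r[unfolded rep_def, rule_format]
    by simp
  moreover have "ev (ch \<theta>) g = of_real (?h - 1 + b * ?q)"
  proof -
    have "ev (ch \<theta>) g = ev (ch \<theta>) (1 + resolvent 0 b \<nu> g) - 1 + b *\<^sub>R ev (ch \<theta>) (flux_op b \<nu> g)"
      by (subst resolvent_recovers[OF b, of g]) (simp add: ch.ev_simps)
    then show ?thesis using r by (simp add: rep_def scaleR_conv_of_real[where 'a = complex])
  qed
  ultimately have "ev (ch \<theta>) (steady_op b \<nu> e1 e2 g) = ev (ch \<theta>) g \<longleftrightarrow>
    ?e1 * ?h ^ 3 - b * ((?h ^ 3 - 1) * ?q) - ?e2 * (?h ^ 3 * ?s) = ?h - 1 + b * ?q"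
    by (simp only: of_real_eq_iff)
  also have "\<dots> \<longleftrightarrow> ?h - ?e1 * ?h ^ 3 + b * ?h ^ 3 * ?q + ?e2 * ?h ^ 3 * ?s = 1"
    by (auto simp: algebra_simps)
  finally show "(?h - ?e1 * ?h ^ 3 + b * ?h ^ 3 * ?q + \<epsilon>$2 * sin \<theta> * ?h ^ 3 * ?s = 1) \<longleftrightarrow>
     ev (ch \<theta>) (steady_op b \<nu> e1 e2 g) = ev (ch \<theta>) g" by (rule sym)
qed

end

section \<open>Uniqueness\<close>

lemma trig_sum_add:
  "trig_sum \<nu> c v \<Longrightarrow> trig_sum \<nu> d u \<Longrightarrow> trig_sum \<nu> (\<lambda>i. c i + d i) (\<lambda>\<theta>. v \<theta> + u \<theta>)"
  unfolding trig_sum_def by (auto simp: distrib_right intro: has_sum_add)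

lemma trig_sum_scale:
  "trig_sum \<nu> c v \<Longrightarrow> trig_sum \<nu> (\<lambda>i. of_real r * c i) (\<lambda>\<theta>. r * v \<theta>)"
  unfolding trig_sum_def by (auto simp: mult.assoc intro: has_sum_cmult_right)

lemma trig_sum_diff:
  "trig_sum \<nu> c v \<Longrightarrow> trig_sum \<nu> d u \<Longrightarrow> trig_sum \<nu> (\<lambda>i. c i - d i) (\<lambda>\<theta>. v \<theta> - u \<theta>)"
  using trig_sum_add[of \<nu> c v "\<lambda>i. of_real (-1) * d i" "\<lambda>\<theta>. (-1) * u \<theta>"] trig_sum_scale[of \<nu> d u "-1"]
  by simp

lemma trig_sum_zero: "trig_sum \<nu> (\<lambda>_. 0) (\<lambda>_. 0)"
  by (simp add: trig_sum_def)

lemma trig_sum_sum: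
  assumes "finite A" "\<And>p. p \<in> A \<Longrightarrow> trig_sum \<nu> (c p) (v p)"
  shows "trig_sum \<nu> (\<lambda>i. \<Sum>p\<in>A. c p i) (\<lambda>\<theta>. \<Sum>p\<in>A. v p \<theta>)"
  using assms by (induction A rule: finite_induct) (auto simp: trig_sum_zero intro: trig_sum_add)

lemma trig_sum_const: "\<nu> i0 = 0 \<Longrightarrow> trig_sum \<nu> (\<lambda>i. of_bool (i = i0)) (\<lambda>_. 1)"
  unfolding trig_sum_def by (intro allI has_sum_finite_neutralI[of "{i0}"]) auto

text \<open>\<open>i\<close> and \<open>j\<close> stand for indices of frequency 1 and -1, which may
  carry a parameter degree as well.\<close>

definition cosine_elt :: "'i::weighted_monoid \<Rightarrow> 'i \<Rightarrow> real \<Rightarrow> 'i wiener" where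
  "cosine_elt i j x = single i (of_real (x / 2)) + single j (of_real (x / 2))"

definition sine_elt :: "'i::weighted_monoid \<Rightarrow> 'i \<Rightarrow> real \<Rightarrow> 'i wiener" where
  "sine_elt i j x = single i (Complex 0 (- x / 2)) + single j (Complex 0 (x / 2))"

lemma norm_cosine_elt_le: "norm (cosine_elt i j x) \<le> \<bar>x\<bar> * (wt i + wt j) / 2"
  using norm_triangle_ineq[of "single i (of_real (x / 2))" "single j (of_real (x / 2))"]
  by (simp add: cosine_elt_def norm_single field_simps)

lemma cmod_Complex_0: "cmod (Complex 0 y) = \<bar>y\<bar>"
  by (simp add: cmod_def)

lemma norm_sine_elt_le: "norm (sine_elt i j x) \<le> \<bar>x\<bar> * (wt i + wt j) / 2"
  using norm_triangle_ineq[of "single i (Complex 0 (- x / 2))" "single j (Complex 0 (x / 2))"]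
  by (simp add: sine_elt_def norm_single cmod_Complex_0 field_simps)

context circle_weights
begin

lemma rep_trig_elts:
  assumes "\<nu> i = 1" "\<nu> j = -1" "w i = of_real r" "w j = of_real r"
  shows "rep (cosine_elt i j x) (\<lambda>\<theta>. r * x * cos \<theta>)"
    and "rep (sine_elt i j x) (\<lambda>\<theta>. r * x * sin \<theta>)"
  using assms
  by (auto simp: rep_def cosine_elt_def sine_elt_def ch.ev_simps ch.ev_single ch_def complex_eq_iff)

lemma rep_add: "rep f u \<Longrightarrow> rep g v \<Longrightarrow> rep (f + g) (\<lambda>\<theta>. u \<theta> + v \<theta>)"
  by (simp add: rep_def ch.ev_simps)

lemma steady_map_fixpoint_rep:
  assumes b: "b > 0" and g: "steady_op b \<nu> e1 e2 g = g" and h: "rep (1 + resolvent 0 b \<nu> g) h"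
    and e: "rep e1 (\<lambda>\<theta>. \<epsilon>$1 * cos \<theta> / 3)" "rep e2 (\<lambda>\<theta>. \<epsilon>$2 * sin \<theta>)"
  shows "steady_state b \<epsilon> h"
  using steady_state_iff[OF b h e] g by simp

end

instantiation int :: weighted_monoid
begin

definition wt_int :: "int \<Rightarrow> real" where "wt_int n = 1"

instance by standard (simp_all add: wt_int_def)

end

interpretation fourier: circle_weights "\<lambda>n::int. n" "\<lambda>_. 1"
  by unfold_locales auto

lemma fourier_ev_inject:
  fixes f g :: "int wiener"
  assumes "\<And>\<theta>. ev (fourier.ch \<theta>) f = ev (fourier.ch \<theta>) g"
  shows "f = g"
proof (rule wiener_eqI)
  fix m
  have s: "(\<lambda>n. norm (coeff f n)) summable_on UNIV" for f :: "int wiener"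
    using coeff_summable[of f] by (simp add: wt_int_def)
  have "((\<lambda>\<theta>. ev (fourier.ch \<theta>) f * cis (- (of_int m * \<theta>))) has_integral 2 * pi * coeff f m) {0..2 * pi}" for f
    using integral_trig_cis[OF s[of f]] by (simp add: ev_def fourier.ch_def)
  from has_integral_unique[OF this[of f, unfolded assms] this[of g]]
  show "coeff f m = coeff g m" by simp
qed

lemma sobolev_4_minus_one:
  assumes h: "h \<in> sobolev 4"
  shows "(\<lambda>\<theta>. h \<theta> - 1) \<in> sobolev 4"
proof -
  have t: "trig_sum (\<lambda>n. n) (\<lambda>n. fourier_coeff h n - of_bool (n = 0)) (\<lambda>\<theta>. h \<theta> - 1)"
    by (intro trig_sum_diff sobolev_4_fourier(3)[OF h] trig_sum_const) simp
  let ?y = "\<lambda>v n. (cmod (fourier_coeff v n))\<^sup>2 * (real_of_int n ^ (2 * 4) + 1)"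
  have "?y h summable_on UNIV" using h by (simp add: sobolev_def)
  moreover have "?y (\<lambda>\<theta>. h \<theta> - 1) n = ?y h n" if "n \<noteq> 0" for n
    using that by (simp add: trig_sum_fourier_coeff[OF t])
  ultimately have "?y (\<lambda>\<theta>. h \<theta> - 1) summable_on UNIV"
    using summable_on_cong[of "UNIV - {0}" "?y (\<lambda>\<theta>. h \<theta> - 1)" "?y h"]
      summable_on_insert_iff[of "?y (\<lambda>\<theta>. h \<theta> - 1)" 0 "UNIV - {0}"]
      summable_on_subset[of "?y h" UNIV "UNIV - {0}"] by (simp add: insert_absorb)
  then show ?thesis
    using trig_sum_continuous[OF t] trig_sum_periodic[OF t] by (simp add: sobolev_def)
qed

text \<open>\<open>g\<close> is L (h - 1), formed on coefficients;
  \<open>steady_symbol_upper\<close> matches the weight 1 + |n|^3 with which the coefficients of h -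
  1 are summable.\<close>

lemma sobolev_4_wiener:
  assumes b: "b > 0" and h: "h \<in> sobolev 4"
  obtains g :: "int wiener"
  where "fourier.rep (1 + resolvent 0 b (\<lambda>n. n) g) h"
    and "norm g \<le> (1 + 2 * b) * (sobolev_embedding_const * sobolev_norm 4 (\<lambda>\<theta>. h \<theta> - 1))"
proof -
  let ?v = "\<lambda>\<theta>. h \<theta> - 1"
  note F = sobolev_4_fourier[OF sobolev_4_minus_one[OF h]]
  let ?c = "\<lambda>n. steady_symbol b n * fourier_coeff ?v n"
  have le: "norm (?c n) * wt n \<le> (1 + 2 * b) * (norm (fourier_coeff ?v n) * (1 + \<bar>of_int n\<bar> ^ 3))" for n
    using mult_right_mono[OF steady_symbol_upper[OF b, of n], of "norm (fourier_coeff ?v n)"]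
    by (simp add: norm_mult wt_int_def mult_ac)
  note s = summable_on_cmult_right[OF F(1), of "1 + 2 * b"]
  have sc: "(\<lambda>n. norm (?c n) * wt n) summable_on UNIV"
    by (rule summable_on_comparison_test[OF s le]) simp
  define g where "g = Wiener ?c"
  have cg: "coeff g = ?c" using sc by (simp add: g_def Wiener_inverse)
  show ?thesis
  proof
    have "norm g \<le> (\<Sum>\<^sub>\<infinity>n. (1 + 2 * b) * (norm (fourier_coeff ?v n) * (1 + \<bar>of_int n\<bar> ^ 3)))"
      unfolding norm_wiener_def cg by (rule infsum_mono[OF sc s le])
    also have "\<dots> \<le> (1 + 2 * b) * (sobolev_embedding_const * sobolev_norm 4 ?v)"
      unfolding infsum_cmult_right' using F(2) b by (intro mult_left_mono) auto
    finally show "norm g \<le> (1 + 2 * b) * (sobolev_embedding_const * sobolev_norm 4 ?v)" .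
    have "trig_sum (\<lambda>n. n) (\<lambda>n. of_bool (n = 0) + fourier_coeff ?v n) (\<lambda>\<theta>. 1 + ?v \<theta>)"
      by (intro trig_sum_add F(3) trig_sum_const) simp
    then show "fourier.rep (1 + resolvent 0 b (\<lambda>n. n) g) h"
      by (simp add: fourier.rep_iff_trig_sum coeff_simps coeff_resolvent[OF b] cg steady_symbol_nonzero)
  qed
qed

lemma sobolev_embedding_const_nonneg: "sobolev_embedding_const \<ge> 0"
  unfolding sobolev_embedding_const_def by (intro real_sqrt_ge_zero infsum_nonneg) simp

text \<open>Every perturbation of 1 of this Sobolev size corresponds to a \<open>g\<close> within
  the contraction radius: 1 + 2 b bounds the symbol, the other factor the embedding. The added 1
  makes the denominator positive at once.\<close>

definition uniqueness_radius :: "real \<Rightarrow> real" where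
  "uniqueness_radius b = steady_radius b / ((1 + 2 * b) * (sobolev_embedding_const + 1))"

lemma steady_radius_pos: "b > 0 \<Longrightarrow> steady_radius b > 0"
  by (intro contraction_radius_pos op_bound_nonneg) auto

lemma uniqueness_radius_pos: "b > 0 \<Longrightarrow> uniqueness_radius b > 0"
  unfolding uniqueness_radius_def using sobolev_embedding_const_nonneg steady_radius_pos[of b]
  by (intro divide_pos_pos mult_pos_pos) auto

lemma solution_near_one_unique:
  assumes b: "b > 0" and \<epsilon>: "\<bar>\<epsilon>$1\<bar> \<le> steady_radius b" "\<bar>\<epsilon>$2\<bar> \<le> steady_radius b"
    and h: "solution_near_one b (uniqueness_radius b) \<epsilon> h" and k: "solution_near_one b (uniqueness_radius b) \<epsilon> k"
  shows "h = k"
proof -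
  define e1 :: "int wiener" where "e1 = cosine_elt 1 (-1) (\<epsilon>$1 / 3)"
  define e2 :: "int wiener" where "e2 = sine_elt 1 (-1) (\<epsilon>$2)"
  have e: "fourier.rep e1 (\<lambda>\<theta>. \<epsilon>$1 * cos \<theta> / 3)" "fourier.rep e2 (\<lambda>\<theta>. \<epsilon>$2 * sin \<theta>)"
    using fourier.rep_trig_elts(1)[of 1 "-1" 1 "\<epsilon>$1 / 3"] fourier.rep_trig_elts(2)[of 1 "-1" 1 "\<epsilon>$2"]
    by (simp_all add: e1_def e2_def)
  have ne: "norm e1 \<le> steady_radius b" "norm e2 \<le> steady_radius b"
    using norm_cosine_elt_le[of "1::int" "-1" "\<epsilon>$1 / 3"] norm_sine_elt_le[of "1::int" "-1" "\<epsilon>$2"] \<epsilon>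
    by (simp_all add: e1_def e2_def wt_int_def)
  have ex: "\<exists>g. fourier.rep (1 + resolvent 0 b (\<lambda>n. n) g) h \<and> norm g \<le> steady_radius b \<and>
      steady_op b (\<lambda>n. n) e1 e2 g = g" if h: "solution_near_one b (uniqueness_radius b) \<epsilon> h" for h
  proof -
    have hs: "h \<in> sobolev 4" "steady_state b \<epsilon> h" "sobolev_norm 4 (\<lambda>\<theta>. h \<theta> - 1) \<le> uniqueness_radius b"
      using h by (simp_all add: solution_near_one_def)
    obtain g where g: "fourier.rep (1 + resolvent 0 b (\<lambda>n. n) g) h"
        "norm g \<le> (1 + 2 * b) * (sobolev_embedding_const * sobolev_norm 4 (\<lambda>\<theta>. h \<theta> - 1))"
      by (rule sobolev_4_wiener[OF b hs(1)])
    have "norm g \<le> (1 + 2 * b) * ((sobolev_embedding_const + 1) * uniqueness_radius b)"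
      using sobolev_embedding_const_nonneg b hs(3) uniqueness_radius_pos[OF b]
      by (intro order_trans[OF g(2)] mult_left_mono order_trans[OF mult_left_mono[OF hs(3)]] mult_right_mono) auto
    also have "\<dots> = steady_radius b"
      using sobolev_embedding_const_nonneg b by (simp add: uniqueness_radius_def)
    finally have "norm g \<le> steady_radius b" .
    moreover have "steady_op b (\<lambda>n. n) e1 e2 g = g"
      using fourier.steady_state_iff[OF b g(1) e] hs(2) by (intro fourier_ev_inject) simp
    ultimately show ?thesis using g(1) by blast
  qed
  obtain g where g: "fourier.rep (1 + resolvent 0 b (\<lambda>n. n) g) h" "norm g \<le> steady_radius b"
    "steady_op b (\<lambda>n. n) e1 e2 g = g" using ex[OF h] by blast
  obtain g' where g': "fourier.rep (1 + resolvent 0 b (\<lambda>n. n) g') k" "norm g' \<le> steady_radius b"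
    "steady_op b (\<lambda>n. n) e1 e2 g' = g'" using ex[OF k] by blast
  have "g = g'"
    by (rule steady_map_fixpoint_unique[OF _ op_bound_nonneg _ _ _ _ _ _ ne g(2) g'(2) g(3) g'(3)])
      (use b in \<open>auto intro: bounded_linear_resolvent bounded_linear_flux_op norm_flux_op_le norm_resolvent_le_op_bound\<close>)
  then show ?thesis using g(1) g'(1) by (auto simp: fourier.rep_def)
qed

section \<open>Existence and analyticity\<close>

text \<open>
  \<open>Mode n j l\<close> stands for the monomial \<open>e\<^sup>i\<^sup>n\<^sup>\<theta> s\<^sup>j t\<^sup>l\<close>, where \<open>s\<close> and \<open>t\<close> are the increments of the two
  parameters divided by the radius \<open>\<delta>\<close>, so that \<open>\<bar>s\<bar>, \<bar>t\<bar> \<le> 1\<close> and no weight in \<open>j\<close>, \<open>l\<close> is needed.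
\<close>

datatype mode = Mode (freq: int) (deg1: nat) (deg2: nat)

instantiation mode :: weighted_monoid
begin

definition zero_mode :: mode where "0 = Mode 0 0 0"

definition plus_mode :: "mode \<Rightarrow> mode \<Rightarrow> mode" where
  "m + m' = Mode (freq m + freq m') (deg1 m + deg1 m') (deg2 m + deg2 m')"

definition wt_mode :: "mode \<Rightarrow> real" where "wt m = 1 + \<bar>of_int (freq m)\<bar>"

instance
proof
  fix x y z :: mode
  show "x + y + z = x + (y + z)" "x + y = y + x" "0 + x = x"
    by (simp_all add: plus_mode_def zero_mode_def)
  show "1 \<le> wt x" "wt (0 :: mode) = 1" by (simp_all add: wt_mode_def zero_mode_def)
  have "\<bar>of_int (freq x) + of_int (freq y) :: real\<bar> \<le> \<bar>of_int (freq x)\<bar> + \<bar>of_int (freq y)\<bar>"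
    by (rule abs_triangle_ineq)
  moreover have "0 \<le> \<bar>of_int (freq x) :: real\<bar> * \<bar>of_int (freq y)\<bar>" by simp
  ultimately show "wt (x + y) \<le> wt x * wt y"
    unfolding wt_mode_def plus_mode_def mode.sel of_int_add by (simp only: distrib_left distrib_right)
qed

end

lemma mode_sel_simps [simp]:
  "freq (m + m') = freq m + freq m'" "deg1 (m + m') = deg1 m + deg1 m'" "deg2 (m + m') = deg2 m + deg2 m'"
  "freq 0 = 0" "deg1 0 = 0" "deg2 0 = 0"
  by (simp_all add: plus_mode_def zero_mode_def)

definition total_deg :: "mode \<Rightarrow> nat" where "total_deg m = deg1 m + deg2 m"

lemma total_deg_add: "total_deg (m + m') = total_deg m + total_deg m'"
  by (simp add: total_deg_def)

definition param_weight :: "real \<Rightarrow> real \<Rightarrow> mode \<Rightarrow> complex" where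
  "param_weight s t m = of_real (s ^ deg1 m * t ^ deg2 m)"

lemma norm_param_weight: "norm (param_weight s t m) = \<bar>s\<bar> ^ deg1 m * \<bar>t\<bar> ^ deg2 m"
  by (simp add: param_weight_def norm_mult norm_power)

lemma norm_param_weight_le:
  "\<bar>s\<bar> \<le> 1 \<Longrightarrow> \<bar>t\<bar> \<le> 1 \<Longrightarrow> norm (param_weight s t m) \<le> 1"
  by (simp add: norm_param_weight mult_le_one power_le_one)

lemma circle_weights_mode:
  assumes "\<bar>s\<bar> \<le> 1" "\<bar>t\<bar> \<le> 1"
  shows "circle_weights freq (param_weight s t)"
proof
  show "param_weight s t (i + j) = param_weight s t i * param_weight s t j" for i j
    by (simp add: param_weight_def power_add)
qed (use assms in \<open>auto simp: norm_param_weight_le\<close>, simp add: param_weight_def)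

section \<open>Real elements and the filtration by degree\<close>

definition flip :: "mode \<Rightarrow> mode" where "flip m = Mode (- freq m) (deg1 m) (deg2 m)"

lemma flip_simps [simp]: "flip (flip m) = m" "flip (m + m') = flip m + flip m'" "flip 0 = 0"
  "freq (flip m) = - freq m" "deg1 (flip m) = deg1 m" "deg2 (flip m) = deg2 m"
  by (simp_all add: flip_def plus_mode_def zero_mode_def)

lemma flip_eq_iff: "flip m = m' \<longleftrightarrow> m = flip m'"
  by (metis flip_simps(1))

text \<open>The parameters are real, so conjugation reverses the frequency and fixes the degrees.
  The condition makes evaluations real at all parameter values simultaneously.\<close>

definition real_elts :: "mode wiener set" where
  "real_elts = {f. \<forall>m. coeff f (flip m) = cnj (coeff f m)}"

text \<open>The ideal of power series vanishing to order \<open>d\<close> at the centre.\<close>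

definition deg_ge :: "nat \<Rightarrow> mode wiener set" where
  "deg_ge d = {f. \<forall>m. total_deg m < d \<longrightarrow> coeff f m = 0}"

lemma closed_real_elts: "closed real_elts"
  unfolding real_elts_def
  by (intro closed_Collect_all closed_Collect_eq continuous_intros bounded_linear.continuous_on[OF bounded_linear_coeff])

lemma closed_deg_ge: "closed (deg_ge d)"
  unfolding deg_ge_def
  by (intro closed_Collect_all closed_Collect_imp closed_Collect_eq open_Collect_const continuous_intros
      bounded_linear.continuous_on[OF bounded_linear_coeff])

lemma real_elts_arith:
  "f \<in> real_elts \<Longrightarrow> g \<in> real_elts \<Longrightarrow> f + g \<in> real_elts"
  "f \<in> real_elts \<Longrightarrow> g \<in> real_elts \<Longrightarrow> f - g \<in> real_elts"
  "f \<in> real_elts \<Longrightarrow> c *\<^sub>R f \<in> real_elts"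
  "0 \<in> real_elts" "1 \<in> real_elts"
  by (auto simp: real_elts_def coeff_simps flip_eq_iff)

lemma real_elts_mult:
  assumes "f \<in> real_elts" "g \<in> real_elts"
  shows "f * g \<in> real_elts"
  unfolding real_elts_def
proof (intro CollectI allI)
  fix k
  have "coeff (f * g) (flip k) = (\<Sum>\<^sub>\<infinity>p\<in>{p. fst p + snd p = k}. cnj (coeff f (fst p) * coeff g (snd p)))"
    unfolding times_wiener.rep_eq conv_def
    by (rule infsum_reindex_bij_witness[where i = "map_prod flip flip" and j = "map_prod flip flip"])
      (use assms in \<open>auto simp: real_elts_def prod_eq_iff simp flip: flip_simps(2)\<close>)
  then show "coeff (f * g) (flip k) = cnj (coeff (f * g) k)"
    unfolding times_wiener.rep_eq conv_def by (simp only: infsum_cnj)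
qed

lemma real_elts_power: "f \<in> real_elts \<Longrightarrow> f ^ n \<in> real_elts"
  by (induction n) (auto intro: real_elts_arith real_elts_mult)

lemma cnj_steady_symbol: "steady_symbol b (- n) = cnj (steady_symbol b n)"
  by (simp add: steady_symbol_def complex_eq_iff algebra_simps)

lemma real_elts_resolvent:
  assumes "b > 0" "k \<le> 3" "f \<in> real_elts"
  shows "resolvent k b freq f \<in> real_elts"
  using assms(3) by (simp add: real_elts_def coeff_resolvent[OF assms(1,2)] cnj_steady_symbol)

lemma deg_ge_arith:
  "f \<in> deg_ge d \<Longrightarrow> g \<in> deg_ge d \<Longrightarrow> f + g \<in> deg_ge d"
  "f \<in> deg_ge d \<Longrightarrow> g \<in> deg_ge d \<Longrightarrow> f - g \<in> deg_ge d"
  "f \<in> deg_ge d \<Longrightarrow> c *\<^sub>R f \<in> deg_ge d"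
  "0 \<in> deg_ge d" "f \<in> deg_ge 0"
  by (auto simp: deg_ge_def coeff_simps)

lemma deg_ge_mono: "f \<in> deg_ge d \<Longrightarrow> d' \<le> d \<Longrightarrow> f \<in> deg_ge d'"
  by (auto simp: deg_ge_def)

lemma deg_ge_mult:
  assumes "f \<in> deg_ge d" "g \<in> deg_ge d'"
  shows "f * g \<in> deg_ge (d + d')"
  unfolding deg_ge_def
proof (intro CollectI allI impI)
  fix m assume m: "total_deg m < d + d'"
  show "coeff (f * g) m = 0"
    unfolding times_wiener.rep_eq conv_def
  proof (rule infsum_0)
    fix p assume "p \<in> {p. fst p + snd p = m}"
    then have "total_deg (fst p) + total_deg (snd p) < d + d'"
      using m total_deg_add[of "fst p" "snd p"] by simp
    then have "total_deg (fst p) < d \<or> total_deg (snd p) < d'" by linarith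
    then show "coeff f (fst p) * coeff g (snd p) = 0"
      using assms by (auto simp: deg_ge_def)
  qed
qed

lemma deg_ge_resolvent:
  assumes "b > 0" "k \<le> 3" "f \<in> deg_ge d"
  shows "resolvent k b freq f \<in> deg_ge d"
  using assms(3) by (simp add: deg_ge_def coeff_resolvent[OF assms(1,2)])

lemma real_elts_steady_op:
  assumes "b > 0" "e1 \<in> real_elts" "e2 \<in> real_elts" "g \<in> real_elts"
  shows "steady_op b freq e1 e2 g \<in> real_elts"
  unfolding steady_map_def flux_op_def
  by (intro real_elts_arith real_elts_mult real_elts_power real_elts_resolvent assms) auto

text \<open>Apart from \<open>e1\<close> itself every term is a product of two factors of degree at
  least 1, so the fixed point agrees with \<open>e1\<close> to first order. In particular
  \<open>e2\<close>, which multiplies the derivative, enters at second order.\<close>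

lemma deg_ge_steady_op:
  assumes b: "b > 0" and e: "e1 \<in> deg_ge 1" "e2 \<in> deg_ge 1" and g: "g \<in> deg_ge 1"
  shows "steady_op b freq e1 e2 g - e1 \<in> deg_ge 2"
proof -
  let ?p = "resolvent 0 b freq g" and ?s = "resolvent 1 b freq g" and ?q = "flux_op b freq g"
  have K: "?p \<in> deg_ge 1" "?s \<in> deg_ge 1" "?q \<in> deg_ge 1"
    using g b by (auto simp: flux_op_def intro!: deg_ge_arith deg_ge_resolvent)
  have mult: "x * y \<in> deg_ge 2" if "x \<in> deg_ge 1" "y \<in> deg_ge 1" for x y
    using deg_ge_mult[OF that] by (simp add: numeral_2_eq_2)
  have ideal: "x * y \<in> deg_ge 1" if "x \<in> deg_ge 1" for x y
    using deg_ge_mult[OF that deg_ge_arith(5)] by simp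
  have ideal': "y * x \<in> deg_ge 1" if "x \<in> deg_ge 1" for x y
    using deg_ge_mult[OF deg_ge_arith(5) that] by simp
  have "(1 + ?p) ^ 3 - 1 = ?p * (3 + 3 * ?p + ?p * ?p)"
    by (simp add: algebra_simps power3_eq_cube)
  then have c: "(1 + ?p) ^ 3 - 1 \<in> deg_ge 1" using ideal[OF K(1)] by simp
  have "steady_op b freq e1 e2 g - e1 =
      e1 * ((1 + ?p) ^ 3 - 1) - b *\<^sub>R (((1 + ?p) ^ 3 - 1) * ?q) - e2 * ((1 + ?p) ^ 3 * ?s)"
    by (simp add: steady_map_def right_diff_distrib)
  then show ?thesis using mult e c K ideal' by (auto intro!: deg_ge_arith)
qed

text \<open>
  The elements representing \<open>\<epsilon>\<^sub>1 cos \<theta> / 3\<close> and \<open>\<epsilon>\<^sub>2 sin \<theta>\<close> for \<open>\<epsilon> = (x + \<delta> s, y + \<delta> t)\<close>.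
\<close>

definition mode_e1 :: "real \<Rightarrow> real \<Rightarrow> mode wiener" where
  "mode_e1 x \<delta> = cosine_elt (Mode 1 0 0) (Mode (-1) 0 0) (x / 3) + cosine_elt (Mode 1 1 0) (Mode (-1) 1 0) (\<delta> / 3)"

definition mode_e2 :: "real \<Rightarrow> real \<Rightarrow> mode wiener" where
  "mode_e2 y \<delta> = sine_elt (Mode 1 0 0) (Mode (-1) 0 0) y + sine_elt (Mode 1 0 1) (Mode (-1) 0 1) \<delta>"

lemma norm_mode_e1_le: "norm (mode_e1 x \<delta>) \<le> 2 * (\<bar>x\<bar> + \<bar>\<delta>\<bar>) / 3"
  unfolding mode_e1_def
  by (rule order_trans[OF norm_triangle_ineq], rule order_trans[OF add_mono[OF norm_cosine_elt_le norm_cosine_elt_le]])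
    (simp add: wt_mode_def)

lemma norm_mode_e2_le: "norm (mode_e2 y \<delta>) \<le> 2 * (\<bar>y\<bar> + \<bar>\<delta>\<bar>)"
  unfolding mode_e2_def
  by (rule order_trans[OF norm_triangle_ineq], rule order_trans[OF add_mono[OF norm_sine_elt_le norm_sine_elt_le]])
    (simp add: wt_mode_def)

lemma mode_e_real: "mode_e1 x \<delta> \<in> real_elts" "mode_e2 y \<delta> \<in> real_elts"
proof -
  have "flip m = Mode n j l \<longleftrightarrow> m = Mode (- n) j l" for m n j l
    by (cases m) (auto simp: flip_def)
  then show "mode_e1 x \<delta> \<in> real_elts" "mode_e2 y \<delta> \<in> real_elts"
    by (auto simp: real_elts_def mode_e1_def mode_e2_def cosine_elt_def sine_elt_def coeff_simps single.rep_eq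
        complex_eq_iff)
qed

lemma mode_e_deg: "mode_e1 0 \<delta> \<in> deg_ge 1" "mode_e2 0 \<delta> \<in> deg_ge 1"
  by (auto simp: deg_ge_def mode_e1_def mode_e2_def cosine_elt_def sine_elt_def coeff_simps single.rep_eq
      total_deg_def complex_eq_iff)

lemma rep_mode_e:
  assumes st: "\<bar>s\<bar> \<le> 1" "\<bar>t\<bar> \<le> 1"
  shows "circle_weights.rep freq (param_weight s t) (mode_e1 x \<delta>) (\<lambda>\<theta>. (x + \<delta> * s) * cos \<theta> / 3)"
    and "circle_weights.rep freq (param_weight s t) (mode_e2 y \<delta>) (\<lambda>\<theta>. (y + \<delta> * t) * sin \<theta>)"
proof -
  interpret circle_weights freq "param_weight s t" by (rule circle_weights_mode[OF st])
  have 1: "rep (mode_e1 x \<delta>) (\<lambda>\<theta>. 1 * (x / 3) * cos \<theta> + s * (\<delta> / 3) * cos \<theta>)"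
    unfolding mode_e1_def by (intro rep_add rep_trig_elts) (auto simp: param_weight_def)
  have 2: "rep (mode_e2 y \<delta>) (\<lambda>\<theta>. 1 * y * sin \<theta> + t * \<delta> * sin \<theta>)"
    unfolding mode_e2_def by (intro rep_add rep_trig_elts) (auto simp: param_weight_def)
  show "rep (mode_e1 x \<delta>) (\<lambda>\<theta>. (x + \<delta> * s) * cos \<theta> / 3)"
    using 1 by (rule back_subst[where P = "rep _"]) (auto simp: field_simps)
  show "rep (mode_e2 y \<delta>) (\<lambda>\<theta>. (y + \<delta> * t) * sin \<theta>)"
    using 2 by (rule back_subst[where P = "rep _"]) (auto simp: field_simps)
qed

text \<open>Modes of frequency 1 and -1 have weight 2, so the bound \<open>\<rho> / 4\<close> on
  centre and increment gives \<open>\<rho> / 3\<close> for the first forcing element and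
  \<open>\<rho>\<close> for the second, within the limits of
  \<open>steady_map_fixpoint_exists\<close>.\<close>

lemma mode_fixpoint:
  assumes b: "b > 0" and \<rho>: "\<rho> \<le> steady_radius b" and \<delta>: "\<bar>\<delta>\<bar> \<le> \<rho> / 4" "\<bar>x\<bar> \<le> \<rho> / 4" "\<bar>y\<bar> \<le> \<rho> / 4"
  shows "\<exists>g\<in>real_elts. norm g \<le> \<rho> \<and> steady_op b freq (mode_e1 x \<delta>) (mode_e2 y \<delta>) g = g \<and>
    (x = 0 \<and> y = 0 \<longrightarrow> g - mode_e1 x \<delta> \<in> deg_ge 2)"
proof -
  \<comment> \<open>Vanishing at the centre is imposed only for the centre 0; elsewhere the forcing
    has terms of degree 0.\<close>
  let ?S = "real_elts \<inter> (if x = 0 \<and> y = 0 then deg_ge 1 else UNIV)"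
  have \<rho>0: "\<rho> \<ge> 0" using \<delta>(1) by linarith
  have n1: "norm (mode_e1 x \<delta>) \<le> \<rho> / 2"
    by (rule order_trans[OF norm_mode_e1_le]) (use \<delta> \<rho>0 in simp)
  have n2: "norm (mode_e2 y \<delta>) \<le> \<rho>"
    by (rule order_trans[OF norm_mode_e2_le]) (use \<delta> in simp)
  have inv: "steady_op b freq (mode_e1 x \<delta>) (mode_e2 y \<delta>) g \<in> ?S" if g: "g \<in> ?S" for g
  proof -
    have "steady_op b freq (mode_e1 x \<delta>) (mode_e2 y \<delta>) g \<in> deg_ge 1" if "x = 0" "y = 0" "g \<in> deg_ge 1"
    proof -
      have "steady_op b freq (mode_e1 0 \<delta>) (mode_e2 0 \<delta>) g - mode_e1 0 \<delta> \<in> deg_ge 1"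
        using deg_ge_mono[OF deg_ge_steady_op[OF b mode_e_deg that(3)]] by simp
      from deg_ge_arith(1)[OF this mode_e_deg(1)[of \<delta>]] show ?thesis by (simp add: that)
    qed
    then show ?thesis using g real_elts_steady_op[OF b mode_e_real] by auto
  qed
  have "\<exists>g\<in>?S. norm g \<le> \<rho> \<and> steady_op b freq (mode_e1 x \<delta>) (mode_e2 y \<delta>) g = g"
  proof (rule steady_map_fixpoint_exists[OF _ op_bound_nonneg[OF b] _ _ _ _ _ _ \<rho> n1 n2 _ _ inv])
    show "closed ?S" using closed_real_elts closed_deg_ge by auto
    show "0 \<in> ?S" using real_elts_arith(4) deg_ge_arith(4) by auto
  qed (use b in \<open>auto intro: bounded_linear_resolvent bounded_linear_flux_op norm_flux_op_le norm_resolvent_le_op_bound\<close>)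
  then obtain g where g: "g \<in> ?S" "norm g \<le> \<rho>" "steady_op b freq (mode_e1 x \<delta>) (mode_e2 y \<delta>) g = g"
    by blast
  have "g - mode_e1 x \<delta> \<in> deg_ge 2" if "x = 0 \<and> y = 0"
    using deg_ge_steady_op[OF b mode_e_deg, of g \<delta> \<delta>] g that by simp
  then show ?thesis using g by blast
qed

section \<open>Series over modes as Sobolev-valued power series\<close>

definition synth :: "(mode \<Rightarrow> complex) \<Rightarrow> real \<Rightarrow> real" where
  "synth V \<theta> = Re (\<Sum>\<^sub>\<infinity>m. V m * cis (of_int (freq m) * \<theta>))"

text \<open>Reindexing by \<open>flip\<close> shows the sum equal to its conjugate, so the real part
  in \<open>synth\<close> loses nothing.\<close>

lemma trig_sum_synth:
  assumes sym: "\<And>m. V (flip m) = cnj (V m)" and s: "(\<lambda>m. norm (V m)) summable_on UNIV"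
  shows "trig_sum freq V (synth V)"
  unfolding trig_sum_def
proof
  fix \<theta>
  let ?S = "\<Sum>\<^sub>\<infinity>m. V m * cis (of_int (freq m) * \<theta>)"
  have "cnj ?S = (\<Sum>\<^sub>\<infinity>m. cnj (V m * cis (of_int (freq m) * \<theta>)))" by (rule infsum_cnj[symmetric])
  also have "\<dots> = ?S"
    by (rule infsum_reindex_bij_witness[where i = flip and j = flip]) (simp_all add: sym cis_cnj)
  finally have "of_real (Re ?S) = ?S" by (simp add: complex_eq_iff)
  then show "((\<lambda>m. V m * cis (of_int (freq m) * \<theta>)) has_sum complex_of_real (synth V \<theta>)) UNIV"
    using has_sum_trig[OF s] by (simp add: synth_def)
qed

lemma trig_sum_unique: "trig_sum \<nu> c v \<Longrightarrow> trig_sum \<nu> c u \<Longrightarrow> v = u"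
  unfolding trig_sum_def fun_eq_iff by (metis has_sum_unique of_real_eq_iff)

text \<open>One device for three purposes: \<open>r\<close> inserts parameter values as s^j t^l,
  extracts a Taylor coefficient as the indicator of one bidegree, and cuts out a remainder as the
  indicator of a complement.\<close>

definition deg_mult :: "(nat \<Rightarrow> nat \<Rightarrow> real) \<Rightarrow> (mode \<Rightarrow> complex) \<Rightarrow> mode \<Rightarrow> complex" where
  "deg_mult r W m = of_real (r (deg1 m) (deg2 m)) * W m"

text \<open>The Taylor coefficient in the increments themselves; dividing by
  \<open>\<delta> ^ (j + l)\<close> undoes their scaling.\<close>

definition mode_term :: "real \<Rightarrow> (mode \<Rightarrow> complex) \<Rightarrow> nat \<Rightarrow> nat \<Rightarrow> real \<Rightarrow> real" where
  "mode_term \<delta> W j l = synth (deg_mult (\<lambda>j' l'. of_bool (j' = j \<and> l' = l) / \<delta> ^ (j + l)) W)"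

lemma sobolev_norm_nonneg: "sobolev_norm k v \<ge> 0"
  by (simp add: sobolev_norm_def infsum_nonneg)

locale real_modes =
  fixes W :: "mode \<Rightarrow> complex"
  assumes sym: "W (flip m) = cnj (W m)"
    and sum_W: "(\<lambda>m. norm (W m) * (of_int (freq m) ^ 4 + 1)) summable_on UNIV"
begin

abbreviation X :: "mode \<Rightarrow> real" where "X m \<equiv> norm (W m) * (of_int (freq m) ^ 4 + 1)"

lemma deg_mult_summable:
  assumes "\<And>j l. \<bar>r j l\<bar> \<le> C"
  shows "(\<lambda>m. \<bar>r (deg1 m) (deg2 m)\<bar> * X m) summable_on UNIV"
  by (rule summable_on_comparison_test[OF summable_on_cmult_right[OF sum_W, of C]])
    (use assms in \<open>auto intro!: mult_right_mono\<close>)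

lemma trig_sum_deg_mult:
  assumes "\<And>j l. \<bar>r j l\<bar> \<le> C"
  shows "trig_sum freq (deg_mult r W) (synth (deg_mult r W))"
proof (rule trig_sum_synth)
  show "(\<lambda>m. norm (deg_mult r W m)) summable_on UNIV"
    by (rule summable_on_comparison_test[OF deg_mult_summable[OF assms]])
      (auto simp: deg_mult_def norm_mult intro!: mult_left_mono simp: mult_le_cancel_left1)
qed (simp add: deg_mult_def sym)

lemma deg_mult_sobolev:
  assumes r: "\<And>j l. \<bar>r j l\<bar> \<le> C" and v: "trig_sum freq (deg_mult r W) v"
  shows "v \<in> sobolev 4" "sobolev_norm 4 v \<le> (\<Sum>\<^sub>\<infinity>m. \<bar>r (deg1 m) (deg2 m)\<bar> * X m)"
proof -
  have eq: "norm (deg_mult r W m) * (of_int (freq m) ^ 4 + 1) = \<bar>r (deg1 m) (deg2 m)\<bar> * X m" for m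
    by (simp add: deg_mult_def norm_mult)
  show "v \<in> sobolev 4" "sobolev_norm 4 v \<le> (\<Sum>\<^sub>\<infinity>m. \<bar>r (deg1 m) (deg2 m)\<bar> * X m)"
    using trig_sum_sobolev[OF v] deg_mult_summable[of r, OF r] by (simp_all add: eq)
qed

text \<open>The share of one bidegree in the total weighted mass: a summable majorant for the terms
  of the power series.\<close>

definition M :: "nat \<times> nat \<Rightarrow> real" where
  "M p = (\<Sum>\<^sub>\<infinity>m\<in>{m. (deg1 m, deg2 m) = p}. X m)"

lemma M_has_sum: "(M has_sum infsum X UNIV) UNIV"
  unfolding M_def by (rule has_sum_fibre[OF sum_W])

lemma infsum_of_bool_X: "(\<Sum>\<^sub>\<infinity>m. of_bool (P m) * X m) = infsum X {m. P m}"
  by (rule Infinite_Sum.infsum_cong_neutral) auto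

lemma infsum_tail:
  assumes "finite F"
  shows "infsum X {m. (deg1 m, deg2 m) \<notin> F} = infsum X UNIV - sum M F"
proof -
  have s: "X summable_on A" for A by (rule summable_on_subset_banach[OF sum_W]) auto
  have "infsum X {m. (deg1 m, deg2 m) \<notin> F} = infsum X (UNIV - {m. (deg1 m, deg2 m) \<in> F})"
    by (rule arg_cong[where f = "infsum X"]) auto
  also have "\<dots> = infsum X UNIV - infsum X {m. (deg1 m, deg2 m) \<in> F}"
    by (rule infsum_Diff[OF s s]) auto
  also have "infsum X {m. (deg1 m, deg2 m) \<in> F} = infsum X (\<Union>p\<in>F. {m. (deg1 m, deg2 m) = p})"
    by (rule arg_cong[where f = "infsum X"]) auto
  also have "\<dots> = sum M F"
    unfolding M_def by (rule sum_infsum[OF assms s, symmetric]) auto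
  finally show ?thesis .
qed

lemma mode_term_sobolev:
  assumes "\<delta> > 0"
  shows "trig_sum freq (deg_mult (\<lambda>j' l'. of_bool (j' = j \<and> l' = l) / \<delta> ^ (j + l)) W) (mode_term \<delta> W j l)"
    and "mode_term \<delta> W j l \<in> sobolev 4"
    and "sobolev_norm 4 (mode_term \<delta> W j l) \<le> M (j, l) / \<delta> ^ (j + l)"
proof -
  let ?r = "\<lambda>j' l'. of_bool (j' = j \<and> l' = l) / \<delta> ^ (j + l)"
  have r: "\<bar>?r j' l'\<bar> \<le> 1 / \<delta> ^ (j + l)" for j' l'
    using assms by (auto simp: of_bool_def)
  show t: "trig_sum freq (deg_mult ?r W) (mode_term \<delta> W j l)"
    unfolding mode_term_def by (rule trig_sum_deg_mult[OF r])
  show "mode_term \<delta> W j l \<in> sobolev 4" by (rule deg_mult_sobolev(1)[OF r t])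
  have "sobolev_norm 4 (mode_term \<delta> W j l) \<le> (\<Sum>\<^sub>\<infinity>m. \<bar>?r (deg1 m) (deg2 m)\<bar> * X m)"
    by (rule deg_mult_sobolev(2)[OF r t])
  also have "(\<lambda>m. \<bar>?r (deg1 m) (deg2 m)\<bar> * X m) = (\<lambda>m. of_bool ((deg1 m, deg2 m) = (j, l)) * X m / \<delta> ^ (j + l))"
    using assms by (auto simp: of_bool_def)
  also have "(\<Sum>\<^sub>\<infinity>m. of_bool ((deg1 m, deg2 m) = (j, l)) * X m / \<delta> ^ (j + l)) =
      (\<Sum>\<^sub>\<infinity>m. of_bool ((deg1 m, deg2 m) = (j, l)) * X m) / \<delta> ^ (j + l)"
    using infsum_cmult_left'[of "\<lambda>m. of_bool ((deg1 m, deg2 m) = (j, l)) * X m" "1 / \<delta> ^ (j + l)" UNIV] by simp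
  also have "\<dots> = M (j, l) / \<delta> ^ (j + l)"
    unfolding infsum_of_bool_X M_def by simp
  finally show "sobolev_norm 4 (mode_term \<delta> W j l) \<le> M (j, l) / \<delta> ^ (j + l)" .
qed

text \<open>Removing the bidegrees in a finite \<open>F\<close> leaves another degree multiplier,
  bounded by 1 and supported off \<open>F\<close>. The Sobolev norm of the remainder is therefore at
  most the mass of \<open>W\<close> off \<open>F\<close>, which tends to 0 because the total mass is
  finite.\<close>

lemma has_sobolev_power_series_modes:
  assumes \<delta>: "\<delta> > 0" "r \<le> \<delta>"
    and H: "\<And>\<epsilon>. \<epsilon> \<in> ball c r \<Longrightarrow>
      H \<epsilon> = synth (deg_mult (\<lambda>j l. ((\<epsilon>$1 - c$1) / \<delta>) ^ j * ((\<epsilon>$2 - c$2) / \<delta>) ^ l) W)"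
  shows "has_sobolev_power_series 4 H c r (mode_term \<delta> W)"
  unfolding has_sobolev_power_series_def
proof (intro conjI allI ballI)
  show "mode_term \<delta> W j l \<in> sobolev 4" for j l by (rule mode_term_sobolev[OF \<delta>(1)])
  fix \<epsilon> :: "real^2" assume \<epsilon>: "\<epsilon> \<in> ball c r"
  define x where "x = \<epsilon>$1 - c$1"
  define y where "y = \<epsilon>$2 - c$2"
  have xy: "\<bar>x\<bar> \<le> \<delta>" "\<bar>y\<bar> \<le> \<delta>"
    using component_le_norm_cart[of "\<epsilon> - c" 1] component_le_norm_cart[of "\<epsilon> - c" 2] \<epsilon> \<delta>
    by (auto simp: x_def y_def dist_norm norm_minus_commute)
  let ?r = "\<lambda>j l. (x / \<delta>) ^ j * (y / \<delta>) ^ l"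
  have r_le: "\<bar>?r j l\<bar> \<le> 1" for j l
    using xy \<delta>(1) by (simp add: abs_mult power_abs mult_le_one power_le_one)
  have H\<epsilon>: "H \<epsilon> = synth (deg_mult ?r W)" using H[OF \<epsilon>] by (simp add: x_def y_def)
  have tH: "trig_sum freq (deg_mult ?r W) (H \<epsilon>)"
    unfolding H\<epsilon> by (rule trig_sum_deg_mult[OF r_le])
  show "H \<epsilon> \<in> sobolev 4" by (rule deg_mult_sobolev(1)[OF r_le tH])
  have xy_pow: "\<bar>x\<bar> ^ j * \<bar>y\<bar> ^ l \<le> \<delta> ^ (j + l)" for j l
    using xy \<delta>(1) by (auto simp: power_add intro!: mult_mono power_mono)
  have bound: "sobolev_norm 4 (mode_term \<delta> W j l) * \<bar>x\<bar> ^ j * \<bar>y\<bar> ^ l \<le> M (j, l)" for j l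
  proof -
    have "sobolev_norm 4 (mode_term \<delta> W j l) * (\<bar>x\<bar> ^ j * \<bar>y\<bar> ^ l) \<le> M (j, l) / \<delta> ^ (j + l) * \<delta> ^ (j + l)"
      using mode_term_sobolev(3)[OF \<delta>(1), of j l] xy_pow \<delta>(1) sobolev_norm_nonneg[of 4 "mode_term \<delta> W j l"]
      by (intro mult_mono) (auto intro: order_trans)
    then show ?thesis using \<delta>(1) by (simp add: mult.assoc)
  qed
  show "(\<lambda>(j, l). sobolev_norm 4 (mode_term \<delta> W j l) * \<bar>\<epsilon>$1 - c$1\<bar> ^ j * \<bar>\<epsilon>$2 - c$2\<bar> ^ l) summable_on UNIV"
    by (rule summable_on_comparison_test[OF has_sum_imp_summable[OF M_has_sum]])
      (use bound in \<open>auto simp: x_def y_def sobolev_norm_nonneg\<close>)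
  let ?D = "\<lambda>F \<theta>. H \<epsilon> \<theta> - (\<Sum>(j, l)\<in>F. (\<epsilon>$1 - c$1) ^ j * (\<epsilon>$2 - c$2) ^ l * mode_term \<delta> W j l \<theta>)"
  have D: "sobolev_norm 4 (?D F) \<le> infsum X UNIV - sum M F" if F: "finite F" for F
  proof -
    let ?q = "\<lambda>j l. of_bool ((j, l) \<notin> F) * ?r j l"
    have q_le: "\<bar>?q j l\<bar> \<le> of_bool ((j, l) \<notin> F)" for j l
      using r_le by (auto simp: of_bool_def)
    then have q_le1: "\<bar>?q j l\<bar> \<le> 1" for j l
      by (rule order_trans) auto
    have "trig_sum freq (\<lambda>m. deg_mult ?r W m - (\<Sum>p\<in>F. of_real (x ^ fst p * y ^ snd p) *
          deg_mult (\<lambda>j' l'. of_bool (j' = fst p \<and> l' = snd p) / \<delta> ^ (fst p + snd p)) W m))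
        (\<lambda>\<theta>. H \<epsilon> \<theta> - (\<Sum>p\<in>F. x ^ fst p * y ^ snd p * mode_term \<delta> W (fst p) (snd p) \<theta>))"
      by (intro trig_sum_diff tH trig_sum_sum F trig_sum_scale mode_term_sobolev \<delta>)
    moreover have "deg_mult ?r W m - (\<Sum>p\<in>F. of_real (x ^ fst p * y ^ snd p) *
          deg_mult (\<lambda>j' l'. of_bool (j' = fst p \<and> l' = snd p) / \<delta> ^ (fst p + snd p)) W m) = deg_mult ?q W m" for m
    proof -
      \<comment> \<open>A mode has a single bidegree, so at most one member of \<open>F\<close>
        contributes, and there the powers of \<delta> recombine to \<open>?r\<close>.\<close>
      have "(\<Sum>p\<in>F. of_real (x ^ fst p * y ^ snd p) *
          deg_mult (\<lambda>j' l'. of_bool (j' = fst p \<and> l' = snd p) / \<delta> ^ (fst p + snd p)) W m) =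
        (\<Sum>p\<in>F. if p = (deg1 m, deg2 m) then deg_mult ?r W m else 0)"
        by (rule sum.cong) (auto simp: deg_mult_def power_divide power_add)
      then show ?thesis using F by (simp add: deg_mult_def)
    qed
    ultimately have "trig_sum freq (deg_mult ?q W) (?D F)"
      by (simp add: x_def y_def case_prod_beta)
    from deg_mult_sobolev(2)[OF q_le1 this]
    have "sobolev_norm 4 (?D F) \<le> (\<Sum>\<^sub>\<infinity>m. \<bar>?q (deg1 m) (deg2 m)\<bar> * X m)" .
    also have "\<dots> \<le> (\<Sum>\<^sub>\<infinity>m. of_bool ((deg1 m, deg2 m) \<notin> F) * X m)"
    proof (rule infsum_mono[OF deg_mult_summable[OF q_le1]])
      show "(\<lambda>m. of_bool ((deg1 m, deg2 m) \<notin> F) * X m) summable_on UNIV"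
        using deg_mult_summable[of "\<lambda>j l. of_bool ((j, l) \<notin> F)" 1] by simp
      show "\<bar>?q (deg1 m) (deg2 m)\<bar> * X m \<le> of_bool ((deg1 m, deg2 m) \<notin> F) * X m" for m
        by (rule mult_right_mono[OF q_le]) simp
    qed
    also have "\<dots> = infsum X UNIV - sum M F"
      unfolding infsum_of_bool_X by (rule infsum_tail[OF F])
    finally show ?thesis .
  qed
  have "((\<lambda>F. infsum X UNIV - sum M F) \<longlongrightarrow> infsum X UNIV - infsum X UNIV) (finite_subsets_at_top UNIV)"
    using M_has_sum unfolding has_sum_def by (intro tendsto_diff tendsto_const)
  then have lim: "((\<lambda>F. infsum X UNIV - sum M F) \<longlongrightarrow> 0) (finite_subsets_at_top UNIV)" by simp
  show "((\<lambda>F. sobolev_norm 4 (?D F)) \<longlongrightarrow> 0) (finite_subsets_at_top UNIV)"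
  proof (rule tendsto_sandwich[OF _ _ tendsto_const lim])
    show "\<forall>\<^sub>F F in finite_subsets_at_top UNIV. 0 \<le> sobolev_norm 4 (?D F)"
      by (simp add: sobolev_norm_nonneg)
    show "\<forall>\<^sub>F F in finite_subsets_at_top UNIV. sobolev_norm 4 (?D F) \<le> infsum X UNIV - sum M F"
      by (rule eventually_finite_subsets_at_top_weakI) (rule D)
  qed
qed

end

section \<open>Solutions from the mode algebra and their low-order terms\<close>

lemma resolvent_gain:
  fixes g :: "mode wiener"
  assumes b: "b > 0"
  shows "(\<lambda>m. norm (coeff (resolvent 0 b freq g) m) * (of_int (freq m) ^ 4 + 1)) summable_on UNIV"
    and "(\<Sum>\<^sub>\<infinity>m. norm (coeff (resolvent 0 b freq g) m) * (of_int (freq m) ^ 4 + 1)) \<le> norm g / symbol_bound b"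
proof -
  have le: "norm (coeff (resolvent 0 b freq g) m) * (of_int (freq m) ^ 4 + 1) \<le>
      norm (coeff g m) * wt m * (1 / symbol_bound b)" for m
  proof -
    let ?n = "\<bar>of_int (freq m) :: real\<bar>"
    \<comment> \<open>Of the four powers of the frequency one is paid by the weight of
      \<open>g\<close>, three by the symbol.\<close>
    have "?n ^ 4 + 1 \<le> (1 + ?n) * (1 + ?n ^ 3)"
      by (simp add: power4_eq_xxxx power3_eq_cube distrib_left distrib_right)
    then have "norm (complex_of_real (of_int (freq m) ^ 4 + 1)) \<le> wt m * (1 + ?n ^ 3)"
      by (simp add: wt_mode_def del: of_real_add)
    then have "norm (complex_of_real (of_int (freq m) ^ 4 + 1) / steady_symbol b (freq m)) \<le> wt m / symbol_bound b"
      by (rule norm_div_steady_symbol_le[OF b]) simp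
    then have "norm (coeff g m) * norm (complex_of_real (of_int (freq m) ^ 4 + 1) / steady_symbol b (freq m))
        \<le> norm (coeff g m) * (wt m / symbol_bound b)"
      by (rule mult_left_mono) simp
    then show ?thesis
      by (simp add: coeff_resolvent[OF b] norm_divide norm_mult mult_ac del: of_real_add)
  qed
  have s: "(\<lambda>m. norm (coeff g m) * wt m * (1 / symbol_bound b)) summable_on UNIV"
    by (rule summable_on_cmult_left[OF coeff_summable])
  show s': "(\<lambda>m. norm (coeff (resolvent 0 b freq g) m) * (of_int (freq m) ^ 4 + 1)) summable_on UNIV"
    by (rule summable_on_comparison_test[OF s le]) simp
  have "(\<Sum>\<^sub>\<infinity>m. norm (coeff (resolvent 0 b freq g) m) * (of_int (freq m) ^ 4 + 1)) \<le>
      (\<Sum>\<^sub>\<infinity>m. norm (coeff g m) * wt m * (1 / symbol_bound b))"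
    by (rule infsum_mono[OF s' s le])
  also have "\<dots> = norm g / symbol_bound b"
    by (subst infsum_cmult_left') (simp add: norm_wiener_def)
  finally show "(\<Sum>\<^sub>\<infinity>m. norm (coeff (resolvent 0 b freq g) m) * (of_int (freq m) ^ 4 + 1)) \<le> norm g / symbol_bound b" .
qed

text \<open>The final 4 matches \<open>mode_fixpoint\<close> with \<open>\<rho>\<close> equal to
  four times this radius. The second entry of the minimum brings the norm of H - 1, at most that of
  \<open>g\<close> divided by \<open>symbol_bound b\<close>, down to half the uniqueness radius,
  hence strictly inside it.\<close>

definition existence_radius :: "real \<Rightarrow> real" where
  "existence_radius b = min (steady_radius b) (symbol_bound b * uniqueness_radius b / 2) / 4"

lemma existence_radius_pos: "b > 0 \<Longrightarrow> existence_radius b > 0"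
  unfolding existence_radius_def
  using steady_radius_pos[of b] symbol_bound_pos[of b] uniqueness_radius_pos[of b] by simp

abbreviation mode_solution :: "real \<Rightarrow> real^2 \<Rightarrow> (mode \<Rightarrow> complex) \<Rightarrow> real^2 \<Rightarrow> real \<Rightarrow> real" where
  "mode_solution \<delta> c W \<epsilon> \<equiv>
     synth (deg_mult (\<lambda>j l. ((\<epsilon>$1 - c$1) / \<delta>) ^ j * ((\<epsilon>$2 - c$2) / \<delta>) ^ l) W)"

text \<open>One family \<open>W\<close> serves the whole square around \<open>c\<close>: evaluation
  at the scaled increments turns a single algebraic fixed point into a solution for each
  \<epsilon>.\<close>

lemma mode_solution_exists:
  assumes b: "b > 0" and c: "\<bar>c$1\<bar> \<le> existence_radius b" "\<bar>c$2\<bar> \<le> existence_radius b"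
  shows "\<exists>W. real_modes W \<and>
     (\<forall>\<epsilon>. \<bar>\<epsilon>$1 - c$1\<bar> \<le> existence_radius b \<longrightarrow> \<bar>\<epsilon>$2 - c$2\<bar> \<le> existence_radius b \<longrightarrow>
        solution_near_one b (uniqueness_radius b) \<epsilon> (mode_solution (existence_radius b) c W \<epsilon>)) \<and>
     (c = 0 \<longrightarrow> (\<forall>m. total_deg m < 2 \<longrightarrow> W m = coeff (1 + mode_e1 0 (existence_radius b)) m))"
proof -
  define \<delta> where "\<delta> = existence_radius b"
  have \<delta>: "\<delta> > 0" using existence_radius_pos[OF b] by (simp add: \<delta>_def)
  have \<delta>4: "4 * \<delta> \<le> steady_radius b" "4 * \<delta> \<le> symbol_bound b * uniqueness_radius b / 2"
    by (simp_all add: \<delta>_def existence_radius_def)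
  let ?e1 = "mode_e1 (c$1) \<delta>" and ?e2 = "mode_e2 (c$2) \<delta>"
  obtain g where g: "g \<in> real_elts" "norm g \<le> 4 * \<delta>" "steady_op b freq ?e1 ?e2 g = g"
      "c$1 = 0 \<and> c$2 = 0 \<Longrightarrow> g - ?e1 \<in> deg_ge 2"
    using mode_fixpoint[OF b \<delta>4(1), of \<delta> "c$1" "c$2"] c \<delta> by (auto simp: \<delta>_def)
  define W where "W = coeff (1 + resolvent 0 b freq g)"
  have W: "W m = of_bool (m = 0) + coeff (resolvent 0 b freq g) m" for m
    by (simp add: W_def coeff_simps)
  have rm: "real_modes W"
  proof
    show "W (flip m) = cnj (W m)" for m
      using real_elts_arith(1)[OF real_elts_arith(5) real_elts_resolvent[OF b _ g(1), of 0]]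
      by (simp add: W_def real_elts_def)
    have "(\<lambda>m::mode. of_bool (m = 0) * 1 :: real) summable_on UNIV"
      by (rule finite_nonzero_values_imp_summable_on) simp
    from summable_on_add[OF this resolvent_gain(1)[OF b, of g]]
    show "(\<lambda>m. norm (W m) * (of_int (freq m) ^ 4 + 1)) summable_on UNIV"
    proof (rule summable_on_comparison_test)
      fix m
      have "norm (W m) * (of_int (freq m) ^ 4 + 1) \<le>
          (norm (of_bool (m = 0) :: complex) + norm (coeff (resolvent 0 b freq g) m)) * (of_int (freq m) ^ 4 + 1)"
        unfolding W by (intro mult_right_mono norm_triangle_ineq) simp
      then show "norm (W m) * (of_int (freq m) ^ 4 + 1) \<le> of_bool (m = 0) * 1 +
          norm (coeff (resolvent 0 b freq g) m) * (of_int (freq m) ^ 4 + 1)"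
        by (auto simp: distrib_right of_bool_def split: if_splits)
    qed simp
  qed
  have sol: "solution_near_one b (uniqueness_radius b) \<epsilon> (mode_solution \<delta> c W \<epsilon>)"
    if \<epsilon>: "\<bar>\<epsilon>$1 - c$1\<bar> \<le> \<delta>" "\<bar>\<epsilon>$2 - c$2\<bar> \<le> \<delta>" for \<epsilon>
  proof -
    define s where "s = (\<epsilon>$1 - c$1) / \<delta>"
    define t where "t = (\<epsilon>$2 - c$2) / \<delta>"
    have st: "\<bar>s\<bar> \<le> 1" "\<bar>t\<bar> \<le> 1" using \<epsilon> \<delta> by (simp_all add: s_def t_def)
    interpret circle_weights freq "param_weight s t" by (rule circle_weights_mode[OF st])
    interpret real_modes W by (rule rm)
    let ?r = "\<lambda>j l. s ^ j * t ^ l"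
    let ?h = "synth (deg_mult ?r W)"
    have r: "\<bar>?r j l\<bar> \<le> 1" for j l
      using st by (simp add: abs_mult power_abs mult_le_one power_le_one)
    have th: "trig_sum freq (deg_mult ?r W) ?h" by (rule trig_sum_deg_mult[OF r])
    have dm: "deg_mult ?r W m = coeff (1 + resolvent 0 b freq g) m * param_weight s t m" for m
      by (simp add: deg_mult_def param_weight_def W_def)
    have rep_h: "rep (1 + resolvent 0 b freq g) ?h"
      using th by (simp add: rep_iff_trig_sum dm[abs_def])
    have eq: "c$1 + \<delta> * s = \<epsilon>$1" "c$2 + \<delta> * t = \<epsilon>$2"
      using \<delta> by (simp_all add: s_def t_def)
    have "steady_state b \<epsilon> ?h"
      by (rule steady_map_fixpoint_rep[OF b g(3) rep_h rep_mode_e(1)[OF st, of "c$1" \<delta>, unfolded eq]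
        rep_mode_e(2)[OF st, of "c$2" \<delta>, unfolded eq]])
    moreover have "?h \<in> sobolev 4" by (rule deg_mult_sobolev(1)[OF r th])
    moreover have "sobolev_norm 4 (\<lambda>\<theta>. ?h \<theta> - 1) < uniqueness_radius b"
    proof -
      let ?c = "\<lambda>m. coeff (resolvent 0 b freq g) m * param_weight s t m"
      have "rep (resolvent 0 b freq g) (\<lambda>\<theta>. ?h \<theta> - 1)"
        using rep_h by (simp add: rep_def ch.ev_simps algebra_simps)
      then have t1: "trig_sum freq ?c (\<lambda>\<theta>. ?h \<theta> - 1)" by (simp add: rep_iff_trig_sum)
      have le: "norm (?c m) * (of_int (freq m) ^ 4 + 1) \<le>
          norm (coeff (resolvent 0 b freq g) m) * (of_int (freq m) ^ 4 + 1)" for m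
        using norm_param_weight_le[OF st, of m]
        by (intro mult_right_mono) (auto simp: norm_mult mult_left_le)
      have sc: "(\<lambda>m. norm (?c m) * (of_int (freq m) ^ 4 + 1)) summable_on UNIV"
        by (rule summable_on_comparison_test[OF resolvent_gain(1)[OF b, of g] le]) simp
      have "sobolev_norm 4 (\<lambda>\<theta>. ?h \<theta> - 1) \<le> (\<Sum>\<^sub>\<infinity>m. norm (?c m) * (of_int (freq m) ^ 4 + 1))"
        by (rule trig_sum_sobolev(2)[OF t1 sc])
      also have "\<dots> \<le> norm g / symbol_bound b"
        using infsum_mono[OF sc resolvent_gain(1)[OF b, of g] le] resolvent_gain(2)[OF b, of g] by linarith
      also have "\<dots> \<le> (symbol_bound b * uniqueness_radius b / 2) / symbol_bound b"
        using g(2) \<delta>4(2) symbol_bound_pos[OF b] by (intro divide_right_mono) auto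
      also have "\<dots> < uniqueness_radius b"
        using symbol_bound_pos[OF b] uniqueness_radius_pos[OF b] by simp
      finally show ?thesis .
    qed
    ultimately show ?thesis by (simp add: solution_near_one_def s_def t_def)
  qed
  \<comment> \<open>Below degree 2 \<open>g\<close> coincides with the forcing, whose frequencies
    are 1 and -1, where division by the symbol changes nothing.\<close>
  have low: "W m = coeff (1 + mode_e1 0 \<delta>) m" if "c = 0" "total_deg m < 2" for m
  proof -
    have "coeff g m = coeff (mode_e1 0 \<delta>) m"
      using g(4) that by (simp add: deg_ge_def coeff_simps)
    moreover have "coeff (mode_e1 0 \<delta>) m / steady_symbol b (freq m) = coeff (mode_e1 0 \<delta>) m"
    proof (cases "\<bar>freq m\<bar> \<le> 1")
      case True
      then show ?thesis by (simp add: steady_symbol_unit)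
    next
      case False
      then have "coeff (mode_e1 0 \<delta>) m = 0"
        by (auto simp: mode_e1_def cosine_elt_def coeff_simps single.rep_eq)
      then show ?thesis by simp
    qed
    ultimately show ?thesis by (simp add: W coeff_resolvent[OF b] coeff_simps)
  qed
  show ?thesis using rm sol low unfolding \<delta>_def by blast
qed

lemma
  assumes rm: "real_modes W" and \<delta>: "\<delta> > 0"
    and low: "\<And>m. total_deg m < 2 \<Longrightarrow> W m = coeff (1 + mode_e1 0 \<delta>) m"
  shows mode_term_0_0: "mode_term \<delta> W 0 0 = (\<lambda>\<theta>. 1)"
    and mode_term_1_0: "mode_term \<delta> W 1 0 = (\<lambda>\<theta>. cos \<theta> / 3)"
    and mode_term_0_1: "mode_term \<delta> W 0 1 = (\<lambda>\<theta>. 0)"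
    and mode_solution_first_order: "\<And>\<epsilon>. norm \<epsilon> \<le> \<delta> \<Longrightarrow>
      sobolev_norm 4 (\<lambda>\<theta>. mode_solution \<delta> 0 W \<epsilon> \<theta> - (1 + \<epsilon>$1 / 3 * cos \<theta>)) \<le>
        (\<Sum>\<^sub>\<infinity>m. norm (W m) * (of_int (freq m) ^ 4 + 1)) / \<delta>\<^sup>2 * (norm \<epsilon>)\<^sup>2"
proof -
  interpret real_modes W by (rule rm)
  have cosine: "coeff (cosine_elt i j x) m = of_real (x / 2) * (of_bool (m = i) + of_bool (m = j))" for i j x m
    by (simp add: cosine_elt_def coeff_simps single.rep_eq)
  have e1: "coeff (1 + mode_e1 0 \<delta>) m = of_bool (m = 0) +
      of_real (\<delta> / 6) * (of_bool (m = Mode 1 1 0) + of_bool (m = Mode (-1) 1 0))" for m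
    by (simp add: mode_e1_def cosine_elt_def coeff_simps single.rep_eq)
  show "mode_term \<delta> W 0 0 = (\<lambda>\<theta>. 1)"
  proof (rule trig_sum_unique[OF mode_term_sobolev(1)[OF \<delta>]])
    have "deg_mult (\<lambda>j' l'. of_bool (j' = 0 \<and> l' = 0) / \<delta> ^ (0 + 0)) W m = of_bool (m = 0)" for m
      using low[of m] by (cases m) (force simp: deg_mult_def e1 total_deg_def zero_mode_def)
    then have eq: "deg_mult (\<lambda>j' l'. of_bool (j' = 0 \<and> l' = 0) / \<delta> ^ (0 + 0)) W = (\<lambda>m. of_bool (m = 0))"
      by (rule ext)
    show "trig_sum freq (deg_mult (\<lambda>j' l'. of_bool (j' = 0 \<and> l' = 0) / \<delta> ^ (0 + 0)) W) (\<lambda>\<theta>. 1)"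
      unfolding eq by (rule trig_sum_const) simp
  qed
  show "mode_term \<delta> W 1 0 = (\<lambda>\<theta>. cos \<theta> / 3)"
  proof (rule trig_sum_unique[OF mode_term_sobolev(1)[OF \<delta>]])
    interpret circle_weights freq "param_weight 1 1" by (rule circle_weights_mode) auto
    have "rep (cosine_elt (Mode 1 1 0) (Mode (-1) 1 0) (1 / 3)) (\<lambda>\<theta>. 1 * (1 / 3) * cos \<theta>)"
      by (rule rep_trig_elts) (auto simp: param_weight_def)
    moreover have eq: "deg_mult (\<lambda>j' l'. of_bool (j' = 1 \<and> l' = 0) / \<delta> ^ (1 + 0)) W =
        (\<lambda>m. coeff (cosine_elt (Mode 1 1 0) (Mode (-1) 1 0) (1 / 3)) m * param_weight 1 1 m)"
    proof
      fix m
      show "deg_mult (\<lambda>j' l'. of_bool (j' = 1 \<and> l' = 0) / \<delta> ^ (1 + 0)) W m =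
        coeff (cosine_elt (Mode 1 1 0) (Mode (-1) 1 0) (1 / 3)) m * param_weight 1 1 m"
        using low[of m] \<delta>
        by (cases m) (force simp: deg_mult_def e1 total_deg_def zero_mode_def cosine param_weight_def)
    qed
    ultimately show "trig_sum freq (deg_mult (\<lambda>j' l'. of_bool (j' = 1 \<and> l' = 0) / \<delta> ^ (1 + 0)) W) (\<lambda>\<theta>. cos \<theta> / 3)"
      unfolding eq by (simp add: rep_iff_trig_sum)
  qed
  show "mode_term \<delta> W 0 1 = (\<lambda>\<theta>. 0)"
  proof (rule trig_sum_unique[OF mode_term_sobolev(1)[OF \<delta>]])
    have "deg_mult (\<lambda>j' l'. of_bool (j' = 0 \<and> l' = 1) / \<delta> ^ (0 + 1)) W m = 0" for m
      using low[of m] by (cases m) (auto simp: deg_mult_def e1 total_deg_def zero_mode_def)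
    then have eq: "deg_mult (\<lambda>j' l'. of_bool (j' = 0 \<and> l' = 1) / \<delta> ^ (0 + 1)) W = (\<lambda>_. 0)"
      by (rule ext)
    show "trig_sum freq (deg_mult (\<lambda>j' l'. of_bool (j' = 0 \<and> l' = 1) / \<delta> ^ (0 + 1)) W) (\<lambda>\<theta>. 0)"
      unfolding eq by (rule trig_sum_zero)
  qed
  fix \<epsilon> :: "real^2" assume \<epsilon>: "norm \<epsilon> \<le> \<delta>"
  define s where "s = \<epsilon>$1 / \<delta>"
  define t where "t = \<epsilon>$2 / \<delta>"
  define q where "q = norm \<epsilon> / \<delta>"
  have q: "0 \<le> q" "q \<le> 1" using \<epsilon> \<delta> by (simp_all add: q_def)
  have stq: "\<bar>s\<bar> \<le> q" "\<bar>t\<bar> \<le> q"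
    using component_le_norm_cart[of \<epsilon> 1] component_le_norm_cart[of \<epsilon> 2] \<delta>
    by (simp_all add: s_def t_def q_def divide_right_mono)
  then have st: "\<bar>s\<bar> \<le> 1" "\<bar>t\<bar> \<le> 1" using q by auto
  interpret circle_weights freq "param_weight s t" by (rule circle_weights_mode[OF st])
  let ?r = "\<lambda>j l. s ^ j * t ^ l"
  \<comment> \<open>Degrees 0 and 1 of \<open>W\<close> form exactly the claimed approximation. What
    remains has degree at least 2, where s^j t^l is at most q^2 in absolute value since q \<le>
    1.\<close>
  let ?r2 = "\<lambda>j l. of_bool (j + l \<ge> 2) * (s ^ j * t ^ l)"
  have r: "\<bar>?r j l\<bar> \<le> q ^ (j + l)" for j l
    using stq q by (auto simp: abs_mult power_abs power_add intro!: mult_mono power_mono)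
  have r1: "\<bar>?r j l\<bar> \<le> 1" for j l
    using r[of j l] power_le_one[OF q, of "j + l"] by linarith
  have r2: "\<bar>?r2 j l\<bar> \<le> q\<^sup>2" for j l
    using r[of j l] power_decreasing[of 2 "j + l" q] q by (auto simp: of_bool_def)
  let ?D = "\<lambda>\<theta>. mode_solution \<delta> 0 W \<epsilon> \<theta> - (1 + \<epsilon>$1 / 3 * cos \<theta>)"
  have "rep (1 + mode_e1 0 \<delta>) (\<lambda>\<theta>. 1 + (0 + \<delta> * s) * cos \<theta> / 3)"
    by (intro rep_add rep_mode_e st) (simp add: rep_def ch.ev_simps)
  then have "rep (1 + mode_e1 0 \<delta>) (\<lambda>\<theta>. 1 + \<epsilon>$1 / 3 * cos \<theta>)"
    using \<delta> by (simp add: s_def)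
  then have "trig_sum freq (\<lambda>m. deg_mult ?r W m - coeff (1 + mode_e1 0 \<delta>) m * param_weight s t m) ?D"
    using trig_sum_deg_mult[OF r1] unfolding rep_iff_trig_sum
    by (intro trig_sum_diff) (simp_all add: s_def t_def)
  moreover have "deg_mult ?r W m - coeff (1 + mode_e1 0 \<delta>) m * param_weight s t m = deg_mult ?r2 W m" for m
  proof (cases "total_deg m < 2")
    case True
    then show ?thesis by (simp add: low deg_mult_def param_weight_def total_deg_def)
  next
    case False
    then have "coeff (1 + mode_e1 0 \<delta>) m = 0"
      by (auto simp: e1 total_deg_def)
    with False show ?thesis by (simp add: deg_mult_def total_deg_def)
  qed
  ultimately have D: "trig_sum freq (deg_mult ?r2 W) ?D" by simp
  have "sobolev_norm 4 ?D \<le> (\<Sum>\<^sub>\<infinity>m. \<bar>?r2 (deg1 m) (deg2 m)\<bar> * X m)"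
    by (rule deg_mult_sobolev(2)[OF r2 D])
  also have "\<dots> \<le> (\<Sum>\<^sub>\<infinity>m. q\<^sup>2 * X m)"
    by (intro infsum_mono deg_mult_summable[of ?r2, OF r2] summable_on_cmult_right sum_W mult_right_mono r2) simp
  also have "\<dots> = infsum X UNIV / \<delta>\<^sup>2 * (norm \<epsilon>)\<^sup>2"
    unfolding infsum_cmult_right' by (simp add: q_def power_divide)
  finally show "sobolev_norm 4 ?D \<le> infsum X UNIV / \<delta>\<^sup>2 * (norm \<epsilon>)\<^sup>2" .
qed

lemma steady_state_min_abs_pos:
  assumes h: "h \<in> sobolev 4" and st: "steady_state b \<epsilon> h"
  shows "\<exists>\<theta>\<^sub>0. (\<forall>\<theta>. \<bar>h \<theta>\<^sub>0\<bar> \<le> \<bar>h \<theta>\<bar>) \<and> \<bar>h \<theta>\<^sub>0\<bar> > 0"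
proof -
  have c: "continuous_on UNIV h" and per: "\<And>\<theta>. h (\<theta> + 2 * pi) = h \<theta>"
    using h by (auto simp: sobolev_def)
  have "continuous_on {0..2 * pi} (\<lambda>\<theta>. \<bar>h \<theta>\<bar>)"
    by (intro continuous_intros continuous_on_subset[OF c]) simp
  moreover have "{0..2 * pi} \<noteq> {}" by simp
  ultimately obtain \<theta>\<^sub>0 where \<theta>\<^sub>0: "\<And>t. t \<in> {0..2 * pi} \<Longrightarrow> \<bar>h \<theta>\<^sub>0\<bar> \<le> \<bar>h t\<bar>"
    using continuous_attains_inf[OF compact_Icc] by metis
  have "h \<theta>\<^sub>0 \<noteq> 0"
  proof
    assume "h \<theta>\<^sub>0 = 0"
    with st[unfolded steady_state_def, rule_format, of \<theta>\<^sub>0] show False by simp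
  qed
  moreover have "\<bar>h \<theta>\<^sub>0\<bar> \<le> \<bar>h \<theta>\<bar>" for \<theta>
    using periodic_representative[of h \<theta>, OF per] \<theta>\<^sub>0 by metis
  ultimately show ?thesis by auto
qed

theorem theorem2p1:
  fixes b :: real
  assumes "b > 0"
  shows "\<exists>\<delta>\<^sub>0>0. \<exists>\<delta>\<^sub>1>0. \<exists>H :: real^2 \<Rightarrow> real \<Rightarrow> real.
     (\<forall>\<epsilon>\<in>ball 0 \<delta>\<^sub>0. solution_near_one b \<delta>\<^sub>1 \<epsilon> (H \<epsilon>) \<and>
        (\<forall>h. solution_near_one b \<delta>\<^sub>1 \<epsilon> h \<longrightarrow> h = H \<epsilon>)) \<and>
     sobolev_real_analytic_on 4 H (ball 0 \<delta>\<^sub>0) \<and>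
     (\<forall>\<epsilon>\<in>ball 0 \<delta>\<^sub>0. \<exists>\<theta>\<^sub>0. (\<forall>\<theta>. \<bar>H \<epsilon> \<theta>\<^sub>0\<bar> \<le> \<bar>H \<epsilon> \<theta>\<bar>) \<and> \<bar>H \<epsilon> \<theta>\<^sub>0\<bar> > 0) \<and>
     (\<exists>r>0. \<exists>a. has_sobolev_power_series 4 H 0 r a \<and>
        a 0 0 = (\<lambda>\<theta>. 1) \<and> a 1 0 = (\<lambda>\<theta>. cos \<theta> / 3) \<and> a 0 1 = (\<lambda>\<theta>. 0)) \<and>
     (\<lambda>\<epsilon>. sobolev_norm 4 (\<lambda>\<theta>. H \<epsilon> \<theta> - (1 + \<epsilon>$1 / 3 * cos \<theta>)))
       \<in> O[at 0](\<lambda>\<epsilon>. (norm \<epsilon>)\<^sup>2)"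
proof -
  note b = assms
  define \<delta> where "\<delta> = existence_radius b"
  define \<delta>\<^sub>1 where "\<delta>\<^sub>1 = uniqueness_radius b"
  have \<delta>: "\<delta> > 0" and \<delta>\<^sub>1: "\<delta>\<^sub>1 > 0"
    using existence_radius_pos[OF b] uniqueness_radius_pos[OF b] by (simp_all add: \<delta>_def \<delta>\<^sub>1_def)
  have "4 * \<delta> \<le> steady_radius b" by (simp add: \<delta>_def existence_radius_def)
  then have \<delta>_le: "\<delta> \<le> steady_radius b" using \<delta> by linarith
  have comp: "\<bar>\<epsilon>$1 - c$1\<bar> \<le> r" "\<bar>\<epsilon>$2 - c$2\<bar> \<le> r" if "\<epsilon> \<in> ball c r" for \<epsilon> c :: "real^2" and r
    using component_le_norm_cart[of "\<epsilon> - c" 1] component_le_norm_cart[of "\<epsilon> - c" 2] that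
    by (auto simp: dist_norm norm_minus_commute)
  have comp0: "\<bar>\<epsilon>$1\<bar> \<le> \<delta>" "\<bar>\<epsilon>$2\<bar> \<le> \<delta>" if "\<epsilon> \<in> ball 0 \<delta>" for \<epsilon> :: "real^2"
    using comp[OF that] by simp_all
  have unique: "h = k" if "\<epsilon> \<in> ball 0 \<delta>" "solution_near_one b \<delta>\<^sub>1 \<epsilon> h" "solution_near_one b \<delta>\<^sub>1 \<epsilon> k" for \<epsilon> h k
    using solution_near_one_unique[OF b _ _ that(2,3)[unfolded \<delta>\<^sub>1_def]] comp0[OF that(1)] \<delta>_le by force
  obtain W where W: "real_modes W"
    and W_sol: "\<And>\<epsilon>. \<epsilon> \<in> ball 0 \<delta> \<Longrightarrow> solution_near_one b \<delta>\<^sub>1 \<epsilon> (mode_solution \<delta> 0 W \<epsilon>)"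
    and W_low: "\<And>m. total_deg m < 2 \<Longrightarrow> W m = coeff (1 + mode_e1 0 \<delta>) m"
    using mode_solution_exists[OF b, of 0] \<delta> comp0 unfolding \<delta>_def[symmetric] \<delta>\<^sub>1_def[symmetric] by auto
  define H where "H = mode_solution \<delta> 0 W"
  have H_sol: "solution_near_one b \<delta>\<^sub>1 \<epsilon> (H \<epsilon>)" if "\<epsilon> \<in> ball 0 \<delta>" for \<epsilon>
    using W_sol[OF that] by (simp add: H_def)
  \<comment> \<open>\<open>W\<close> expands \<open>H\<close> at 0 only. At \<open>c\<close> a fresh
    fixed point yields coefficients \<open>V\<close>, and uniqueness identifies its sums with
    \<open>H\<close>; the radius \<open>\<delta> - norm c\<close> keeps \<epsilon> inside the ball
    where uniqueness is available.\<close>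
  have series: "\<exists>a. has_sobolev_power_series 4 H c (\<delta> - norm c) a" if c: "c \<in> ball 0 \<delta>" for c
  proof -
    obtain V where V: "real_modes V" and V_sol: "\<And>\<epsilon>. \<bar>\<epsilon>$1 - c$1\<bar> \<le> \<delta> \<Longrightarrow> \<bar>\<epsilon>$2 - c$2\<bar> \<le> \<delta> \<Longrightarrow>
        solution_near_one b \<delta>\<^sub>1 \<epsilon> (mode_solution \<delta> c V \<epsilon>)"
      using mode_solution_exists[OF b, of c] comp0[OF c] unfolding \<delta>_def[symmetric] \<delta>\<^sub>1_def[symmetric] by auto
    have "H \<epsilon> = mode_solution \<delta> c V \<epsilon>" if \<epsilon>: "\<epsilon> \<in> ball c (\<delta> - norm c)" for \<epsilon>
    proof -
      have in_ball: "\<epsilon> \<in> ball 0 \<delta>"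
        using \<epsilon> norm_triangle_ineq2[of \<epsilon> c] by (simp add: dist_norm norm_minus_commute)
      have "\<bar>\<epsilon>$1 - c$1\<bar> \<le> \<delta>" "\<bar>\<epsilon>$2 - c$2\<bar> \<le> \<delta>"
        using comp[OF \<epsilon>] norm_ge_zero[of c] by linarith+
      then show ?thesis using unique[OF in_ball H_sol[OF in_ball]] V_sol by blast
    qed
    then have "has_sobolev_power_series 4 H c (\<delta> - norm c) (mode_term \<delta> V)"
      by (intro real_modes.has_sobolev_power_series_modes[OF V \<delta>]) auto
    then show ?thesis by blast
  qed
  have "sobolev_real_analytic_on 4 H (ball 0 \<delta>)"
    unfolding sobolev_real_analytic_on_def
  proof
    fix c :: "real^2" assume c: "c \<in> ball 0 \<delta>"
    have "ball c (\<delta> - norm c) \<subseteq> ball 0 \<delta>"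
      by (simp add: ball_subset_ball_iff)
    with series[OF c] c show "\<exists>r>0. ball c r \<subseteq> ball 0 \<delta> \<and> (\<exists>a. has_sobolev_power_series 4 H c r a)"
      by (intro exI[of _ "\<delta> - norm c"]) auto
  qed
  moreover have "has_sobolev_power_series 4 H 0 \<delta> (mode_term \<delta> W)"
    by (rule real_modes.has_sobolev_power_series_modes[OF W \<delta> order_refl]) (simp add: H_def)
  moreover have "(\<lambda>\<epsilon>. sobolev_norm 4 (\<lambda>\<theta>. H \<epsilon> \<theta> - (1 + \<epsilon>$1 / 3 * cos \<theta>))) \<in> O[at 0](\<lambda>\<epsilon>. (norm \<epsilon>)\<^sup>2)"
  proof (rule bigoI)
    have "\<forall>\<^sub>F \<epsilon> :: real^2 in at 0. \<epsilon> \<in> ball 0 \<delta>"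
      unfolding eventually_at using \<delta> by (intro exI[of _ \<delta>]) (simp add: dist_commute)
    then show "\<forall>\<^sub>F \<epsilon> in at 0. norm (sobolev_norm 4 (\<lambda>\<theta>. H \<epsilon> \<theta> - (1 + \<epsilon>$1 / 3 * cos \<theta>))) \<le>
        (\<Sum>\<^sub>\<infinity>m. norm (W m) * (of_int (freq m) ^ 4 + 1)) / \<delta>\<^sup>2 * norm ((norm \<epsilon>)\<^sup>2)"
      by eventually_elim
        (use mode_solution_first_order[OF W \<delta> W_low] in \<open>simp add: H_def sobolev_norm_nonneg\<close>)
  qed
  moreover have "\<forall>\<epsilon>\<in>ball 0 \<delta>. \<exists>\<theta>\<^sub>0. (\<forall>\<theta>. \<bar>H \<epsilon> \<theta>\<^sub>0\<bar> \<le> \<bar>H \<epsilon> \<theta>\<bar>) \<and> \<bar>H \<epsilon> \<theta>\<^sub>0\<bar> > 0"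
    using H_sol steady_state_min_abs_pos[of "H _" b] unfolding solution_near_one_def by blast
  moreover have "\<forall>\<epsilon>\<in>ball 0 \<delta>. solution_near_one b \<delta>\<^sub>1 \<epsilon> (H \<epsilon>) \<and>
      (\<forall>h. solution_near_one b \<delta>\<^sub>1 \<epsilon> h \<longrightarrow> h = H \<epsilon>)"
    using H_sol unique by blast
  ultimately show ?thesis
    using \<delta> \<delta>\<^sub>1 mode_term_0_0[OF W \<delta> W_low] mode_term_1_0[OF W \<delta> W_low] mode_term_0_1[OF W \<delta> W_low]
    by blast
qed

end
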